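(* Let $\sigma>1$, let $n\ge 1$ be an integer and let $a\ge 0$. Then the Sobolev solutions $u$ to the Cauchy problem $$u_{tt}+(-\Delta)^\sigma u+(-\Delta)^\sigma u_t=0,\quad x\in\mathbb{R}^n,\ t\ge 0,\qquad u(0,x)=u_0(x),\quad u_t(0,x)=u_1(x),$$ satisfy the following $L^1$-$L^1$ estimates: $$\big\||D|^a u(t,\cdot)\big\|_{L^1}\lesssim (1+t)^{\frac12\left(2+\left[\frac n2\right]\right)-\frac{a}{2\sigma}}\|u_0\|_{H^a_1}+(1+t)^{1+\frac12\left(1+\left[\frac n2\right]\right)-\frac{a}{2\sigma}}\|u_1\|_{H^{[a-\sigma]^+}_1},$$ $$\big\||D|^a u_t(t,\cdot)\big\|_{L^1}\lesssim (1+t)^{\frac12\left(1+\left[\frac n2\right]\right)-\frac{a}{2\sigma}}\|u_0\|_{H^{2\sigma+[a-\sigma]^+}_1}+(1+t)^{\frac12\left(2+\left[\frac n2\right]\right)-\frac{a}{2\sigma}}\|u_1\|_{H^{2\sigma+[a-\sigma]^+}_1}.$$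
   Context: Notation. $f\lesssim g$ means that there is a constant $C>0$ with $f\le Cg$; here $C$ does not depend on $t$ or on the data $u_0,u_1$ (it may depend on $n,\sigma,a$). For $s\in\mathbb{R}$, $[s]=\max\{k\in\mathbb{Z}: k\le s\}$ is the integer part, while $[s]^+=\max\{s,0\}$ is the positive part (no integer part is taken in $[s]^+$). $|D|^a$ and $\langle D\rangle^a$ are the Fourier multiplier operators with symbols $|\xi|^a$ and $\langle\xi\rangle^a=(1+|\xi|^2)^{a/2}$, and $(-\Delta)^\sigma$ is the Fourier multiplier operator with symbol $|\xi|^{2\sigma}$. For $a\ge0$, $H^a_1=H^a_1(\mathbb{R}^n)$ is the Bessel potential space based on $L^1(\mathbb{R}^n)$, with norm $\|f\|_{H^a_1}=\|\langle D\rangle^a f\|_{L^1}$. $L^1=L^1(\mathbb{R}^n)$. Solutions. The data $u_0,u_1$ are such that the norms on the right-hand side of the estimate considered are finite. The solution is the one given through the partial Fourier transform in $x$ by $$\widehat u(t,\xi)=\frac{\lambda_1e^{\lambda_2t}-\lambda_2e^{\lambda_1t}}{\lambda_1-\lambda_2}\,\widehat{u}_0(\xi)+\frac{e^{\lambda_1t}-e^{\lambda_2t}}{\lambda_1-\lambda_2}\,\widehat{u}_1(\xi),\qquad \lambda_{1,2}=\lambda_{1,2}(\xi)=\tfrac12\Big(-|\xi|^{2\sigma}\pm\sqrt{|\xi|^{4\sigma}-4|\xi|^{2\sigma}}\Big),$$ with the multipliers extended by continuity where $\lambda_1=\lambda_2$ (the square root of a negative number being $i$ times the square root of its absolute value).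 *)

theory Defs
  imports "HOL-Analysis.Analysis"
begin

text \<open>
  \<open>\<real>\<^sup>n\<close> is \<open>real ^ 'n\<close> with \<open>n = CARD('n)\<close>, and functions are complex valued. Elements of \<open>L\<^sup>1\<close> are
  given by integrable Borel representatives. The normalisation of the Fourier transform is
  immaterial here, as all the estimates are linear in the data.
\<close>

definition fourier :: "(real ^ 'n \<Rightarrow> complex) \<Rightarrow> real ^ 'n \<Rightarrow> complex" where
  "fourier f \<xi> = (LINT x|lborel. exp (- \<i> * of_real (x \<bullet> \<xi>)) * f x)"

definition L1_norm :: "(real ^ 'n \<Rightarrow> complex) \<Rightarrow> real" where
  "L1_norm f = (LINT x|lborel. norm (f x))"

definition has_fourier :: "(real ^ 'n \<Rightarrow> complex) \<Rightarrow> (real ^ 'n \<Rightarrow> complex) \<Rightarrow> bool" where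
  "has_fourier f w \<longleftrightarrow> integrable lborel f \<and> (AE \<xi> in lborel. fourier f \<xi> = w \<xi>)"

text \<open>
  \<open>w \<in> fourier_L1\<close> says that the inverse Fourier transform of \<open>w\<close> (in general a tempered
  distribution) belongs to \<open>L\<^sup>1\<close>; in that case \<open>inv_fourier w\<close> is that \<open>L\<^sup>1\<close> function. It is unique
  almost everywhere, and otherwise \<open>inv_fourier w\<close> carries no information, so its norm must always
  be read together with the membership in \<open>fourier_L1\<close>.
\<close>

definition fourier_L1 :: "(real ^ 'n \<Rightarrow> complex) set" where
  "fourier_L1 = {w. \<exists>f. has_fourier f w}"

definition inv_fourier :: "(real ^ 'n \<Rightarrow> complex) \<Rightarrow> real ^ 'n \<Rightarrow> complex" where
  "inv_fourier w = (SOME f. has_fourier f w)"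

text \<open>
  The Fourier multiplier operator with symbol \<open>m\<close>, and the set of \<open>f \<in> L\<^sup>1\<close> which it maps into \<open>L\<^sup>1\<close>.
\<close>

definition multiplier :: "(real ^ 'n \<Rightarrow> real) \<Rightarrow> (real ^ 'n \<Rightarrow> complex) \<Rightarrow> real ^ 'n \<Rightarrow> complex" where
  "multiplier m f = inv_fourier (\<lambda>\<xi>. of_real (m \<xi>) * fourier f \<xi>)"

definition multiplier_dom :: "(real ^ 'n \<Rightarrow> real) \<Rightarrow> (real ^ 'n \<Rightarrow> complex) set" where
  "multiplier_dom m = {f. integrable lborel f \<and> (\<lambda>\<xi>. of_real (m \<xi>) * fourier f \<xi>) \<in> fourier_L1}"

text \<open>
  The symbols of \<open>|D|\<^sup>a\<close> and \<open>\<langle>D\<rangle>\<^sup>a\<close>. The convention \<open>0 powr 0 = 0\<close> changes the symbol of \<open>|D|\<^sup>0\<close> only on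
  the null set \<open>{0}\<close>, which \<open>has_fourier\<close> ignores.
\<close>

definition abs_symbol :: "real \<Rightarrow> real ^ 'n \<Rightarrow> real" where
  "abs_symbol a \<xi> = norm \<xi> powr a"

definition jap_symbol :: "real \<Rightarrow> real ^ 'n \<Rightarrow> real" where
  "jap_symbol a \<xi> = (1 + (norm \<xi>)\<^sup>2) powr (a / 2)"

text \<open>
  The Bessel potential space based on \<open>L\<^sup>1\<close>, for \<open>s \<ge> 0\<close>. A tempered distribution \<open>f\<close> with
  \<open>\<langle>D\<rangle>\<^sup>s f \<in> L\<^sup>1\<close> is then itself in \<open>L\<^sup>1\<close>, since the Bessel kernel of order \<open>s\<close> is a finite measure;
  hence it is enough to consider \<open>f \<in> L\<^sup>1\<close>.
\<close>

definition H1 :: "real \<Rightarrow> (real ^ 'n \<Rightarrow> complex) set" where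
  "H1 s = multiplier_dom (jap_symbol s)"

definition H1_norm :: "real \<Rightarrow> (real ^ 'n \<Rightarrow> complex) \<Rightarrow> real" where
  "H1_norm s f = L1_norm (multiplier (jap_symbol s) f)"

text \<open>
  On negative reals \<open>csqrt\<close> is \<open>\<i>\<close> times the square root of the absolute value.
\<close>

definition discr_root :: "real \<Rightarrow> real ^ 'n \<Rightarrow> complex" where
  "discr_root \<sigma> \<xi> = csqrt (of_real (norm \<xi> powr (4 * \<sigma>) - 4 * norm \<xi> powr (2 * \<sigma>)))"

definition lambda1 :: "real \<Rightarrow> real ^ 'n \<Rightarrow> complex" where
  "lambda1 \<sigma> \<xi> = (- of_real (norm \<xi> powr (2 * \<sigma>)) + discr_root \<sigma> \<xi>) / 2"

definition lambda2 :: "real \<Rightarrow> real ^ 'n \<Rightarrow> complex" where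
  "lambda2 \<sigma> \<xi> = (- of_real (norm \<xi> powr (2 * \<sigma>)) - discr_root \<sigma> \<xi>) / 2"

text \<open>
  The multipliers of \<open>u\<^sub>0\<close> and \<open>u\<^sub>1\<close>. The values for \<open>l1 = l2\<close> are the limits of the quotients as
  both roots tend to the double root.
\<close>

definition K0 :: "real \<Rightarrow> real \<Rightarrow> real ^ 'n \<Rightarrow> complex" where
  "K0 \<sigma> t \<xi> = (let l1 = lambda1 \<sigma> \<xi>; l2 = lambda2 \<sigma> \<xi> in
     if l1 = l2 then (1 - l1 * of_real t) * exp (l1 * of_real t)
     else (l1 * exp (l2 * of_real t) - l2 * exp (l1 * of_real t)) / (l1 - l2))"

definition K1 :: "real \<Rightarrow> real \<Rightarrow> real ^ 'n \<Rightarrow> complex" where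
  "K1 \<sigma> t \<xi> = (let l1 = lambda1 \<sigma> \<xi>; l2 = lambda2 \<sigma> \<xi> in
     if l1 = l2 then of_real t * exp (l1 * of_real t)
     else (exp (l1 * of_real t) - exp (l2 * of_real t)) / (l1 - l2))"

definition solution_hat ::
  "real \<Rightarrow> (real ^ 'n \<Rightarrow> complex) \<Rightarrow> (real ^ 'n \<Rightarrow> complex) \<Rightarrow> real \<Rightarrow> real ^ 'n \<Rightarrow> complex" where
  "solution_hat \<sigma> u0 u1 t \<xi> = K0 \<sigma> t \<xi> * fourier u0 \<xi> + K1 \<sigma> t \<xi> * fourier u1 \<xi>"

definition solution_t_hat ::
  "real \<Rightarrow> (real ^ 'n \<Rightarrow> complex) \<Rightarrow> (real ^ 'n \<Rightarrow> complex) \<Rightarrow> real \<Rightarrow> real ^ 'n \<Rightarrow> complex" where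
  "solution_t_hat \<sigma> u0 u1 t \<xi> =
     vector_derivative (\<lambda>s. solution_hat \<sigma> u0 u1 s \<xi>) (at t within {0..})"

text \<open>
  The solution \<open>u(t,\<cdot>)\<close> of \<open>u\<^sub>t\<^sub>t + (-\<Delta>)\<^sup>\<sigma> u + (-\<Delta>)\<^sup>\<sigma> u\<^sub>t = 0\<close> with data \<open>u\<^sub>0, u\<^sub>1\<close>, and its time derivative
  \<open>u\<^sub>t(t,\<cdot>)\<close>. The time derivative is taken under the partial Fourier transform in \<open>x\<close>.
\<close>

definition solution ::
  "real \<Rightarrow> (real ^ 'n \<Rightarrow> complex) \<Rightarrow> (real ^ 'n \<Rightarrow> complex) \<Rightarrow> real \<Rightarrow> real ^ 'n \<Rightarrow> complex" where
  "solution \<sigma> u0 u1 t = inv_fourier (solution_hat \<sigma> u0 u1 t)"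

definition solution_t ::
  "real \<Rightarrow> (real ^ 'n \<Rightarrow> complex) \<Rightarrow> (real ^ 'n \<Rightarrow> complex) \<Rightarrow> real \<Rightarrow> real ^ 'n \<Rightarrow> complex" where
  "solution_t \<sigma> u0 u1 t = inv_fourier (solution_t_hat \<sigma> u0 u1 t)"

end

theory Submission
  imports Defs "HOL-Probability.Probability" "HOL-Complex_Analysis.Complex_Analysis" "HOL-Real_Asymp.Real_Asymp"
begin

text \<open>
  All four estimates say that a radial Fourier multiplier \<open>F(|\<xi>|\<^sup>2)\<close> maps \<open>L\<^sup>1\<close> into \<open>L\<^sup>1\<close> with a norm that is
  bounded by a power of \<open>\<tau> = 1 + t\<close>. Here \<open>F(w) = w\<^bsup>a/2\<^esup> (1 + w)\<^bsup>-b/2\<^esup> k(t, w\<^sup>\<sigma>)\<close>, where \<open>b\<close> is the order of the Sobolev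
  norm and \<open>k\<close> is one of the two fundamental solutions \<open>k\<^sub>0, k\<^sub>1\<close> of \<open>y'' + p y' + p y = 0\<close>. These are
  symmetric in the characteristic roots, hence entire in \<open>p\<close> even where the roots coincide, so that \<open>F\<close> is
  holomorphic in the right half plane. Holomorphy replaces the study of oscillatory integrals.

  By the Cauchy formula, \<open>2 \<pi> i F(x)\<close> is the integral of \<open>F(w) / (w - x)\<close> over the boundary of a sector
  \<open>|arg w| \<le> \<theta>\<close>. There each resolvent \<open>1 / (w - x)\<close> is a superposition of complex heat semigroups \<open>exp (- z x)\<close>
  with \<open>|arg z| = \<pi>/2 - \<theta>/2\<close>. Their kernels are complex Gaussians, whose \<open>L\<^sup>1\<close> norm \<open>(|z| / Re z)\<^bsup>n/2\<^esup>\<close> is known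
  exactly. Thus \<open>F(-\<Delta>)\<close> is bounded on \<open>L\<^sup>1\<close> by \<open>C \<theta>\<^bsup>-n/2-1\<^esup>\<close> times the integral of \<open>|F| ds/s\<close> along the rays
  (\<open>L1_mult_sector\<close>). A nonzero limit \<open>c\<close> of \<open>F\<close> at \<open>0\<close> is removed with a Gaussian, and Hoelder decay at both
  ends makes the integral finite (\<open>L1_mult_of_polar_bounds\<close>).

  It remains to choose the angle. For \<open>|p| = \<rho> \<le> 1\<close> the characteristic roots are close to \<open>\<plusminus> i \<surd>p - p/2\<close>, and for
  \<open>arg p = \<psi>\<close> their real parts are at most \<open>\<psi>\<^sup>2 - \<rho>/8\<close>. So the fundamental solutions stay bounded along the rays
  as long as \<open>t \<psi>\<^sup>2 \<le> 1\<close>. This allows \<open>\<theta>\<close> of order \<open>\<tau>\<^bsup>-1/2\<^esup>\<close>, which costs the factor \<open>\<tau>\<^bsup>n/4+1/2\<^esup>\<close>. Since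
  \<open>[n/2] \<ge> (n-1)/2\<close>, the powers in the theorem exceed this one by at least \<open>1/4\<close> for \<open>k\<^sub>0\<close> and \<open>3/4\<close> for \<open>k\<^sub>1\<close>; the
  factor \<open>\<tau>\<^bsup>-a/(2\<sigma>)\<^esup>\<close> comes from \<open>w\<^bsup>a/2\<^esup>\<close> at the relevant scale \<open>\<rho> = 1/\<tau>\<close>. For \<open>k\<^sub>0\<close> the allowance of \<open>1/4\<close> suffices
  (\<open>K0_multiplier\<close>); as \<open>p \<rightarrow> \<infinity>\<close> one root tends to \<open>-1\<close> and \<open>k\<^sub>0\<close> to \<open>exp (- t)\<close>, which is split off. For \<open>k\<^sub>1\<close>, which
  is as large as \<open>t\<close> near \<open>p = 0\<close>, the allowance of \<open>3/4\<close> suffices when \<open>a > \<sigma>/2\<close>. Otherwise \<open>k\<^sub>1\<close> is cut at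
  \<open>\<rho> = \<tau>\<^bsup>-7/5\<^esup>\<close> by the entire function \<open>exp (- \<tau>\<^bsup>7/5\<^esup> p)\<close>: the part above the cut is smaller, and the part
  below it tolerates the wider angle \<open>\<tau>\<^bsup>-3/10\<^esup>\<close> (\<open>K1_multiplier\<close>).

  Finally \<open>\<partial>\<^sub>t k\<^sub>0 = - p k\<^sub>1\<close> and \<open>\<partial>\<^sub>t k\<^sub>1 = k\<^sub>0 - p k\<^sub>1\<close>, and \<open>p k\<^sub>1\<close> is the case of \<open>k\<^sub>1\<close> with \<open>a + 2 \<sigma>\<close> in place of \<open>a\<close>, so the
  bounds for \<open>u\<^sub>t\<close> follow from those for \<open>u\<close>. The solution is itself defined by an inverse Fourier transform,
  which is meaningful because the Fourier transform is injective on \<open>L\<^sup>1\<close> (\<open>fourier_eq_0_imp_AE_eq_0\<close>).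
\<close>

section \<open>Gaussian integrals on the line\<close>

lemma norm_exp_i_diff_le: "norm (exp (- \<i> * of_real a) - exp (- \<i> * of_real b)) \<le> \<bar>a - b\<bar>"
proof -
  have "exp (- \<i> * of_real a) - exp (- \<i> * of_real b)
      = exp (- \<i> * of_real b) * (exp (\<i> * of_real (b - a)) - 1)"
    by (simp add: algebra_simps flip: exp_add)
  moreover have "norm (exp (\<i> * of_real (b - a)) - 1) \<le> \<bar>b - a\<bar>"
    using iexp_approx1[of "b - a" 0] by simp
  ultimately show ?thesis by (simp add: norm_mult norm_exp_eq_Re)
qed

lemma has_vector_derivative_iff_quotient:
  fixes f :: "real \<Rightarrow> 'a::real_normed_vector"
  shows "(f has_vector_derivative D) (at y) \<longleftrightarrow> ((\<lambda>k. (f (y + k) - f y) /\<^sub>R k) \<longlongrightarrow> D) (at 0)"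
proof -
  have "norm (f (y + k) - f y - k *\<^sub>R D) / norm k = norm ((f (y + k) - f y) /\<^sub>R k - D)" if "k \<noteq> 0" for k
  proof -
    have "(f (y + k) - f y) /\<^sub>R k - D = (f (y + k) - f y - k *\<^sub>R D) /\<^sub>R k"
      using that by (simp add: algebra_simps)
    then show ?thesis by (simp add: divide_inverse_commute)
  qed
  then have "((\<lambda>k. norm (f (y + k) - f y - k *\<^sub>R D) / norm k) \<longlongrightarrow> 0) (at 0)
      \<longleftrightarrow> ((\<lambda>k. norm ((f (y + k) - f y) /\<^sub>R k - D)) \<longlongrightarrow> 0) (at 0)"
    by (intro tendsto_cong) (auto simp: eventually_at_filter)
  also have "\<dots> \<longleftrightarrow> ((\<lambda>k. (f (y + k) - f y) /\<^sub>R k) \<longlongrightarrow> D) (at 0)"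
    by (simp add: tendsto_norm_zero_iff LIM_zero_iff)
  finally show ?thesis
    by (simp add: has_vector_derivative_def has_derivative_at bounded_linear_scaleR_left)
qed

text \<open>
  Differentiation under the integral by dominated convergence: the difference quotients of the
  oscillating factor are bounded by \<open>|g|\<close> because \<open>exp (- i a)\<close> is Lipschitz in \<open>a\<close>. With \<open>g x = x\<close> this
  differentiates a Fourier transform, with \<open>g x = x\<^sup>2\<close> a Gaussian integral in the imaginary part of its
  parameter.
\<close>

lemma has_vector_derivative_oscillatory_integral:
  fixes h :: "real \<Rightarrow> complex" and g :: "real \<Rightarrow> real"
  assumes h: "integrable lborel h" and gh: "integrable lborel (\<lambda>x. of_real (g x) * h x)"
    and [measurable]: "g \<in> borel_measurable borel"
  shows "((\<lambda>y. LINT x|lborel. exp (- \<i> * of_real (y * g x)) * h x) has_vector_derivative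
      (LINT x|lborel. - \<i> * of_real (g x) * exp (- \<i> * of_real (y * g x)) * h x)) (at y)"
proof -
  have [measurable]: "h \<in> borel_measurable borel" using h by auto
  define e where "e y x = exp (- \<i> * of_real (y * g x))" for y x
  have [measurable]: "e y \<in> borel_measurable borel" for y unfolding e_def by measurable
  have int: "integrable lborel (\<lambda>x. e y x * h x)" for y
    by (rule Bochner_Integration.integrable_bound[OF h]) (auto simp: e_def norm_mult norm_exp_eq_Re)
  define F where "F y = (LINT x|lborel. e y x * h x)" for y
  define D where "D = (LINT x|lborel. - \<i> * of_real (g x) * e y x * h x)"
  have "((\<lambda>k. (F (y + k) - F y) /\<^sub>R k) \<longlongrightarrow> D) (at 0)"
  proof (subst tendsto_at_iff_sequentially, intro allI impI)
    fix X :: "nat \<Rightarrow> real" assume X: "\<forall>i. X i \<in> UNIV - {0}" "X \<longlonglongrightarrow> 0"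
    let ?s = "\<lambda>i x. ((e (y + X i) x - e y x) /\<^sub>R X i) * h x"
    have eq: "(F (y + X i) - F y) /\<^sub>R X i = (LINT x|lborel. ?s i x)" for i
    proof -
      have "(F (y + X i) - F y) /\<^sub>R X i = (LINT x|lborel. e (y + X i) x * h x - e y x * h x) /\<^sub>R X i"
        unfolding F_def by (subst Bochner_Integration.integral_diff[OF int int]) simp
      also have "\<dots> = (LINT x|lborel. (e (y + X i) x * h x - e y x * h x) /\<^sub>R X i)"
        by simp
      also have "\<dots> = (LINT x|lborel. ?s i x)"
        by (intro Bochner_Integration.integral_cong) (auto simp: algebra_simps)
      finally show ?thesis .
    qed
    have "(\<lambda>i. LINT x|lborel. ?s i x) \<longlonglongrightarrow> D"
      unfolding D_def
    proof (rule integral_dominated_convergence[where w="\<lambda>x. norm (of_real (g x) * h x)"])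
      show "integrable lborel (\<lambda>x. norm (of_real (g x) * h x))" using gh by (rule integrable_norm)
      show "AE x in lborel. (\<lambda>i. ?s i x) \<longlonglongrightarrow> - \<i> * of_real (g x) * e y x * h x"
      proof (rule AE_I2)
        fix x
        have "((\<lambda>y. exp (- \<i> * of_real (y * g x))) has_vector_derivative - \<i> * of_real (g x) * exp (- \<i> * of_real (y * g x))) (at y)"
          unfolding of_real_mult by (rule has_vector_derivative_real_field) (auto intro!: derivative_eq_intros)
        then have "((\<lambda>k. (e (y + k) x - e y x) /\<^sub>R k) \<longlongrightarrow> - \<i> * of_real (g x) * e y x) (at 0)"
          unfolding e_def has_vector_derivative_iff_quotient by simp
        then show "(\<lambda>i. ?s i x) \<longlonglongrightarrow> - \<i> * of_real (g x) * e y x * h x"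
          using X by (intro tendsto_mult_right) (auto simp: tendsto_at_iff_sequentially o_def)
      qed
      have "norm (?s i x) \<le> norm (of_real (g x) * h x)" for i x
      proof -
        have "norm (e (y + X i) x - e y x) \<le> \<bar>X i * g x\<bar>"
          unfolding e_def by (rule order.trans[OF norm_exp_i_diff_le]) (simp add: algebra_simps)
        then have "norm ((e (y + X i) x - e y x) /\<^sub>R X i) \<le> \<bar>g x\<bar>"
          using X(1) by (auto simp: divide_simps abs_mult mult.commute)
        then show ?thesis unfolding norm_mult by (intro mult_right_mono) auto
      qed
      then show "AE x in lborel. norm (?s i x) \<le> norm (of_real (g x) * h x)" for i by auto
    qed auto
    then show "((\<lambda>k. (F (y + k) - F y) /\<^sub>R k) \<circ> X) \<longlonglongrightarrow> D"
      by (simp add: o_def eq)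
  qed
  then show ?thesis
    unfolding F_def D_def e_def has_vector_derivative_iff_quotient .
qed

lemma
  fixes c :: complex assumes c: "Re c > 0"
  shows integrable_gaussian_moment: "integrable lborel (\<lambda>x::real. of_real (x ^ k) * exp (- c * of_real (x\<^sup>2)))"
proof -
  define s where "s = 1 / sqrt (2 * Re c)"
  have s: "s > 0" "s\<^sup>2 = 1 / (2 * Re c)" using c by (auto simp: s_def power_divide)
  have "integrable lborel (\<lambda>x. sqrt (2 * pi * s\<^sup>2) * (normal_density 0 s x * (x - 0)^k))"
    by (intro integrable_mult_right integrable_normal_moment s)
  also have "(\<lambda>x. sqrt (2 * pi * s\<^sup>2) * (normal_density 0 s x * (x - 0)^k)) = (\<lambda>x. x ^ k * exp (- (Re c * x\<^sup>2)))"
    using s(1) c by (simp add: normal_density_def fun_eq_iff s(2))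
  finally show ?thesis
    by (rule Bochner_Integration.integrable_bound) (auto simp: norm_mult norm_exp_eq_Re norm_power abs_mult power_abs)
qed

text \<open>
  The boundary term of all integrations by parts below.
\<close>

lemma integral_deriv_eq_0:
  fixes F f :: "real \<Rightarrow> complex"
  assumes F: "\<And>x. (F has_vector_derivative f x) (at x)" and f: "\<And>x. isCont f x" "integrable lborel f"
    and "(F \<longlongrightarrow> 0) at_top" "(F \<longlongrightarrow> 0) at_bot"
  shows "integral\<^sup>L lborel f = 0"
proof -
  have "(LBINT x=-\<infinity>..\<infinity>. f x) = 0 - 0"
    using assms by (intro interval_integral_FTC_integrable[where F=F])
       (auto simp: set_integrable_def ereal_tendsto_simps)
  then show ?thesis
    by (simp add: interval_lebesgue_integral_def set_lebesgue_integral_def)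
qed

lemma tendsto_gaussian_moment_0:
  fixes c :: complex assumes "Re c > 0"
  shows "((\<lambda>x::real. of_real (x ^ k) * exp (- c * of_real (x\<^sup>2))) \<longlongrightarrow> 0) at_top"
    and "((\<lambda>x::real. of_real (x ^ k) * exp (- c * of_real (x\<^sup>2))) \<longlongrightarrow> 0) at_bot"
proof -
  have lim: "((\<lambda>x::real. x ^ k * exp (- (Re c * x\<^sup>2))) \<longlongrightarrow> 0) at_top"
    using assms by real_asymp
  let ?f = "\<lambda>x::real. of_real (x ^ k) * exp (- c * of_real (x\<^sup>2))"
  have n: "norm (?f x) = \<bar>x ^ k * exp (- (Re c * x\<^sup>2))\<bar>" for x
    by (simp add: norm_mult norm_exp_eq_Re norm_power abs_mult power_abs)
  have n': "norm (?f (- x)) = norm (?f x)" for x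
    by (simp add: norm_mult norm_power)
  have 1: "((\<lambda>x. norm (?f x)) \<longlongrightarrow> 0) at_top"
    unfolding n using lim by (rule tendsto_rabs_zero)
  then show "(?f \<longlongrightarrow> 0) at_top" by (rule tendsto_norm_zero_cancel)
  have "((\<lambda>x. norm (?f (- x))) \<longlongrightarrow> 0) at_top"
    unfolding n' using 1 .
  then show "(?f \<longlongrightarrow> 0) at_bot"
    by (subst tendsto_norm_zero_iff[symmetric]) (simp add: filterlim_at_bot_mirror)
qed

definition gauss_int :: "complex \<Rightarrow> complex" where
  "gauss_int c = (LINT x::real|lborel. exp (- c * of_real (x\<^sup>2)))"

lemma gauss_int_by_parts:
  assumes c: "Re c > 0"
  shows "gauss_int c = 2 * c * (LINT x::real|lborel. of_real (x\<^sup>2) * exp (- c * of_real (x\<^sup>2)))"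
proof -
  note int = integrable_gaussian_moment[OF c]
  have "(LINT x::real|lborel. exp (- c * of_real (x\<^sup>2)) - 2 * c * (of_real (x\<^sup>2) * exp (- c * of_real (x\<^sup>2)))) = 0"
  proof (rule integral_deriv_eq_0)
    show "((\<lambda>x. of_real (x ^ 1) * exp (- c * of_real (x\<^sup>2))) has_vector_derivative
        exp (- c * of_real (x\<^sup>2)) - 2 * c * (of_real (x\<^sup>2) * exp (- c * of_real (x\<^sup>2)))) (at x)" for x
      unfolding of_real_power
      by (rule has_vector_derivative_real_field) (auto intro!: derivative_eq_intros simp: power2_eq_square algebra_simps)
    show "integrable lborel (\<lambda>x::real. exp (- c * of_real (x\<^sup>2)) - 2 * c * (of_real (x\<^sup>2) * exp (- c * of_real (x\<^sup>2))))"
      using int[of 0] int[of 2] by auto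
  qed (use tendsto_gaussian_moment_0[OF c, of 1] in \<open>auto intro!: continuous_intros\<close>)
  then show ?thesis
    using int[of 0] int[of 2] by (simp add: gauss_int_def)
qed

text \<open>
  Along a vertical line \<open>c = a + i u\<close>, integration by parts gives \<open>J' = - i J / (2 c)\<close> for the Gaussian integral
  \<open>J\<close>, so \<open>J\<^sup>2 c\<close> is constant; its value for \<open>u = 0\<close> is that of a normal density. Working with \<open>J\<^sup>2\<close> avoids the
  choice of a branch of the square root; only \<open>J \<noteq> 0\<close> and \<open>|J|\<close> matter later.
\<close>

lemma gauss_int_squared:
  fixes c :: complex assumes c: "Re c > 0"
  shows "(gauss_int c)\<^sup>2 = pi / c"
proof -
  define a where "a = Re c"
  define C where "C u = Complex a u" for u
  have a: "a > 0" and ReC: "Re (C u) > 0" for u using c by (auto simp: a_def C_def)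
  have Ceq: "C u = of_real a + \<i> * of_real u" for u by (simp add: C_def complex_eq_iff)
  define H where "H u = (gauss_int (C u))\<^sup>2 * C u" for u
  have der: "((\<lambda>u. gauss_int (C u)) has_vector_derivative - \<i> * (gauss_int (C u) / (2 * C u))) (at u)" for u
  proof -
    have e: "exp (- \<i> * of_real (u * x\<^sup>2)) * exp (- of_real a * of_real (x\<^sup>2)) = exp (- C u * of_real (x\<^sup>2))" for u x :: real
      by (simp add: Ceq algebra_simps flip: exp_add)
    have "((\<lambda>u. LINT x|lborel. exp (- \<i> * of_real (u * x\<^sup>2)) * exp (- of_real a * of_real (x\<^sup>2))) has_vector_derivative
      (LINT x|lborel. - \<i> * of_real (x\<^sup>2) * exp (- \<i> * of_real (u * x\<^sup>2)) * exp (- of_real a * of_real (x\<^sup>2)))) (at u)"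
      using integrable_gaussian_moment[of "of_real a" 0] integrable_gaussian_moment[of "of_real a" 2] a
      by (intro has_vector_derivative_oscillatory_integral) (auto simp: algebra_simps)
    also have "(LINT x|lborel. - \<i> * of_real (x\<^sup>2) * exp (- \<i> * of_real (u * x\<^sup>2)) * exp (- of_real a * of_real (x\<^sup>2)))
       = (LINT x|lborel. - \<i> * (of_real (x\<^sup>2) * exp (- C u * of_real (x\<^sup>2))))"
      by (simp only: mult.assoc e)
    also have "\<dots> = - \<i> * (gauss_int (C u) / (2 * C u))"
      using gauss_int_by_parts[OF ReC, of u] ReC[of u] by (auto simp: field_simps)
    finally show ?thesis unfolding e gauss_int_def .
  qed
  have "(H has_vector_derivative 0) (at u)" for u
  proof -
    have "(C has_vector_derivative \<i>) (at u)"
      unfolding Ceq[abs_def] by (auto intro!: derivative_eq_intros has_vector_derivative_real_field)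
    from has_vector_derivative_mult[OF has_vector_derivative_mult[OF der der] this]
    have "(H has_vector_derivative gauss_int (C u) * gauss_int (C u) * \<i> +
        (gauss_int (C u) * (- \<i> * (gauss_int (C u) / (2 * C u))) + - \<i> * (gauss_int (C u) / (2 * C u)) * gauss_int (C u)) * C u) (at u)"
      unfolding H_def[abs_def] power2_eq_square .
    moreover have "C u \<noteq> 0" using ReC[of u] by auto
    then have "gauss_int (C u) * gauss_int (C u) * \<i> +
        (gauss_int (C u) * (- \<i> * (gauss_int (C u) / (2 * C u))) + - \<i> * (gauss_int (C u) / (2 * C u)) * gauss_int (C u)) * C u = 0"
      by (simp add: field_simps)
    ultimately show ?thesis by simp
  qed
  then have "H (Im c) = H 0"
    by (metis UNIV_I convex_UNIV has_vector_derivative_zero_constant)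
  moreover have "gauss_int (C 0) = of_real (sqrt (pi / a))"
  proof -
    define s where "s = 1 / sqrt (2 * a)"
    have s: "s > 0" "s\<^sup>2 = 1 / (2 * a)" using a by (auto simp: s_def power_divide)
    have "gauss_int (C 0) = (LINT x|lborel. of_real (exp (- (a * x\<^sup>2))))"
      by (simp add: gauss_int_def Ceq exp_of_real[symmetric])
    also have "(\<lambda>x. exp (- (a * x\<^sup>2))) = (\<lambda>x. sqrt (pi / a) * normal_density 0 s x)"
      using s(1) a by (auto simp: normal_density_def fun_eq_iff s(2))
    finally show ?thesis using s(1) by simp
  qed
  moreover have "C (Im c) = c" by (simp add: C_def a_def)
  moreover have "(of_real (sqrt (pi / a)))\<^sup>2 = (of_real (pi / a) :: complex)"
    using a by (simp flip: of_real_power)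
  ultimately have "(gauss_int c)\<^sup>2 * c = pi"
    using a by (simp add: H_def Ceq)
  then show ?thesis using c by (subst eq_divide_eq) auto
qed

text \<open>
  The transform \<open>P\<close> satisfies \<open>P' = - y P / (2 c)\<close>, again by parts, and \<open>P 0\<close> is the Gaussian integral.
\<close>

lemma integral_gaussian_fourier_1d:
  assumes c: "Re c > 0"
  shows "(LINT x::real|lborel. exp (- \<i> * of_real (y * x)) * exp (- c * of_real (x\<^sup>2)))
     = gauss_int c * exp (- of_real (y\<^sup>2) / (4 * c))"
proof -
  note int = integrable_gaussian_moment[OF c]
  define P where "P y = (LINT x::real|lborel. exp (- \<i> * of_real (y * x)) * exp (- c * of_real (x\<^sup>2)))" for y
  have parts: "(LINT x|lborel. - \<i> * of_real x * exp (- \<i> * of_real (y * x)) * exp (- c * of_real (x\<^sup>2)))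
      = - of_real y / (2 * c) * P y" for y :: real
  proof -
    let ?E = "\<lambda>x. exp (- \<i> * of_real (y * x)) * exp (- c * of_real (x\<^sup>2))"
    let ?D = "\<lambda>x. - \<i> * of_real x * exp (- \<i> * of_real (y * x)) * exp (- c * of_real (x\<^sup>2))"
    have i0: "integrable lborel ?E"
      by (rule Bochner_Integration.integrable_bound[OF int[of 0]]) (auto simp: norm_mult norm_exp_eq_Re)
    have i1: "integrable lborel ?D"
      by (rule Bochner_Integration.integrable_bound[OF int[of 1]]) (auto simp: norm_mult norm_exp_eq_Re)
    have "(LINT x|lborel. - \<i> * of_real y * ?E x - 2 * \<i> * c * ?D x) = 0"
    proof (rule integral_deriv_eq_0)
      show "(?E has_vector_derivative - \<i> * of_real y * ?E x - 2 * \<i> * c * ?D x) (at x)" for x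
        unfolding of_real_power of_real_mult
        by (rule has_vector_derivative_real_field) (auto intro!: derivative_eq_intros simp: power2_eq_square algebra_simps)
      show "integrable lborel (\<lambda>x. - \<i> * of_real y * ?E x - 2 * \<i> * c * ?D x)"
        using i0 i1 by auto
      have "norm (?E x) = norm (of_real (x ^ 0) * exp (- c * of_real (x\<^sup>2)))" for x :: real
        by (simp add: norm_mult norm_exp_eq_Re)
      then have n: "(\<lambda>x. norm (?E x)) = (\<lambda>x. norm (of_real (x ^ 0) * exp (- c * of_real (x\<^sup>2))))" by blast
      show "(?E \<longlongrightarrow> 0) at_top"
        by (rule tendsto_norm_zero_cancel, unfold n, rule tendsto_norm_zero, rule tendsto_gaussian_moment_0[OF c])
      show "(?E \<longlongrightarrow> 0) at_bot"
        by (rule tendsto_norm_zero_cancel, unfold n, rule tendsto_norm_zero, rule tendsto_gaussian_moment_0[OF c])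
    qed (auto intro!: continuous_intros)
    then have "- \<i> * of_real y * P y = 2 * \<i> * c * (LINT x|lborel. ?D x)"
      using i0 i1 unfolding P_def by (subst (asm) Bochner_Integration.integral_diff) auto
    then have "(LINT x|lborel. ?D x) = (- \<i> * of_real y * P y) / (2 * \<i> * c)"
      using c by (subst eq_divide_eq) (auto simp: mult.commute)
    then show ?thesis by simp
  qed
  have der: "(P has_vector_derivative - of_real y / (2 * c) * P y) (at y)" for y
    using has_vector_derivative_oscillatory_integral[of "\<lambda>x. exp (- c * of_real (x\<^sup>2))" "\<lambda>x. x" y] int[of 0] int[of 1]
    unfolding parts[of y] by (simp add: P_def[abs_def] mult.commute)
  define H where "H y = P y * exp (of_real (y\<^sup>2) / (4 * c))" for y
  have "(H has_vector_derivative 0) (at y)" for y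
  proof -
    have "((\<lambda>y. exp (of_real (y\<^sup>2) / (4 * c))) has_vector_derivative of_real y / (2 * c) * exp (of_real (y\<^sup>2) / (4 * c))) (at y)"
      unfolding of_real_power
      by (rule has_vector_derivative_real_field) (use c in \<open>auto intro!: derivative_eq_intros simp: field_simps\<close>)
    from has_vector_derivative_mult[OF der this]
    show ?thesis by (simp add: H_def[abs_def])
  qed
  then have "H y = H 0"
    by (metis UNIV_I convex_UNIV has_vector_derivative_zero_constant)
  then have "P y * exp (of_real (y\<^sup>2) / (4 * c)) = gauss_int c"
    by (simp add: H_def P_def gauss_int_def)
  then have "P y * (exp (of_real (y\<^sup>2) / (4 * c)) * exp (- (of_real (y\<^sup>2) / (4 * c)))) = gauss_int c * exp (- of_real (y\<^sup>2) / (4 * c))"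
    by (simp add: mult.assoc[symmetric])
  then show ?thesis unfolding P_def by (simp flip: exp_add)
qed

section \<open>Gaussians on \<open>\<real>\<^sup>n\<close> and superpositions\<close>

text \<open>
  Lebesgue measure on \<open>\<real>\<^sup>n\<close> is the image of the product measure on the coordinates, so integrals of
  products of functions of one coordinate factor.
\<close>

lemma
  fixes h :: "'n::finite \<Rightarrow> real \<Rightarrow> complex"
  assumes h: "\<And>i. integrable lborel (h i)"
  shows integrable_prod_vec: "integrable lborel (\<lambda>x::real^'n. \<Prod>i\<in>UNIV. h i (x $ i))"
    and integral_prod_vec: "(LINT x|(lborel::(real^'n) measure). (\<Prod>i\<in>UNIV. h i (x $ i))) = (\<Prod>i\<in>UNIV. (LINT x|lborel. h i x))"
proof -
  interpret product_sigma_finite "\<lambda>b::real^'n. lborel :: real measure" ..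
  have B: "Basis = (\<lambda>i. axis i (1::real)) ` (UNIV::'n set)" by (auto simp: Basis_vec_def)
  have inj: "inj (\<lambda>i::'n. axis i (1::real))" by (auto simp: inj_on_def axis_eq_axis)
  define k where "k b = h (the_inv (\<lambda>i. axis i (1::real)) b)" for b :: "real^'n"
  have k: "k (axis i 1) = h i" for i by (simp add: k_def the_inv_f_f[OF inj])
  have P: "(\<Prod>i\<in>UNIV. h i (x $ i)) = (\<Prod>b\<in>Basis. k b (x \<bullet> b))" for x :: "real^'n"
    unfolding B by (subst prod.reindex[OF inj]) (simp add: k inner_axis)
  have kint: "integrable lborel (k b)" for b unfolding k_def by (rule h)
  then have [measurable]: "k b \<in> borel_measurable borel" for b by auto
  have [measurable]: "(\<lambda>f. \<Sum>b\<in>Basis. f b *\<^sub>R b) \<in> (\<Pi>\<^sub>M b\<in>(Basis::(real^'n) set). lborel) \<rightarrow>\<^sub>M borel" by measurable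
  have in_b: "(\<Sum>b\<in>Basis. f b *\<^sub>R b) \<bullet> a = f a" if "a \<in> Basis" for f and a :: "real^'n"
    using that by simp
  have eq: "(\<Prod>b\<in>Basis. k b ((\<Sum>b\<in>Basis. f b *\<^sub>R b) \<bullet> b)) = (\<Prod>b\<in>Basis. k b (f b))" for f :: "real^'n \<Rightarrow> real"
    by (intro prod.cong refl) (simp add: in_b)
  show "integrable lborel (\<lambda>x::real^'n. \<Prod>i\<in>UNIV. h i (x $ i))"
    unfolding P using product_integrable_prod[OF finite_Basis, of k, OF kint]
    by (subst lborel_def, subst integrable_distr_eq) (measurable, simp add: eq flip: lborel_eq_real)
  have "(LINT x|(lborel::(real^'n) measure). (\<Prod>i\<in>UNIV. h i (x $ i))) = (\<Prod>b\<in>Basis. (LINT x|lborel. k b x))"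
    unfolding P using product_integral_prod[OF finite_Basis, of k, OF kint]
    by (subst lborel_def, subst integral_distr) (measurable, simp add: eq flip: lborel_eq_real)
  also have "\<dots> = (\<Prod>i\<in>UNIV. (LINT x|lborel. h i x))"
    unfolding B by (subst prod.reindex[OF inj]) (simp add: k)
  finally show "(LINT x|(lborel::(real^'n) measure). (\<Prod>i\<in>UNIV. h i (x $ i))) = (\<Prod>i\<in>UNIV. (LINT x|lborel. h i x))" .
qed

lemma gaussian_eq_prod:
  "exp (- c * of_real ((norm (x::real^'n))\<^sup>2)) = (\<Prod>i\<in>UNIV. exp (- c * of_real ((x $ i)\<^sup>2)))"
  by (simp add: norm_vec_def L2_set_def sum_nonneg sum_distrib_left flip: exp_sum sum_negf)

lemma
  assumes c: "Re c > 0"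
  shows integrable_gaussian: "integrable lborel (\<lambda>x::real^'n::finite. exp (- c * of_real ((norm x)\<^sup>2)))"
    and fourier_gaussian: "fourier (\<lambda>x::real^'n. exp (- c * of_real ((norm x)\<^sup>2))) \<xi>
      = gauss_int c ^ CARD('n) * exp (- of_real ((norm \<xi>)\<^sup>2) / (4 * c))"
proof -
  note i0 = integrable_gaussian_moment[OF c, of 0, simplified]
  show "integrable lborel (\<lambda>x::real^'n. exp (- c * of_real ((norm x)\<^sup>2)))"
    unfolding gaussian_eq_prod by (rule integrable_prod_vec) (use i0 in simp)
  have E: "exp (- \<i> * of_real (x \<bullet> \<xi>)) = (\<Prod>i\<in>UNIV. exp (- \<i> * of_real (\<xi> $ i * x $ i)))" for x
    by (simp add: inner_vec_def sum_distrib_left mult.commute flip: exp_sum sum_negf)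
  have "fourier (\<lambda>x::real^'n. exp (- c * of_real ((norm x)\<^sup>2))) \<xi>
     = (LINT x|lborel. (\<Prod>i\<in>UNIV. exp (- \<i> * of_real (\<xi> $ i * x $ i)) * exp (- c * of_real ((x $ i)\<^sup>2))))"
    unfolding fourier_def gaussian_eq_prod E by (simp add: prod.distrib)
  also have "\<dots> = (\<Prod>i\<in>UNIV. (LINT x|lborel. exp (- \<i> * of_real (\<xi> $ i * x)) * exp (- c * of_real (x\<^sup>2))))"
    by (rule integral_prod_vec, rule Bochner_Integration.integrable_bound[OF i0]) (auto simp: norm_mult norm_exp_eq_Re)
  also have "\<dots> = (\<Prod>i\<in>UNIV. gauss_int c * exp (- of_real ((\<xi> $ i)\<^sup>2) / (4 * c)))"
    by (simp only: integral_gaussian_fourier_1d[OF c])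
  also have "\<dots> = gauss_int c ^ CARD('n) * exp (- of_real ((norm \<xi>)\<^sup>2) / (4 * c))"
    using gaussian_eq_prod[of "1 / (4 * c)" \<xi>] by (simp add: prod.distrib)
  finally show "fourier (\<lambda>x::real^'n. exp (- c * of_real ((norm x)\<^sup>2))) \<xi>
      = gauss_int c ^ CARD('n) * exp (- of_real ((norm \<xi>)\<^sup>2) / (4 * c))" .
qed

lemma L1_norm_gaussian:
  assumes c: "Re c > 0"
  shows "L1_norm (\<lambda>x::real^'n::finite. exp (- c * of_real ((norm x)\<^sup>2))) = (pi / Re c) powr (CARD('n) / 2)"
proof -
  have J: "L1_norm (\<lambda>x::real^'n. exp (- c * of_real ((norm x)\<^sup>2)))
     = Re (fourier (\<lambda>x::real^'n. exp (- of_real (Re c) * of_real ((norm x)\<^sup>2))) 0)"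
  proof -
    have "fourier (\<lambda>x::real^'n. exp (- of_real (Re c) * of_real ((norm x)\<^sup>2))) 0
       = (LINT x|(lborel::(real^'n) measure). of_real (norm (exp (- c * of_real ((norm x)\<^sup>2)))))"
      by (simp add: fourier_def norm_exp_eq_Re exp_of_real[symmetric])
    then show ?thesis unfolding L1_norm_def by simp
  qed
  define g where "g = gauss_int (of_real (Re c))"
  have "g = of_real (LINT x|lborel. exp (- (Re c * x\<^sup>2)))"
    by (simp add: g_def gauss_int_def flip: exp_of_real integral_complex_of_real)
  moreover have "(LINT x|lborel. exp (- (Re c * x\<^sup>2))) \<ge> 0" by (rule integral_nonneg_AE) auto
  moreover have "g\<^sup>2 = of_real (pi / Re c)" unfolding g_def using gauss_int_squared[of "of_real (Re c)"] c by simp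
  ultimately have "g = of_real (sqrt (pi / Re c))"
    by (metis of_real_eq_iff of_real_power real_sqrt_unique)
  then have "L1_norm (\<lambda>x::real^'n. exp (- c * of_real ((norm x)\<^sup>2))) = sqrt (pi / Re c) ^ CARD('n)"
    unfolding J using c by (subst fourier_gaussian) (simp_all add: g_def flip: of_real_power)
  also have "\<dots> = (pi / Re c) powr (CARD('n) / 2)"
    using c by (simp add: powr_half_sqrt[symmetric] powr_powr flip: powr_realpow)
  finally show ?thesis .
qed

text \<open>
  Fubini for a family of \<open>L\<^sup>1\<close> functions with an integrable bound on the norms. All kernels below, that of
  a convolution included, are obtained in this way.
\<close>

lemma
  fixes h :: "'a \<Rightarrow> real^'n::finite \<Rightarrow> complex"
  assumes "sigma_finite_measure M" and h[measurable]: "case_prod h \<in> borel_measurable (M \<Otimes>\<^sub>M lborel)"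
    and int: "\<And>w. w \<in> space M \<Longrightarrow> integrable lborel (h w)"
    and B: "\<And>w. w \<in> space M \<Longrightarrow> L1_norm (h w) \<le> B w" "integrable M B"
  shows integrable_superposition: "integrable lborel (\<lambda>x. LINT w|M. h w x)"
    and fourier_superposition: "fourier (\<lambda>x. LINT w|M. h w x) \<xi> = (LINT w|M. fourier (h w) \<xi>)"
    and L1_norm_superposition: "L1_norm (\<lambda>x. LINT w|M. h w x) \<le> (LINT w|M. B w)"
proof -
  interpret M: sigma_finite_measure M by fact
  interpret P: pair_sigma_finite M "lborel :: (real^'n) measure" ..
  have L1: "integrable M (\<lambda>w. L1_norm (h w))"
  proof (rule Bochner_Integration.integrable_bound[OF B(2)])
    show "(\<lambda>w. L1_norm (h w)) \<in> borel_measurable M" unfolding L1_norm_def by measurable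
    show "AE w in M. norm (L1_norm (h w)) \<le> norm (B w)"
      using B(1) by (intro AE_I2) (fastforce simp: L1_norm_def integral_nonneg_AE)
  qed
  have hint: "integrable (M \<Otimes>\<^sub>M lborel) (case_prod h)"
    using L1 int unfolding L1_norm_def by (intro P.Fubini_integrable) auto
  show I: "integrable lborel (\<lambda>x. LINT w|M. h w x)"
    using P.integrable_snd[OF hint] .
  have e: "norm (exp (- \<i> * of_real r)) = 1" for r :: real by (simp add: norm_exp_eq_Re)
  let ?g = "\<lambda>w x. exp (- \<i> * of_real (x \<bullet> \<xi>)) * h w x"
  have "integrable (M \<Otimes>\<^sub>M lborel) (case_prod ?g)"
    by (rule Bochner_Integration.integrable_bound[OF hint]) (auto simp: norm_mult norm_exp_eq_Re split: prod.splits)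
  from P.Fubini_integral[OF this]
  show "fourier (\<lambda>x. LINT w|M. h w x) \<xi> = (LINT w|M. fourier (h w) \<xi>)"
    unfolding fourier_def by simp
  have "L1_norm (\<lambda>x. LINT w|M. h w x) \<le> (LINT x|lborel. LINT w|M. norm (h w x))"
    unfolding L1_norm_def
  proof (rule integral_mono_AE)
    show "integrable lborel (\<lambda>x. norm (LINT w|M. h w x))" using I by (rule integrable_norm)
    have "integrable (M \<Otimes>\<^sub>M lborel) (\<lambda>(w, x). norm (h w x))"
      using integrable_norm[OF hint] by (simp add: case_prod_unfold)
    from P.integrable_snd[OF this] show "integrable lborel (\<lambda>x. LINT w|M. norm (h w x))" .
  qed auto
  also have "\<dots> = (LINT w|M. L1_norm (h w))"
    using P.Fubini_integral[of "\<lambda>w x. norm (h w x)"] integrable_norm[OF hint]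
    unfolding L1_norm_def by (simp add: case_prod_unfold)
  also have "\<dots> \<le> (LINT w|M. B w)"
    using B L1 by (intro integral_mono_AE) auto
  finally show "L1_norm (\<lambda>x. LINT w|M. h w x) \<le> (LINT w|M. B w)" .
qed

section \<open>Injectivity of the Fourier transform on \<open>L\<^sup>1\<close>\<close>

lemma gauss_int_nonzero: "Re c > 0 \<Longrightarrow> gauss_int c \<noteq> 0"
  using gauss_int_squared[of c] by auto

text \<open>
  A Gaussian centred at \<open>y\<close> is the Fourier transform of a modulated Gaussian, and the Fourier transform
  may be moved from one factor of the pairing to the other.
\<close>

lemma integral_gaussian_eq_0_of_fourier_eq_0:
  fixes f :: "real^'n::finite \<Rightarrow> complex"
  assumes f: "integrable lborel f" and z: "AE \<xi> in lborel. fourier f \<xi> = 0" and e: "\<epsilon> > 0"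
  shows "(LINT x|lborel. f x * exp (- of_real ((norm (x - y))\<^sup>2 / \<epsilon>))) = 0"
proof -
  define c where "c = complex_of_real (\<epsilon> / 4)"
  have c: "Re c > 0" using e by (simp add: c_def)
  have [measurable]: "f \<in> borel_measurable borel" using f by auto
  let ?g = "\<lambda>\<xi>. exp (- c * of_real ((norm (\<xi>::real^'n))\<^sup>2))"
  have gi: "integrable lborel ?g" by (rule integrable_gaussian[OF c])
  let ?h = "\<lambda>\<xi> x. exp (- \<i> * of_real (\<xi> \<bullet> (x - y))) * ?g \<xi> * f x"
  have inner: "(LINT \<xi>|lborel. ?h \<xi> x) = gauss_int c ^ CARD('n) * (f x * exp (- of_real ((norm (x - y))\<^sup>2 / \<epsilon>)))" for x
    using fourier_gaussian[OF c, of "x - y"] unfolding fourier_def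
    by (simp add: c_def mult.commute)
  have "integrable (lborel \<Otimes>\<^sub>M lborel) (\<lambda>(\<xi>, x). ?g \<xi> * f x)"
  proof (rule lborel_pair.Fubini_integrable)
    show "integrable lborel (\<lambda>\<xi>. LINT x|lborel. norm (case (\<xi>, x) of (\<xi>, x) \<Rightarrow> ?g \<xi> * f x))"
      using integrable_norm[OF gi] by (simp add: norm_mult)
    show "AE \<xi> in lborel. integrable lborel (\<lambda>x. case (\<xi>, x) of (\<xi>, x) \<Rightarrow> ?g \<xi> * f x)"
      using f by auto
  qed measurable
  then have "integrable (lborel \<Otimes>\<^sub>M lborel) (\<lambda>(\<xi>, x). ?h \<xi> x)"
    by (rule Bochner_Integration.integrable_bound) (auto simp: norm_mult norm_exp_eq_Re)
  from lborel_pair.Fubini_integral[OF this]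
  have "(LINT x|lborel. LINT \<xi>|lborel. ?h \<xi> x) = (LINT \<xi>|lborel. LINT x|lborel. ?h \<xi> x)" .
  also have "\<dots> = (LINT \<xi>|lborel. exp (\<i> * of_real (\<xi> \<bullet> y)) * ?g \<xi> * fourier f \<xi>)"
  proof (rule Bochner_Integration.integral_cong[OF refl])
    fix \<xi> :: "real^'n"
    have "?h \<xi> x = exp (\<i> * of_real (\<xi> \<bullet> y)) * ?g \<xi> * (exp (- \<i> * of_real (x \<bullet> \<xi>)) * f x)" for x
      by (simp add: inner_diff_right algebra_simps inner_commute flip: exp_add)
    then show "(LINT x|lborel. ?h \<xi> x) = exp (\<i> * of_real (\<xi> \<bullet> y)) * ?g \<xi> * fourier f \<xi>"
      unfolding fourier_def by (simp only: integral_mult_right_zero)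
  qed
  also have "\<dots> = 0"
    by (rule integral_eq_zero_AE) (use z in auto)
  finally show ?thesis unfolding inner using gauss_int_nonzero[OF c] by simp
qed

lemma lborel_integral_affine:
  fixes f :: "real^'n::finite \<Rightarrow> complex"
  assumes s: "s > 0"
    and [measurable]: "f \<in> borel_measurable borel"
  shows "(LINT y|lborel. f y) = s ^ CARD('n) *\<^sub>R (LINT y|lborel. f (x + s *\<^sub>R y))"
proof -
  have "(LINT y|lborel. f y) = (LINT y|density (distr lborel borel (\<lambda>y. x + s *\<^sub>R y)) (\<lambda>_. ennreal (s ^ CARD('n))). f y)"
    using lborel_affine[of s x] s by simp
  also have "\<dots> = (LINT y|distr lborel borel (\<lambda>y. x + s *\<^sub>R y). s ^ CARD('n) *\<^sub>R f y)"
    using s by (subst integral_density) auto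
  also have "\<dots> = (LINT y|lborel. s ^ CARD('n) *\<^sub>R f (x + s *\<^sub>R y))"
    by (subst integral_distr) auto
  finally show ?thesis by simp
qed

text \<open>
  The indicator of a box, smoothed by Gaussians of width \<open>s\<close>, is a superposition of translated Gaussians, all of
  which are annihilated by \<open>f\<close>. As \<open>s \<rightarrow> 0\<close> the smoothed functions stay bounded and converge to the indicator
  off the boundary of the box.
\<close>

lemma integral_box_eq_0_of_fourier_eq_0:
  fixes f :: "real^'n::finite \<Rightarrow> complex"
  assumes f: "integrable lborel f" and z: "AE \<xi> in lborel. fourier f \<xi> = 0"
  shows "(LINT x|lborel. indicator (box a b) x *\<^sub>R f x) = 0"
proof -
  have [measurable]: "f \<in> borel_measurable borel" using f by auto
  let ?b = "\<lambda>x. indicator (box a b) x :: complex"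
  let ?E = "\<lambda>y. exp (- of_real ((norm (y::real^'n))\<^sup>2)) :: complex"
  have Ei: "integrable lborel ?E" using integrable_gaussian[of 1] by simp
  define K where "K = (LINT y|lborel. ?E y)"
  have "K = gauss_int 1 ^ CARD('n)"
    using fourier_gaussian[of 1 "0::real^'n"] by (simp add: K_def fourier_def)
  then have K: "K \<noteq> 0" using gauss_int_nonzero[of 1] by simp
  define S where "S s x = (LINT y|lborel. ?b (x + s *\<^sub>R y) * ?E y)" for s x
  have zero: "(LINT x|lborel. f x * S s x) = 0" if s: "s > 0" for s
  proof -
    let ?k = "\<lambda>x y. exp (- of_real ((norm (x - y))\<^sup>2 / s\<^sup>2)) :: complex"
    have S: "S s x = (1 / s ^ CARD('n)) *\<^sub>R (LINT y|lborel. ?b y * ?k x y)" for x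
      unfolding S_def using s
      by (subst lborel_integral_affine[of s _ x]) (auto simp: power_mult_distrib)
    have "(\<lambda>y. indicator (box a b) y *\<^sub>R (1::complex)) = ?b" by (auto simp: indicator_def)
    then have bi: "integrable lborel ?b"
      using integrable_indicator[of "box a b" lborel 1]
      by (metis (mono_tags) emeasure_lborel_box_finite integrable_indicator sets_lborel borel_open open_box)
    have "integrable (lborel \<Otimes>\<^sub>M lborel) (\<lambda>(x, y). f x * ?b y)"
    proof (rule lborel_pair.Fubini_integrable)
      show "integrable lborel (\<lambda>x. LINT y|lborel. norm (case (x, y) of (x, y) \<Rightarrow> f x * ?b y))"
        using f by (auto simp: norm_mult)
      show "AE x in lborel. integrable lborel (\<lambda>y. case (x, y) of (x, y) \<Rightarrow> f x * ?b y)"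
        using bi by auto
    qed measurable
    then have "integrable (lborel \<Otimes>\<^sub>M lborel) (\<lambda>(x, y). f x * (?b y * ?k x y))"
    proof (rule Bochner_Integration.integrable_bound)
      have "norm (exp (- of_real r :: complex)) \<le> 1" if "r \<ge> 0" for r :: real
        using that by (simp add: norm_exp_eq_Re)
      then have "norm (f x * (?b y * ?k x y)) \<le> norm (f x * ?b y)" for x y
        unfolding norm_mult by (intro mult_left_mono mult_left_le) auto
      then show "AE p in lborel \<Otimes>\<^sub>M lborel. norm (case p of (x, y) \<Rightarrow> f x * (?b y * ?k x y)) \<le> norm (case p of (x, y) \<Rightarrow> f x * ?b y)"
        by (intro AE_I2) (simp add: case_prod_unfold)
    qed measurable
    from lborel_pair.Fubini_integral[OF this]
    have "(LINT x|lborel. LINT y|lborel. f x * (?b y * ?k x y)) = (LINT y|lborel. LINT x|lborel. f x * (?b y * ?k x y))" ..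
    also have "\<dots> = (LINT y|lborel. ?b y * (LINT x|lborel. f x * ?k x y))"
      by (simp add: mult.left_commute flip: integral_mult_right_zero)
    also have "\<dots> = 0"
      using integral_gaussian_eq_0_of_fourier_eq_0[OF f z, of "s\<^sup>2"] s by simp
    finally show ?thesis unfolding S by simp
  qed
  have bd: "norm (S s x) \<le> (LINT y|lborel. norm (?E y))" for s x
  proof -
    have "integrable lborel (\<lambda>y. ?b (x + s *\<^sub>R y) * ?E y)"
      by (rule Bochner_Integration.integrable_bound[OF Ei]) (auto simp: norm_mult indicator_def)
    then show ?thesis
      unfolding S_def using integrable_norm[OF Ei]
      by (intro Bochner_Integration.integral_norm_bound_integral) (auto simp: norm_mult indicator_def)
  qed
  have pt: "(\<lambda>k. S (1 / real (Suc k)) x) \<longlonglongrightarrow> ?b x * K" if x: "x \<notin> cbox a b - box a b" for x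
    unfolding S_def K_def integral_mult_right_zero[symmetric]
  proof (rule integral_dominated_convergence[where w="\<lambda>y. norm (?E y)"])
    show "AE y in lborel. (\<lambda>k. ?b (x + (1 / real (Suc k)) *\<^sub>R y) * ?E y) \<longlonglongrightarrow> ?b x * ?E y"
    proof (rule AE_I2)
      fix y
      have "(\<lambda>k. x + (1 / real (Suc k)) *\<^sub>R y) \<longlonglongrightarrow> x + 0 *\<^sub>R y"
        by (intro tendsto_intros LIMSEQ_Suc lim_1_over_n)
      then have lim: "(\<lambda>k. x + (1 / real (Suc k)) *\<^sub>R y) \<longlonglongrightarrow> x" by simp
      have "\<forall>\<^sub>F k in sequentially. ?b (x + (1 / real (Suc k)) *\<^sub>R y) = ?b x"
      proof (cases "x \<in> box a b")
        case True
        from topological_tendstoD[OF lim open_box this] show ?thesis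
          by eventually_elim (use True in simp)
      next
        case False
        with x have "x \<in> - cbox a b" by auto
        from topological_tendstoD[OF lim _ this] have "\<forall>\<^sub>F k in sequentially. x + (1 / real (Suc k)) *\<^sub>R y \<in> - cbox a b"
          by (simp add: closed_cbox open_Compl)
        with False show ?thesis using box_subset_cbox[of a b] by (auto elim!: eventually_mono simp: indicator_def)
      qed
      then have "(\<lambda>k. ?b (x + (1 / real (Suc k)) *\<^sub>R y)) \<longlonglongrightarrow> ?b x" by (rule tendsto_eventually)
      then show "(\<lambda>k. ?b (x + (1 / real (Suc k)) *\<^sub>R y) * ?E y) \<longlonglongrightarrow> ?b x * ?E y"
        by (rule tendsto_mult_right)
    qed
  qed (use integrable_norm[OF Ei] in \<open>auto simp: norm_mult indicator_def\<close>)
  have [measurable]: "S s \<in> borel_measurable borel" for s unfolding S_def by measurable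
  have "(\<lambda>k. LINT x|lborel. f x * S (1 / real (Suc k)) x) \<longlonglongrightarrow> (LINT x|lborel. f x * (?b x * K))"
  proof (rule integral_dominated_convergence[where w="\<lambda>x. norm (f x) * (LINT y|lborel. norm (?E y))"])
    have "cbox a b - box a b \<in> null_sets lborel"
      using negligible_frontier_interval[of a b]
      by (subst null_sets_completion_iff[symmetric]) (auto simp: negligible_iff_null_sets)
    then have "AE x in lborel. x \<notin> cbox a b - box a b" by (rule AE_not_in)
    then show "AE x in lborel. (\<lambda>k. f x * S (1 / real (Suc k)) x) \<longlonglongrightarrow> f x * (?b x * K)"
      by eventually_elim (intro tendsto_mult_left pt)
    show "AE x in lborel. norm (f x * S (1 / real (Suc k)) x) \<le> norm (f x) * (LINT y|lborel. norm (?E y))" for k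
      unfolding norm_mult by (intro AE_I2 mult_left_mono bd) auto
  qed (use f in auto)
  then have "(LINT x|lborel. f x * (?b x * K)) = 0" by (simp add: zero LIMSEQ_const_iff)
  moreover have "(LINT x|lborel. f x * (?b x * K)) = (LINT x|lborel. indicator (box a b) x *\<^sub>R f x) * K"
    unfolding integral_mult_left_zero[symmetric] by (intro Bochner_Integration.integral_cong) (auto simp: indicator_def)
  ultimately show ?thesis using K by simp
qed

text \<open>
  The positive and the negative part of \<open>g\<close> are densities of measures that agree on boxes, which form an
  intersection-stable generator.
\<close>

lemma AE_eq_0_of_integral_box_eq_0:
  fixes g :: "'a::euclidean_space \<Rightarrow> real"
  assumes g: "integrable lborel g" and z: "\<And>a b. (LINT x|lborel. indicator (box a b) x *\<^sub>R g x) = 0"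
  shows "AE x in lborel. g x = 0"
proof -
  have [measurable]: "g \<in> borel_measurable borel" using g by auto
  define M where "M s = density lborel (\<lambda>x. ennreal (s * g x))" for s :: real
  have em: "emeasure (M s) A = ennreal (LINT x|lborel. indicator A x * max 0 (s * g x))" if [measurable]: "A \<in> sets borel" for A s
  proof -
    have "integrable lborel (\<lambda>x. indicator A x * max 0 (s * g x))"
      by (rule Bochner_Integration.integrable_bound[of lborel "\<lambda>x. s * g x"]) (use g in \<open>auto simp: indicator_def\<close>)
    then have "(\<integral>\<^sup>+x. ennreal (indicator A x * max 0 (s * g x)) \<partial>lborel) = ennreal (LINT x|lborel. indicator A x * max 0 (s * g x))"
      by (intro nn_integral_eq_integral) (auto simp: indicator_def)
    moreover have "emeasure (M s) A = (\<integral>\<^sup>+x. ennreal (indicator A x * max 0 (s * g x)) \<partial>lborel)"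
      unfolding M_def by (subst emeasure_density) (auto intro!: nn_integral_cong simp: indicator_def max_def ennreal_neg)
    ultimately show ?thesis by simp
  qed
  have "M 1 = M (-1)"
  proof (rule measure_eqI_generator_eq)
    let ?E = "range (\<lambda>(a, b). box a b::'a set)"
    show "Int_stable ?E" by (auto simp: Int_stable_def box_Int_box)
    show "?E \<subseteq> Pow UNIV" "sets (M 1) = sigma_sets UNIV ?E" "sets (M (-1)) = sigma_sets UNIV ?E"
      by (simp_all add: borel_eq_box M_def)
    let ?A = "\<lambda>n::nat. box (- (real n *\<^sub>R One)) (real n *\<^sub>R One) :: 'a set"
    show "range ?A \<subseteq> ?E" "(\<Union>i. ?A i) = UNIV"
      unfolding UN_box_eq_UNIV by auto
    show "emeasure (M 1) (?A i) \<noteq> \<infinity>" for i by (simp add: em)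
    fix X assume "X \<in> ?E"
    then obtain a b where X: "X = box a b" by auto
    have i: "integrable lborel (\<lambda>x. indicator X x * max 0 (s * g x))" for s
      unfolding X by (rule Bochner_Integration.integrable_bound[of lborel "\<lambda>x. s * g x"]) (use g in \<open>auto simp: indicator_def\<close>)
    have "(LINT x|lborel. indicator X x * max 0 (1 * g x)) - (LINT x|lborel. indicator X x * max 0 (-1 * g x))
      = (LINT x|lborel. indicator X x * max 0 (1 * g x) - indicator X x * max 0 (-1 * g x))"
      by (rule Bochner_Integration.integral_diff[symmetric, OF i i])
    also have "\<dots> = (LINT x|lborel. indicator X x *\<^sub>R g x)"
      by (intro Bochner_Integration.integral_cong) (auto simp: indicator_def max_def)
    also have "\<dots> = 0" using z X by simp
    finally show "emeasure (M 1) X = emeasure (M (-1)) X" using X by (simp add: em)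
  qed
  then have "AE x in lborel. ennreal (1 * g x) = ennreal (-1 * g x)"
    unfolding M_def by (subst (asm) sigma_finite_measure.density_unique_iff[OF sigma_finite_lborel]) auto
  then show ?thesis
    by eventually_elim (metis ennreal_eq_0_iff ennreal_inj linear minus_zero mult_1 mult_minus1 neg_le_0_iff_le neg_equal_0_iff_equal order_antisym)
qed

lemma fourier_eq_0_imp_AE_eq_0:
  fixes f :: "real^'n::finite \<Rightarrow> complex"
  assumes f: "integrable lborel f" and z: "AE \<xi> in lborel. fourier f \<xi> = 0"
  shows "AE x in lborel. f x = 0"
proof -
  have "integrable lborel (\<lambda>x. indicator (box a b) x *\<^sub>R f x)" for a b
    by (rule Bochner_Integration.integrable_bound[OF f]) (use f in \<open>auto simp: indicator_def\<close>)
  note int = this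
  have "AE x in lborel. Re (f x) = 0"
  proof (rule AE_eq_0_of_integral_box_eq_0)
    show "(LINT x|lborel. indicator (box a b) x *\<^sub>R Re (f x)) = 0" for a b
      using integral_box_eq_0_of_fourier_eq_0[OF f z, of a b] integral_Re[OF int, of a b] by simp
  qed (use f in auto)
  moreover have "AE x in lborel. Im (f x) = 0"
  proof (rule AE_eq_0_of_integral_box_eq_0)
    show "(LINT x|lborel. indicator (box a b) x *\<^sub>R Im (f x)) = 0" for a b
      using integral_box_eq_0_of_fourier_eq_0[OF f z, of a b] integral_Im[OF int, of a b] by simp
  qed (use f in auto)
  ultimately show ?thesis by eventually_elim (simp add: complex_eq_iff)
qed

section \<open>Fourier multipliers on \<open>L\<^sup>1\<close>\<close>

lemma fourier_add:
  fixes f g :: "real^'n::finite \<Rightarrow> complex"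
  assumes "integrable lborel f" "integrable lborel g"
  shows "fourier (\<lambda>x. f x + g x) \<xi> = fourier f \<xi> + fourier g \<xi>"
proof -
  have "integrable lborel (\<lambda>x. exp (- \<i> * of_real (x \<bullet> \<xi>)) * k x)" if k: "integrable lborel k" for k :: "real^'n \<Rightarrow> complex"
    by (rule Bochner_Integration.integrable_bound[OF k]) (use k in \<open>auto simp: norm_mult norm_exp_eq_Re\<close>)
  from Bochner_Integration.integral_add[OF this[OF assms(1)] this[OF assms(2)]] show ?thesis
    by (simp add: fourier_def distrib_left)
qed

lemma fourier_cmult: "fourier (\<lambda>x. c * f x) \<xi> = c * fourier f \<xi>"
  by (simp add: fourier_def mult.left_commute)

lemma L1_norm_nonneg: "0 \<le> L1_norm f"
  by (simp add: L1_norm_def integral_nonneg_AE)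

lemma L1_norm_add_le:
  assumes "integrable lborel f" "integrable lborel g"
  shows "L1_norm (\<lambda>x. f x + g x) \<le> L1_norm f + L1_norm g"
proof -
  have "L1_norm (\<lambda>x. f x + g x) \<le> (LINT x|lborel. norm (f x) + norm (g x))"
    unfolding L1_norm_def using assms by (intro integral_mono_AE) (auto intro: norm_triangle_ineq)
  then show ?thesis using assms unfolding L1_norm_def by simp
qed

lemma L1_norm_cmult: "L1_norm (\<lambda>x. c * f x) = norm c * L1_norm f"
  by (simp add: L1_norm_def norm_mult)

lemma has_fourier_add:
  "has_fourier f v \<Longrightarrow> has_fourier g w \<Longrightarrow> has_fourier (\<lambda>x. f x + g x) (\<lambda>\<xi>. v \<xi> + w \<xi>)"
  unfolding has_fourier_def by (auto simp: fourier_add elim: eventually_elim2)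

lemma has_fourier_cong:
  "has_fourier f v \<Longrightarrow> AE \<xi> in lborel. v \<xi> = w \<xi> \<Longrightarrow> has_fourier f w"
  unfolding has_fourier_def by (auto elim: eventually_elim2)

text \<open>
  Injectivity makes the norms of \<open>inv_fourier\<close> independent of the choice behind it.
\<close>

lemma L1_norm_eq_of_has_fourier:
  assumes f: "has_fourier f w" and g: "has_fourier g w"
  shows "L1_norm f = L1_norm g"
proof -
  have int: "integrable lborel f" "integrable lborel (\<lambda>x. - 1 * g x)" using f g by (auto simp: has_fourier_def)
  have "AE x in lborel. f x + - 1 * g x = 0"
  proof (rule fourier_eq_0_imp_AE_eq_0)
    show "integrable lborel (\<lambda>x. f x + - 1 * g x)" using int by (rule Bochner_Integration.integrable_add)
    have "AE \<xi> in lborel. fourier f \<xi> = w \<xi>" "AE \<xi> in lborel. fourier g \<xi> = w \<xi>" using f g by (auto simp: has_fourier_def)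
    then show "AE \<xi> in lborel. fourier (\<lambda>x. f x + - 1 * g x) \<xi> = 0"
      unfolding fourier_add[OF int] fourier_cmult by eventually_elim simp
  qed
  then show ?thesis using int unfolding L1_norm_def by (intro integral_cong_AE) (auto elim: eventually_mono)
qed

lemma
  assumes "has_fourier f w"
  shows has_fourier_inv_fourier: "has_fourier (inv_fourier w) w"
    and L1_norm_inv_fourier: "L1_norm (inv_fourier w) = L1_norm f"
    and fourier_L1I: "w \<in> fourier_L1"
proof -
  show 1: "has_fourier (inv_fourier w) w"
    unfolding inv_fourier_def by (rule someI[where P="\<lambda>f. has_fourier f w"]) (rule assms)
  show "L1_norm (inv_fourier w) = L1_norm f" by (rule L1_norm_eq_of_has_fourier[OF 1 assms])
  show "w \<in> fourier_L1" using assms by (auto simp: fourier_L1_def)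
qed

text \<open>
  The convolution is the superposition of the translates of \<open>f\<close> with weight \<open>k\<close>.
\<close>

lemma fourier_convolution:
  fixes f k :: "real^'n::finite \<Rightarrow> complex"
  assumes f: "integrable lborel f" and k: "integrable lborel k"
  defines "g \<equiv> \<lambda>x. LINT y|lborel. k y * f (x - y)"
  shows "integrable lborel g" "fourier g \<xi> = fourier k \<xi> * fourier f \<xi>" "L1_norm g \<le> L1_norm k * L1_norm f"
proof -
  have [measurable]: "f \<in> borel_measurable borel" "k \<in> borel_measurable borel" using f k by auto
  let ?h = "\<lambda>y x. k y * f (x - y)"
  have tr: "(LINT x|lborel. F (x - y)) = (LINT x|lborel. F x)" "integrable lborel F \<Longrightarrow> integrable lborel (\<lambda>x. F (x - y))"
    if "F \<in> borel_measurable borel" for F :: "real^'n \<Rightarrow> 'b::{banach, second_countable_topology}" and y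
  proof -
    have D: "lborel = distr lborel borel (\<lambda>x. - y + x)" using lborel_affine[of 1 "-y"] by (simp add: density_1)
    have "(LINT x|distr lborel borel (\<lambda>x. - y + x). F x) = (LINT x|lborel. F (- y + x))"
      using that by (subst integral_distr) auto
    then show "(LINT x|lborel. F (x - y)) = (LINT x|lborel. F x)" using D by simp
    show "integrable lborel (\<lambda>x. F (x - y))" if "integrable lborel F"
      using that \<open>F \<in> _\<close> D integrable_distr_eq[of "\<lambda>x. - y + x" lborel borel F] by simp
  qed
  have m: "case_prod ?h \<in> borel_measurable (lborel \<Otimes>\<^sub>M lborel)" by measurable
  have i: "integrable lborel (?h y)" for y using tr(2)[OF _ f] by auto
  have n: "L1_norm (?h y) = norm (k y) * L1_norm f" for y
    unfolding L1_norm_cmult using tr(1)[of "\<lambda>x. norm (f x)" y] by (simp add: L1_norm_def)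
  have B: "integrable lborel (\<lambda>y. norm (k y) * L1_norm f)" using k by auto
  note s = integrable_superposition[OF sigma_finite_lborel m i eq_refl[OF n] B]
    fourier_superposition[OF sigma_finite_lborel m i eq_refl[OF n] B]
    L1_norm_superposition[OF sigma_finite_lborel m i eq_refl[OF n] B]
  show "integrable lborel g" unfolding g_def by (rule s(1))
  show "L1_norm g \<le> L1_norm k * L1_norm f" unfolding g_def using s(3) by (simp add: L1_norm_def)
  have "fourier (?h y) \<xi> = exp (- \<i> * of_real (y \<bullet> \<xi>)) * k y * fourier f \<xi>" for y
  proof -
    have "fourier (?h y) \<xi> = (LINT x|lborel. (\<lambda>z. exp (- \<i> * of_real (y \<bullet> \<xi>)) * k y * (exp (- \<i> * of_real (z \<bullet> \<xi>)) * f z)) (x - y))"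
      unfolding fourier_def by (intro Bochner_Integration.integral_cong) (auto simp: inner_diff_left algebra_simps simp flip: exp_add)
    also have "\<dots> = exp (- \<i> * of_real (y \<bullet> \<xi>)) * k y * fourier f \<xi>"
      by (subst tr(1)) (auto simp: fourier_def)
    finally show ?thesis .
  qed
  then show "fourier g \<xi> = fourier k \<xi> * fourier f \<xi>" unfolding g_def s(2) by (simp add: fourier_def)
qed

text \<open>
  \<open>m\<close> is an \<open>L\<^sup>1\<close>-multiplier of norm at most \<open>B\<close>. Bounds on \<open>L\<^sup>1\<close> of the form needed here come either from
  constants or from integrable kernels, and they are stable under sums and products.
\<close>

definition L1_mult :: "(real^'n::finite \<Rightarrow> complex) \<Rightarrow> real \<Rightarrow> bool" where
  "L1_mult m B \<longleftrightarrow> (\<forall>f. integrable lborel f \<longrightarrow>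
     (\<exists>g. has_fourier g (\<lambda>\<xi>. m \<xi> * fourier f \<xi>) \<and> L1_norm g \<le> B * L1_norm f))"

lemma L1_mult_mono: "L1_mult m B \<Longrightarrow> B \<le> B' \<Longrightarrow> L1_mult m B'"
  unfolding L1_mult_def by (meson L1_norm_nonneg mult_right_mono order_trans)

lemma L1_mult_cong:
  assumes "L1_mult m B" and e: "AE \<xi> in lborel. m \<xi> = m' \<xi>"
  shows "L1_mult m' B"
proof -
  have "has_fourier g (\<lambda>\<xi>. m \<xi> * fourier f \<xi>) \<Longrightarrow> has_fourier g (\<lambda>\<xi>. m' \<xi> * fourier f \<xi>)" for f g
    by (erule has_fourier_cong) (use e in \<open>auto elim: eventually_mono\<close>)
  then show ?thesis using assms(1) unfolding L1_mult_def by meson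
qed

lemma L1_mult_const: "L1_mult (\<lambda>_::real^'n::finite. c) (norm c)"
  unfolding L1_mult_def
proof (intro allI impI)
  fix f :: "real^'n \<Rightarrow> complex" assume "integrable lborel f"
  then show "\<exists>g. has_fourier g (\<lambda>\<xi>. c * fourier f \<xi>) \<and> L1_norm g \<le> norm c * L1_norm f"
    by (intro exI[of _ "\<lambda>x. c * f x"]) (auto simp: has_fourier_def fourier_cmult L1_norm_cmult)
qed

lemma L1_mult_kernel:
  fixes m :: "real^'n::finite \<Rightarrow> complex"
  assumes "has_fourier k m" shows "L1_mult m (L1_norm k)"
  unfolding L1_mult_def
proof (intro allI impI)
  fix f :: "real^'n \<Rightarrow> complex" assume f: "integrable lborel f"
  have k: "integrable lborel k" "AE \<xi> in lborel. fourier k \<xi> = m \<xi>" using assms by (auto simp: has_fourier_def)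
  note c = fourier_convolution[OF f k(1)]
  show "\<exists>g. has_fourier g (\<lambda>\<xi>. m \<xi> * fourier f \<xi>) \<and> L1_norm g \<le> L1_norm k * L1_norm f"
    by (rule exI[of _ "\<lambda>x. LINT y|lborel. k y * f (x - y)"])
       (use c k(2) in \<open>auto simp: has_fourier_def elim: eventually_mono\<close>)
qed

lemma L1_mult_add:
  fixes m m' :: "real^'n::finite \<Rightarrow> complex"
  assumes "L1_mult m B" "L1_mult m' B'"
  shows "L1_mult (\<lambda>\<xi>. m \<xi> + m' \<xi>) (B + B')"
  unfolding L1_mult_def
proof (intro allI impI)
  fix f :: "real^'n \<Rightarrow> complex" assume f: "integrable lborel f"
  obtain g where g: "has_fourier g (\<lambda>\<xi>. m \<xi> * fourier f \<xi>)" "L1_norm g \<le> B * L1_norm f" using assms(1) f by (auto simp: L1_mult_def)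
  obtain h where h: "has_fourier h (\<lambda>\<xi>. m' \<xi> * fourier f \<xi>)" "L1_norm h \<le> B' * L1_norm f" using assms(2) f by (auto simp: L1_mult_def)
  have "L1_norm (\<lambda>x. g x + h x) \<le> (B + B') * L1_norm f"
    using L1_norm_add_le[of g h] g h by (auto simp: has_fourier_def algebra_simps)
  with has_fourier_add[OF g(1) h(1)] show "\<exists>g. has_fourier g (\<lambda>\<xi>. (m \<xi> + m' \<xi>) * fourier f \<xi>) \<and> L1_norm g \<le> (B + B') * L1_norm f"
    by (auto simp: distrib_right)
qed

lemma L1_mult_mult:
  fixes m m' :: "real^'n::finite \<Rightarrow> complex"
  assumes "L1_mult m B" "L1_mult m' B'" "B \<ge> 0"
  shows "L1_mult (\<lambda>\<xi>. m \<xi> * m' \<xi>) (B * B')"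
  unfolding L1_mult_def
proof (intro allI impI)
  fix f :: "real^'n \<Rightarrow> complex" assume f: "integrable lborel f"
  obtain h where h: "has_fourier h (\<lambda>\<xi>. m' \<xi> * fourier f \<xi>)" "L1_norm h \<le> B' * L1_norm f" using assms(2) f by (auto simp: L1_mult_def)
  then have hi: "integrable lborel h" "AE \<xi> in lborel. fourier h \<xi> = m' \<xi> * fourier f \<xi>" by (auto simp: has_fourier_def)
  obtain g where g: "has_fourier g (\<lambda>\<xi>. m \<xi> * fourier h \<xi>)" "L1_norm g \<le> B * L1_norm h" using assms(1) hi by (auto simp: L1_mult_def)
  have "has_fourier g (\<lambda>\<xi>. m \<xi> * m' \<xi> * fourier f \<xi>)"
    by (rule has_fourier_cong[OF g(1)]) (use hi(2) in \<open>auto elim: eventually_mono\<close>)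
  moreover have "L1_norm g \<le> B * B' * L1_norm f"
    using order.trans[OF g(2) mult_left_mono[OF h(2) \<open>B \<ge> 0\<close>]] by (simp add: mult.assoc)
  ultimately show "\<exists>g. has_fourier g (\<lambda>\<xi>. m \<xi> * m' \<xi> * fourier f \<xi>) \<and> L1_norm g \<le> B * B' * L1_norm f" by blast
qed

section \<open>Complex heat kernels and resolvents\<close>

text \<open>
  The kernel of \<open>exp (z \<Delta>)\<close> for complex time \<open>z\<close>. Dividing by \<open>gauss_int\<close> normalises it without naming a branch of
  \<open>z\<^bsup>n/2\<^esup>\<close>.
\<close>

definition heat_kernel :: "complex \<Rightarrow> real^'n::finite \<Rightarrow> complex" where
  "heat_kernel z x = exp (- (1 / (4 * z)) * of_real ((norm x)\<^sup>2)) / gauss_int (1 / (4 * z)) ^ CARD('n)"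

lemma
  assumes z: "Re z > 0"
  shows integrable_heat_kernel: "integrable lborel (heat_kernel z :: real^'n::finite \<Rightarrow> complex)"
    and fourier_heat_kernel: "fourier (heat_kernel z :: real^'n \<Rightarrow> complex) \<xi> = exp (- z * of_real ((norm \<xi>)\<^sup>2))"
    and L1_norm_heat_kernel: "L1_norm (heat_kernel z :: real^'n \<Rightarrow> complex) = (norm z / Re z) powr (CARD('n) / 2)"
proof -
  define c where "c = 1 / (4 * z)"
  have z0: "z \<noteq> 0" using z by auto
  have Rc: "Re c = Re z / (4 * (norm z)\<^sup>2)"
  proof -
    have "c = cnj z / (4 * (of_real ((norm z)\<^sup>2)))"
      using z0 unfolding complex_norm_square c_def by (simp add: field_simps)
    then show ?thesis by (simp flip: of_real_power)
  qed
  have c: "Re c > 0" using z z0 unfolding Rc by simp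
  have K: "heat_kernel z x = (1 / gauss_int c ^ CARD('n)) * exp (- c * of_real ((norm x)\<^sup>2))" for x :: "real^'n"
    by (simp add: heat_kernel_def c_def)
  have J: "gauss_int c \<noteq> 0" by (rule gauss_int_nonzero[OF c])
  show "integrable lborel (heat_kernel z :: real^'n \<Rightarrow> complex)"
    unfolding K[abs_def] using integrable_gaussian[OF c] by (intro integrable_mult_right) auto
  show "fourier (heat_kernel z :: real^'n \<Rightarrow> complex) \<xi> = exp (- z * of_real ((norm \<xi>)\<^sup>2))"
    unfolding K[abs_def] fourier_cmult fourier_gaussian[OF c] using J z0 by (simp add: c_def mult.commute)
  have "(norm (gauss_int c))\<^sup>2 = pi / norm c"
    using gauss_int_squared[OF c] by (simp add: norm_divide flip: norm_power)
  then have nJ: "norm (gauss_int c) = (pi / norm c) powr (1/2)"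
    by (metis norm_ge_zero powr_half_sqrt real_sqrt_abs abs_of_nonneg zero_le_power2)
  have "L1_norm (heat_kernel z :: real^'n \<Rightarrow> complex) = (pi / Re c) powr (CARD('n) / 2) / (pi / norm c) powr (CARD('n) / 2)"
    unfolding K[abs_def] L1_norm_cmult L1_norm_gaussian[OF c]
    by (simp add: norm_divide norm_power nJ powr_powr flip: powr_realpow')
  also have "\<dots> = ((pi / Re c) / (pi / norm c)) powr (CARD('n) / 2)"
    using c by (subst powr_divide) auto
  also have "(pi / Re c) / (pi / norm c) = norm z / Re z"
    using z z0 c unfolding Rc by (simp add: c_def norm_divide norm_mult power2_eq_square field_simps)
  finally show "L1_norm (heat_kernel z :: real^'n \<Rightarrow> complex) = (norm z / Re z) powr (CARD('n) / 2)" .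
qed

lemma
  assumes c: "Re c < 0"
  shows integrable_exp_half_line: "integrable lborel (\<lambda>x::real. indicator {0<..} x *\<^sub>R exp (c * of_real x))"
    and integral_exp_half_line: "(LINT x|lborel. indicator {0<..} x *\<^sub>R exp (c * of_real x)) = - (1 / c)"
proof -
  have "set_integrable lborel {0<..} (\<lambda>x. exp (- (x * (- Re c))))"
    by (rule integrable_I0i_exp_mscale) (use c in simp)
  then show i: "integrable lborel (\<lambda>x::real. indicator {0<..} x *\<^sub>R exp (c * of_real x))"
    unfolding set_integrable_def
    by (rule Bochner_Integration.integrable_bound) (auto simp: indicator_def norm_exp_eq_Re mult.commute)
  have "(LBINT x=0..\<infinity>. exp (c * of_real x)) = 0 - 1 / c"
  proof (rule interval_integral_FTC_integrable[where F="\<lambda>x. exp (c * of_real x) / c"])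
    show "((\<lambda>x. exp (c * of_real x) / c) has_vector_derivative exp (c * of_real x)) (at x)" for x
      by (rule has_vector_derivative_real_field) (use c in \<open>auto intro!: derivative_eq_intros\<close>)
    show "set_integrable lborel (einterval 0 \<infinity>) (\<lambda>x. exp (c * of_real x))"
      using i by (simp add: set_integrable_def zero_ereal_def)
    have "((\<lambda>x. norm (exp (c * of_real x) / c)) \<longlongrightarrow> 0) at_top"
    proof -
      have "((\<lambda>x. exp (Re c * x)) \<longlongrightarrow> 0) at_top" using c by real_asymp
      then have "((\<lambda>x. exp (Re c * x) / norm c) \<longlongrightarrow> 0) at_top" by (rule tendsto_divide_zero)
      then show ?thesis by (simp add: norm_divide norm_exp_eq_Re)
    qed
    then have "((\<lambda>x. exp (c * of_real x) / c) \<longlongrightarrow> 0) at_top" by (rule tendsto_norm_zero_cancel)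
    then show "(((\<lambda>x. exp (c * of_real x) / c) \<circ> real_of_ereal) \<longlongrightarrow> 0) (at_left \<infinity>)"
      by (simp add: ereal_tendsto_simps)
    have "((\<lambda>x::real. exp (c * of_real x) / c) \<longlongrightarrow> exp (c * of_real 0) / c) (at_right 0)"
      using c by (intro tendsto_intros) auto
    then show "(((\<lambda>x. exp (c * of_real x) / c) \<circ> real_of_ereal) \<longlongrightarrow> 1 / c) (at_right 0)"
      by (simp add: zero_ereal_def ereal_tendsto_simps)
  qed (auto intro!: continuous_intros)
  then show "(LINT x|lborel. indicator {0<..} x *\<^sub>R exp (c * of_real x)) = - (1 / c)"
    by (simp add: interval_lebesgue_integral_def set_lebesgue_integral_def zero_ereal_def)
qed

text \<open>
  Let \<open>u = exp (i d \<theta>)\<close> be the direction of a ray and \<open>z = exp (i d (\<pi> - \<theta>)/2)\<close>. Then \<open>Re z = sin (\<theta>/2)\<close> and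
  \<open>Re (z u) = - sin (\<theta>/2)\<close>, so \<open>1 / (s u - x) = - z \<integral>\<^sub>0 exp (z t (s u - x)) dt\<close> for all \<open>x \<ge> 0\<close>. The factor
  \<open>exp (- z t x)\<close> is a heat kernel of norm \<open>sin (\<theta>/2)\<^bsup>-n/2\<^esup>\<close>, and the integral of \<open>|exp (z t s u)|\<close> over \<open>t\<close> gives
  the remaining \<open>1 / (s sin (\<theta>/2))\<close>. This choice of \<open>z\<close> makes both real parts equally large.
\<close>

lemma resolvent_superposition:
  fixes g :: "real \<Rightarrow> complex"
  assumes th: "0 < \<theta>" "\<theta> < pi" and d: "d = 1 \<or> d = -1" and [measurable]: "g \<in> borel_measurable borel"
    and g: "integrable lborel (\<lambda>s. indicator {0<..} s * (norm (g s) / s))"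
  shows "\<exists>k :: real^'n::finite \<Rightarrow> complex. integrable lborel k
    \<and> L1_norm k \<le> sin (\<theta>/2) powr (- CARD('n) / 2 - 1) * (LINT s|lborel. indicator {0<..} s * (norm (g s) / s))
    \<and> (\<forall>\<xi>. fourier k \<xi> = (LINT s|lborel. indicator {0<..} s *\<^sub>R (g s * cis (d * \<theta>) / (of_real s * cis (d * \<theta>) - of_real ((norm \<xi>)\<^sup>2)))))"
proof -
  define S where "S = sin (\<theta>/2)"
  have S: "S > 0" unfolding S_def using th by (intro sin_gt_zero) auto
  define u z where "u = cis (d * \<theta>)" and "z = cis (d * (pi/2 - \<theta>/2))"
  have Rez: "Re z = S" using d cos_minus[of "pi/2 - \<theta>/2"] by (auto simp: z_def S_def sin_cos_eq)
  have "z * u = cis (d * (pi / 2 + \<theta> / 2))" by (simp add: z_def u_def cis_mult algebra_simps)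
  then have Rezu: "Re (z * u) = - S" using d cos_minus[of "pi/2 + \<theta>/2"] by (auto simp: S_def minus_sin_cos_eq add.commute)
  have nz: "norm z = 1" "z \<noteq> 0" by (simp_all add: z_def)
  have nu: "norm u = 1" by (simp add: u_def)
  let ?n = "real CARD('n)"
  define I where "I s = (indicator {0<..} s :: real)" for s :: real
  have [measurable]: "I \<in> borel_measurable borel" unfolding I_def[abs_def] by measurable
  define w where "w s t = g s * u * (- z) * exp (z * u * of_real s * of_real t)" for s t :: real
  define h :: "real \<times> real \<Rightarrow> real^'n \<Rightarrow> complex"
    where "h = (\<lambda>(s, t) x. (I s * I t) *\<^sub>R (w s t * heat_kernel (z * of_real t) x))"
  define B where "B = (\<lambda>(s, t). I s * I t * (norm (g s) * exp (- (t * (s * S)))) * S powr (- ?n / 2))"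
  have wn: "norm (w s t) = norm (g s) * exp (- (t * (s * S)))" for s t
  proof -
    have "Re (z * u * of_real s * of_real t) = Re (z * u) * (s * t)" by (simp add: algebra_simps)
    then have "Re (z * u * of_real s * of_real t) = - (t * (s * S))" unfolding Rezu by simp
    then show ?thesis by (simp add: w_def norm_mult nz nu norm_exp_eq_Re)
  qed
  have ReZ: "Re (z * of_real t) > 0" if "t > 0" for t using that Rez S by simp
  have hm[measurable]: "case_prod h \<in> borel_measurable ((lborel \<Otimes>\<^sub>M lborel) \<Otimes>\<^sub>M lborel)"
    unfolding h_def heat_kernel_def gauss_int_def w_def case_prod_unfold by measurable
  have hi: "integrable lborel (h p)" for p
  proof (cases p)
    case (Pair s t)
    then show ?thesis using integrable_heat_kernel[OF ReZ, of t]
      by (cases "t > 0") (auto simp: h_def I_def)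
  qed
  have hB: "L1_norm (h p) \<le> B p" for p
  proof (cases p)
    case [simp]: (Pair s t)
    show ?thesis
    proof (cases "t > 0")
      case True
      have "L1_norm (heat_kernel (z * of_real t) :: real^'n \<Rightarrow> complex) = (1 / S) powr (?n / 2)"
        using True nz Rez by (simp add: L1_norm_heat_kernel[OF ReZ] norm_mult)
      also have "\<dots> = S powr (- ?n / 2)" using S by (simp add: powr_divide powr_minus divide_simps)
      finally have E: "L1_norm (heat_kernel (z * of_real t) :: real^'n \<Rightarrow> complex) = S powr (- ?n / 2)" .
      have "h p x = (of_real (I s * I t) * w s t) * heat_kernel (z * of_real t) x" for x
        by (simp add: h_def scaleR_conv_of_real)
      then have "L1_norm (h p) = norm (of_real (I s * I t) * w s t) * S powr (- ?n / 2)"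
        unfolding E[symmetric] by (metis L1_norm_cmult ext)
      then show ?thesis by (simp add: B_def norm_mult wn I_def)
    qed (auto simp: h_def I_def L1_norm_def B_def)
  qed
  have Binner: "(LINT t|lborel. B (s, t)) = S powr (- ?n / 2 - 1) * (I s * (norm (g s) / s))"
    and Bii: "integrable lborel (\<lambda>t. B (s, t))" for s
  proof -
    have "integrable lborel (\<lambda>t. B (s, t)) \<and> (LINT t|lborel. B (s, t)) = S powr (- ?n / 2 - 1) * (I s * (norm (g s) / s))"
    proof (cases "s > 0")
      case True
      have Rc: "Re (of_real (- (s * S))) < 0" using True S by simp
      have e: "I t *\<^sub>R exp (of_real (- (s * S)) * of_real t) = complex_of_real (I t * exp (- (t * (s * S))))" for t
        by (simp add: scaleR_conv_of_real exp_of_real[symmetric] mult_ac)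
      have "integrable lborel (\<lambda>t. I t * exp (- (t * (s * S))))"
        using integrable_exp_half_line[OF Rc] unfolding I_def[symmetric] e complex_of_real_integrable_eq .
      moreover have "(LINT t|lborel. I t * exp (- (t * (s * S)))) = 1 / (s * S)"
        using integral_exp_half_line[OF Rc] unfolding I_def[symmetric] e integral_complex_of_real
        by (simp flip: of_real_mult of_real_eq_iff[where 'a=complex])
      moreover have Beq: "B (s, t) = (I s * norm (g s) * S powr (- ?n / 2)) * (I t * exp (- (t * (s * S))))" for t
        by (simp add: B_def mult_ac)
      moreover have "S powr (- ?n / 2 - 1) = S powr (- ?n / 2) / S" using S by (simp only: powr_diff powr_one)
      ultimately show ?thesis unfolding Beq integral_mult_right_zero using S True
        by (intro conjI integrable_mult_right) (auto simp: mult_ac)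
    qed (simp add: B_def I_def)
    then show "integrable lborel (\<lambda>t. B (s, t))" "(LINT t|lborel. B (s, t)) = S powr (- ?n / 2 - 1) * (I s * (norm (g s) / s))" by auto
  qed
  have Bpos: "B p \<ge> 0" for p by (cases p) (auto simp: B_def I_def)
  have Bm[measurable]: "B \<in> borel_measurable (lborel \<Otimes>\<^sub>M lborel)" unfolding B_def by measurable
  have Bi: "integrable (lborel \<Otimes>\<^sub>M lborel) B"
  proof (rule lborel_pair.Fubini_integrable)
    show "integrable lborel (\<lambda>s. LINT t|lborel. norm (B (s, t)))"
      using integrable_mult_right[OF g, of "S powr (- ?n / 2 - 1)"] Bpos by (simp add: Binner I_def)
  qed (use Bii in auto)
  have BB: "(LINT p|(lborel \<Otimes>\<^sub>M lborel). B p) = S powr (- ?n / 2 - 1) * (LINT s|lborel. I s * (norm (g s) / s))"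
    using lborel_pair.integral_fst[of "\<lambda>s t. B (s, t)"] Bi unfolding Binner integral_mult_right_zero by simp
  have sf: "sigma_finite_measure (lborel \<Otimes>\<^sub>M lborel :: (real \<times> real) measure)"
    by (rule lborel_pair.P.sigma_finite_measure_axioms)
  note sp = integrable_superposition[OF sf hm hi hB Bi] fourier_superposition[OF sf hm hi hB Bi] L1_norm_superposition[OF sf hm hi hB Bi]
  have F: "(LINT p|(lborel \<Otimes>\<^sub>M lborel). fourier (h p) \<xi>) = (LINT s|lborel. I s *\<^sub>R (g s * u / (of_real s * u - of_real ((norm \<xi>)\<^sup>2))))" for \<xi>
  proof -
    define r where "r = (norm \<xi>)\<^sup>2"
    have r: "r \<ge> 0" by (simp add: r_def)
    define m where "m = (\<lambda>(s, t). (I s * I t) *\<^sub>R (w s t * exp (- (z * of_real t) * of_real r)))"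
    have "fourier (h p) \<xi> = m p" for p
    proof (cases p)
      case [simp]: (Pair s t)
      show ?thesis
      proof (cases "t > 0")
        case True
        have "h p = (\<lambda>x. (of_real (I s * I t) * w s t) * heat_kernel (z * of_real t) x)"
          by (simp add: h_def scaleR_conv_of_real fun_eq_iff)
        then have "fourier (h p) \<xi> = (of_real (I s * I t) * w s t) * exp (- (z * of_real t) * of_real r)"
          by (simp only: fourier_cmult fourier_heat_kernel[OF ReZ[OF True]] r_def)
        then show ?thesis by (simp add: m_def scaleR_conv_of_real)
      qed (simp add: h_def I_def fourier_def m_def)
    qed
    then have "(LINT p|(lborel \<Otimes>\<^sub>M lborel). fourier (h p) \<xi>) = (LINT p|(lborel \<Otimes>\<^sub>M lborel). m p)" by simp
    also have "\<dots> = (LINT s|lborel. LINT t|lborel. m (s, t))"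
    proof -
      have [measurable]: "m \<in> borel_measurable (lborel \<Otimes>\<^sub>M lborel)" unfolding m_def w_def by measurable
      have "norm (m p) \<le> S powr (?n / 2) * B p" for p
      proof (cases p)
        case [simp]: (Pair s t)
        have le: "norm (exp (- (z * of_real t) * of_real r)) \<le> 1" if "t > 0"
          using that r S Rez by (simp add: norm_exp_eq_Re)
        have "S powr (?n / 2) * S powr (- ?n / 2) = 1" using S by (simp flip: powr_add)
        then have "S powr (?n / 2) * B p = I s * I t * (norm (g s) * exp (- (t * (s * S))))"
          by (simp add: B_def mult_ac)
        moreover have "norm (m p) = I s * I t * (norm (g s) * exp (- (t * (s * S)))) * norm (exp (- (z * of_real t) * of_real r))"
          by (simp add: m_def norm_mult wn I_def)
        ultimately show ?thesis using le by (cases "t > 0") (auto simp: I_def intro!: mult_left_le)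
      qed
      then have "integrable (lborel \<Otimes>\<^sub>M lborel) m"
        using Bpos S by (intro Bochner_Integration.integrable_bound[OF integrable_mult_right[OF Bi, of "S powr (?n / 2)"]]) auto
      then show ?thesis using lborel_pair.integral_fst[of "\<lambda>s t. m (s, t)"] by simp
    qed
    also have "\<dots> = (LINT s|lborel. I s *\<^sub>R (g s * u / (of_real s * u - of_real r)))"
    proof (rule Bochner_Integration.integral_cong[OF refl])
      fix s :: real
      show "(LINT t|lborel. m (s, t)) = I s *\<^sub>R (g s * u / (of_real s * u - of_real r))"
      proof (cases "s > 0")
        case True
        define c where "c = z * (of_real s * u - of_real r)"
        have "Re c = s * Re (z * u) - r * Re z" by (simp add: c_def algebra_simps)
        then have "Re c = - (s * S + r * S)" unfolding Rez Rezu by simp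
        moreover have "s * S > 0" "r * S \<ge> 0" using True r S by auto
        ultimately have c: "Re c < 0" by linarith
        have "exp (z * u * of_real s * of_real t) * exp (- (z * of_real t) * of_real r) = exp (c * of_real t)" for t :: real
          by (simp add: c_def algebra_simps flip: exp_add)
        then have meq: "m (s, t) = (of_real (I s) * g s * u * (- z)) * (I t *\<^sub>R exp (c * of_real t))" for t
          by (simp add: m_def w_def scaleR_conv_of_real mult.assoc mult.left_commute)
        have "(LINT t|lborel. I t *\<^sub>R exp (c * of_real t)) = - (1 / c)"
          using integral_exp_half_line[OF c] by (simp add: I_def)
        then have "(LINT t|lborel. m (s, t)) = (of_real (I s) * g s * u * (- z)) * (- (1 / c))"
          unfolding meq by (simp only: integral_mult_right_zero)
        also have "\<dots> = I s *\<^sub>R (g s * u / (of_real s * u - of_real r))"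
          using nz by (simp add: c_def scaleR_conv_of_real)
        finally show ?thesis .
      qed (simp add: m_def I_def)
    qed
    finally show ?thesis by (simp add: r_def)
  qed
  show ?thesis
    using sp F BB unfolding u_def S_def I_def by (intro exI[of _ "\<lambda>x. LINT p|(lborel \<Otimes>\<^sub>M lborel). h p x"]) auto
qed

section \<open>The Cauchy formula on a sector\<close>

text \<open>
  The closed sector with half angle \<open>\<theta> < \<pi>/2\<close>, written with linear inequalities so that convex combinations
  are immediate; \<open>rcis_in_sector\<close> and \<open>sector_polar\<close> translate to polar coordinates.
\<close>

definition sector :: "real \<Rightarrow> complex set" where
  "sector \<theta> = {w. \<bar>Im w\<bar> * cos \<theta> \<le> sin \<theta> * Re w}"

lemma abs_sin_eq: "\<bar>x\<bar> \<le> pi \<Longrightarrow> \<bar>sin x\<bar> = sin \<bar>x\<bar>"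
  using sin_ge_zero[of x] sin_ge_zero[of "- x"] by (auto simp: abs_if)

lemma rcis_in_sector:
  assumes th: "0 < \<theta>" "\<theta> < pi/2" and r: "0 \<le> r" and p: "\<bar>\<phi>\<bar> \<le> \<theta>"
  shows "rcis r \<phi> \<in> sector \<theta>"
proof -
  have "sin (\<theta> - \<bar>\<phi>\<bar>) \<ge> 0" using th p by (intro sin_ge_zero) auto
  then have "\<bar>sin \<phi>\<bar> * cos \<theta> \<le> sin \<theta> * cos \<phi>"
    using th p by (simp add: abs_sin_eq sin_diff mult.commute)
  then show ?thesis using r
    using mult_left_mono[of "\<bar>sin \<phi>\<bar> * cos \<theta>" "sin \<theta> * cos \<phi>" r]
    by (simp add: sector_def abs_mult mult_ac)
qed

lemma sector_polar:
  assumes th: "0 < \<theta>" "\<theta> < pi/2" and w: "w \<in> sector \<theta>" "w \<noteq> 0"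
  shows "Re w > 0" "w = rcis (norm w) (Arg w)" "\<bar>Arg w\<bar> \<le> \<theta>"
proof -
  have c: "cos \<theta> > 0" "sin \<theta> > 0" using th by (auto intro!: cos_gt_zero sin_gt_zero)
  have le: "\<bar>Im w\<bar> * cos \<theta> \<le> sin \<theta> * Re w" using w by (simp add: sector_def)
  have "0 \<le> sin \<theta> * Re w" using le c by (meson abs_ge_zero less_imp_le mult_nonneg_nonneg order_trans)
  then have R0: "Re w \<ge> 0" using c by (simp add: zero_le_mult_iff)
  have "Re w \<noteq> 0"
  proof
    assume "Re w = 0"
    with le c have "Im w = 0" by (simp add: mult_le_0_iff)
    with \<open>Re w = 0\<close> w show False by (simp add: complex_eq_iff)
  qed
  with R0 show R: "Re w > 0" by simp
  show P: "w = rcis (norm w) (Arg w)" by (simp add: rcis_cmod_Arg)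
  show "\<bar>Arg w\<bar> \<le> \<theta>"
  proof (rule ccontr)
    assume "\<not> ?thesis"
    then have A: "\<bar>Arg w\<bar> > \<theta>" by simp
    have B: "\<bar>Arg w\<bar> < pi/2" using Arg_Re_pos[of w] R by (auto simp: Arg_Re_pos)
    have "sin (\<bar>Arg w\<bar> - \<theta>) > 0" using A B th by (intro sin_gt_zero) auto
    then have "sin \<theta> * cos \<bar>Arg w\<bar> < sin \<bar>Arg w\<bar> * cos \<theta>" by (simp add: sin_diff mult.commute)
    moreover have "sin \<bar>Arg w\<bar> = \<bar>sin (Arg w)\<bar>"
      using B by (simp add: abs_sin_eq)
    ultimately have "norm w * (sin \<theta> * cos (Arg w)) < norm w * (\<bar>sin (Arg w)\<bar> * cos \<theta>)"
      using w by (intro mult_strict_left_mono) auto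
    then have "sin \<theta> * Re (rcis (norm w) (Arg w)) < \<bar>Im (rcis (norm w) (Arg w))\<bar> * cos \<theta>"
      by (simp add: abs_mult mult_ac)
    with le P show False by simp
  qed
qed

lemma sector_cone:
  assumes "0 < \<theta>" "\<theta> < pi/2" "v \<in> sector \<theta>" "w \<in> sector \<theta>" "a \<ge> 0" "b \<ge> 0"
  shows "a *\<^sub>R v + b *\<^sub>R w \<in> sector \<theta>"
proof -
  have c: "cos \<theta> \<ge> 0" using assms by (intro cos_ge_zero) auto
  have "\<bar>a * Im v + b * Im w\<bar> * cos \<theta> \<le> (a * \<bar>Im v\<bar> + b * \<bar>Im w\<bar>) * cos \<theta>"
    using assms by (intro mult_right_mono c) (auto simp: abs_mult intro: order.trans[OF abs_triangle_ineq])
  also have "\<dots> = a * (\<bar>Im v\<bar> * cos \<theta>) + b * (\<bar>Im w\<bar> * cos \<theta>)" by (simp add: algebra_simps)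
  also have "\<dots> \<le> a * (sin \<theta> * Re v) + b * (sin \<theta> * Re w)"
    using assms by (intro add_mono mult_left_mono) (auto simp: sector_def)
  finally show ?thesis by (simp add: sector_def algebra_simps)
qed

lemma contour_integral_linepath_ray:
  assumes L: "L > 0" and f: "continuous_on {0..L} (\<lambda>s. f (of_real s * u))"
  shows "contour_integral (linepath 0 (of_real L * u)) f = (LINT s|lborel. indicator {0..L} s *\<^sub>R (f (of_real s * u) * u))"
proof -
  let ?g = "\<lambda>s. f (of_real s * u) * u"
  have cg: "continuous_on {0..L} ?g" using f by (intro continuous_intros)
  have int: "set_integrable lborel {0..L} ?g" by (rule borel_integrable_atLeastAtMost'[OF cg])
  have "(LINT s|lborel. indicator {0..L} s *\<^sub>R ?g s) = L *\<^sub>R (LINT s|lborel. indicator {0..L} (0 + L * s) *\<^sub>R ?g (0 + L * s))"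
    using lborel_integral_real_affine[of L "\<lambda>s. indicator {0..L} s *\<^sub>R ?g s" 0] L by simp
  also have "\<dots> = (LINT s|lborel. L *\<^sub>R (indicator {0..L} (0 + L * s) *\<^sub>R ?g (0 + L * s)))"
    by (rule integral_scaleR_right[symmetric])
  also have "\<dots> = (LINT s:{0..1}|lborel. f (of_real s * (of_real L * u)) * (of_real L * u))"
    unfolding set_lebesgue_integral_def
    using L by (intro Bochner_Integration.integral_cong) (auto simp: indicator_def scaleR_conv_of_real mult_ac field_simps zero_le_mult_iff)
  also have "\<dots> = integral {0..1} (\<lambda>s. f (of_real s * (of_real L * u)) * (of_real L * u))"
  proof (rule set_borel_integral_eq_integral(2), rule borel_integrable_atLeastAtMost')
    have "continuous_on {0..1} ((\<lambda>s. f (of_real s * u)) \<circ> (\<lambda>s. L * s))"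
      using L by (intro continuous_on_compose continuous_intros continuous_on_subset[OF f]) (auto simp: mult_left_le)
    then show "continuous_on {0..1} (\<lambda>s. f (of_real s * (of_real L * u)) * (of_real L * u))"
      by (intro continuous_intros) (simp add: o_def mult_ac)
  qed
  also have "\<dots> = contour_integral (linepath 0 (of_real L * u)) f"
    unfolding contour_integral_integral by (simp add: linepath_def scaleR_conv_of_real)
  finally show ?thesis ..
qed

text \<open>
  The function need only be continuous up to the vertex \<open>0\<close> and the rays, which is the version of the Cauchy
  formula for convex sets with continuous boundary values; the winding number of a triangle about an
  interior point is \<open>1\<close>.
\<close>

lemma Cauchy_formula_triangle:
  fixes G :: "complex \<Rightarrow> complex"
  assumes th: "0 < \<theta>" "\<theta> < pi/2" and G: "continuous_on (sector \<theta>) G" "G holomorphic_on {w. 0 < Re w}"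
    and x: "0 < x" "x < L * cos \<theta>"
  defines "f \<equiv> \<lambda>w. G w / (w - of_real x)" and "b \<equiv> rcis L (-\<theta>)" and "c \<equiv> rcis L \<theta>"
  shows "contour_integral (linepath 0 b) f + contour_integral (linepath b c) f - contour_integral (linepath 0 c) f
      = 2 * pi * \<i> * G (of_real x)"
    and "f contour_integrable_on linepath b c"
    and "\<And>w. w \<in> closed_segment b c \<Longrightarrow> w \<in> sector \<theta> \<and> Re w = L * cos \<theta>"
proof -
  have cs: "cos \<theta> > 0" "sin \<theta> > 0" using th by (auto intro!: cos_gt_zero sin_gt_zero)
  have L: "L > 0" using x cs zero_less_mult_pos2[of L "cos \<theta>"] by linarith
  define H where "H = convex hull {0, b, c}"
  have bc: "b \<in> sector \<theta>" "c \<in> sector \<theta>" unfolding b_def c_def using th L by (auto intro!: rcis_in_sector)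
  have Hs: "H \<subseteq> sector \<theta>" unfolding H_def convex_hull_3 using sector_cone[OF th bc] by auto
  have z0: "0 \<in> sector \<theta>" by (simp add: sector_def)
  have segH: "closed_segment 0 b \<subseteq> H" "closed_segment b c \<subseteq> H" "closed_segment 0 c \<subseteq> H" "closed_segment c 0 \<subseteq> H"
    unfolding H_def segment_convex_hull by (auto intro!: hull_mono)
  have intH: "interior H = H - (closed_segment 0 b \<union> closed_segment b c \<union> closed_segment c 0)"
    unfolding H_def by (rule interior_of_triangle) simp
  have seg0b: "of_real x \<notin> closed_segment 0 b"
  proof
    assume "of_real x \<in> closed_segment 0 b"
    then obtain t where t: "of_real x = t *\<^sub>R b" by (auto simp: in_segment)
    then have "t * (L * sin \<theta>) = 0" "x = t * (L * cos \<theta>)" by (auto simp: b_def complex_eq_iff)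
    then show False using L cs x by auto
  qed
  have seg0c: "of_real x \<notin> closed_segment 0 c"
  proof
    assume "of_real x \<in> closed_segment 0 c"
    then obtain t where t: "of_real x = t *\<^sub>R c" by (auto simp: in_segment)
    then have "t * (L * sin \<theta>) = 0" "x = t * (L * cos \<theta>)" by (auto simp: c_def complex_eq_iff)
    then show False using L cs x by auto
  qed
  have segbc: "Re w = L * cos \<theta>" if w: "w \<in> closed_segment b c" for w
  proof -
    obtain u where "w = (1 - u) *\<^sub>R b + u *\<^sub>R c" using w unfolding in_segment by blast
    then have "Re w = (1 - u) * (L * cos \<theta>) + u * (L * cos \<theta>)" by (simp add: b_def c_def)
    then show ?thesis by (simp add: algebra_simps)
  qed
  then have segbcx: "of_real x \<notin> closed_segment b c" using x by force
  show 3: "\<And>w. w \<in> closed_segment b c \<Longrightarrow> w \<in> sector \<theta> \<and> Re w = L * cos \<theta>"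
    using segbc segH Hs by auto
  have xH: "of_real x \<in> H"
  proof -
    define t where "t = x / (2 * L * cos \<theta>)"
    have "of_real x = (1 - 2 * t) *\<^sub>R 0 + t *\<^sub>R b + t *\<^sub>R c" using L cs
      by (simp add: complex_eq_iff b_def c_def t_def)
    moreover have "0 \<le> t" "2 * t \<le> 1" using L cs x by (auto simp: t_def field_simps)
    ultimately show ?thesis unfolding H_def convex_hull_3
      by (intro CollectI exI[of _ "1 - 2 * t"] exI[of _ t]) simp
  qed
  have xi: "of_real x \<in> interior H"
    unfolding intH using xH seg0b seg0c segbcx by (simp add: closed_segment_commute)
  have fd: "G field_differentiable at w" if "w \<in> interior H" for w
  proof -
    have "w \<in> sector \<theta>" "w \<noteq> 0" using that Hs unfolding intH by auto
    then have "w \<in> {w. 0 < Re w}" using sector_polar(1)[OF th] by auto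
    then show ?thesis using holomorphic_on_imp_differentiable_at[OF G(2) open_halfspace_Re_gt] by auto
  qed
  have W: "winding_number (linepath 0 b +++ linepath b c +++ linepath c 0) (of_real x) = 1"
  proof -
    have "Im ((b - 0) * cnj (b - of_real x)) = x * L * sin \<theta>"
      by (simp add: b_def algebra_simps)
    then show ?thesis using winding_number_triangle[OF xi[unfolded H_def]] x L cs by simp
  qed
  have "((\<lambda>w. G w / (w - of_real x)) has_contour_integral
      (2 * pi * \<i> * winding_number (linepath 0 b +++ linepath b c +++ linepath c 0) (of_real x) * G (of_real x)))
      (linepath 0 b +++ linepath b c +++ linepath c 0)"
  proof (rule Cauchy_integral_formula_convex[where S=H and K="{}"])
    show "continuous_on H G" using G(1) Hs by (rule continuous_on_subset)
    show "path_image (linepath 0 b +++ linepath b c +++ linepath c 0) \<subseteq> H - {of_real x}"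
      using segH seg0b seg0c segbcx by (auto simp: path_image_join closed_segment_commute)
  qed (use fd xi in \<open>auto simp: H_def\<close>)
  then have "contour_integral (linepath 0 b) f + contour_integral (linepath b c) f + contour_integral (linepath c 0) f
      = 2 * pi * \<i> * G (of_real x)"
    unfolding W f_def[symmetric] by (intro has_chain_integral_chain_integral3) simp
  moreover have cont: "continuous_on S f" if "S \<subseteq> H" "of_real x \<notin> S" for S
    unfolding f_def using that Hs by (intro continuous_intros continuous_on_subset[OF G(1)]) auto
  have "contour_integral (linepath c 0) f = - contour_integral (linepath 0 c) f"
    using segH seg0c by (intro contour_integral_reverse_linepath cont) (auto simp: closed_segment_commute[of c 0])
  ultimately show "contour_integral (linepath 0 b) f + contour_integral (linepath b c) f - contour_integral (linepath 0 c) f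
      = 2 * pi * \<i> * G (of_real x)" by simp
  show "f contour_integrable_on linepath b c"
    using cont[of "closed_segment b c"] segH segbcx by (intro contour_integrable_continuous_linepath) auto
qed

text \<open>
  The triangle is enlarged. Its third side has length of order \<open>L\<close> and there the integrand is
  at most \<open>b / L\<close> up to constants, so this side contributes nothing in the limit.
\<close>

lemma Cauchy_formula_sector:
  fixes G :: "complex \<Rightarrow> complex" and b :: "real \<Rightarrow> real"
  assumes th: "0 < \<theta>" "\<theta> < pi/2" and G: "continuous_on (sector \<theta>) G" "G holomorphic_on {w. 0 < Re w}"
    and b: "\<And>w. w \<in> sector \<theta> \<Longrightarrow> w \<noteq> 0 \<Longrightarrow> norm (G w) \<le> b (norm w)"
    and bi: "integrable lborel (\<lambda>s. indicator {0<..} s * (b s / s))" and b0: "(b \<longlongrightarrow> 0) at_top"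
    and x: "x > 0"
  defines "A \<equiv> \<lambda>\<phi> s. indicator {0<..} s *\<^sub>R (G (of_real s * cis \<phi>) * cis \<phi> / (of_real s * cis \<phi> - of_real x))"
  shows "2 * pi * \<i> * G (of_real x) = (LINT s|lborel. A (-\<theta>) s) - (LINT s|lborel. A \<theta> s)"
proof -
  have cs: "cos \<theta> > 0" "sin \<theta> > 0" using th by (auto intro!: cos_gt_zero sin_gt_zero)
  define f where "f w = G w / (w - of_real x)" for w
  define V where "V L = contour_integral (linepath (rcis L (-\<theta>)) (rcis L \<theta>)) f" for L
  define B where "B \<phi> L = contour_integral (linepath 0 (rcis L \<phi>)) f" for \<phi> L
  have eq: "2 * pi * \<i> * G (of_real x) - (B (-\<theta>) L - B \<theta> L) = V L" if L: "x < L * cos \<theta>" for L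
    using Cauchy_formula_triangle(1)[OF th G x L] by (simp add: B_def V_def f_def[abs_def] algebra_simps)
  have ray: "of_real s * cis \<phi> \<in> sector \<theta>" if "s \<ge> 0" "\<bar>\<phi>\<bar> \<le> \<theta>" for s \<phi>
    using rcis_in_sector[OF th that] by (simp add: rcis_def)
  have cont: "continuous_on {0..} (\<lambda>s. f (of_real s * cis \<phi>))" if phi: "\<bar>\<phi>\<bar> = \<theta>" for \<phi>
  proof -
    have "of_real s * cis \<phi> \<noteq> of_real x" for s
    proof
      assume e: "of_real s * cis \<phi> = of_real x"
      then have "s * sin \<phi> = 0" "s * cos \<phi> = x" by (auto simp: complex_eq_iff)
      moreover have "sin \<phi> \<noteq> 0" using phi cs by (auto simp: abs_if split: if_splits)
      ultimately show False using x by auto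
    qed
    then show ?thesis unfolding f_def using ray phi
      by (intro continuous_intros continuous_on_compose2[OF G(1)]) auto
  qed
  have lim: "integrable lborel (A \<phi>) \<and> (B \<phi> \<longlongrightarrow> (LINT s|lborel. A \<phi> s)) at_top" if phi: "\<bar>\<phi>\<bar> = \<theta>" for \<phi>
  proof -
    have Aeq: "A \<phi> s = indicator {0<..} s *\<^sub>R (f (of_real s * cis \<phi>) * cis \<phi>)" for s by (simp add: A_def f_def)
    have m: "A \<phi> \<in> borel_measurable borel"
    proof -
      have "(\<lambda>s. indicator {0..} s *\<^sub>R (f (of_real s * cis \<phi>) * cis \<phi>)) \<in> borel_measurable borel"
        by (rule borel_measurable_continuous_on_indicator) (auto intro!: continuous_intros cont phi)
      then have "(\<lambda>s. indicator {0<..} s *\<^sub>R (indicator {0..} s *\<^sub>R (f (of_real s * cis \<phi>) * cis \<phi>))) \<in> borel_measurable borel"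
        by measurable
      then show ?thesis unfolding Aeq[abs_def] by (rule measurable_cong[THEN iffD1, rotated]) (auto simp: indicator_def)
    qed
    have "norm (A \<phi> s) \<le> norm (1 / sin \<theta> * (indicator {0<..} s * (b s / s)))" for s
    proof (cases "s > 0")
      case True
      have "s * sin \<theta> = \<bar>Im (of_real s * cis \<phi> - of_real x)\<bar>"
        using phi True th abs_sin_eq[of \<phi>] by (simp add: abs_mult)
      also have "\<dots> \<le> norm (of_real s * cis \<phi> - of_real x)" by (rule abs_Im_le_cmod)
      finally have 1: "s * sin \<theta> \<le> norm (of_real s * cis \<phi> - of_real x)" .
      have 2: "norm (G (of_real s * cis \<phi>)) \<le> b s"
        using b[OF ray[of s \<phi>]] True phi by (simp add: norm_mult)
      have "norm (A \<phi> s) = norm (G (of_real s * cis \<phi>)) / norm (of_real s * cis \<phi> - of_real x)"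
        using True by (simp add: A_def norm_mult norm_divide)
      also have "\<dots> \<le> b s / (s * sin \<theta>)"
        using 1 2 True cs by (intro frac_le) (auto intro: order.trans[OF norm_ge_zero 2])
      also have "\<dots> = 1 / sin \<theta> * (indicator {0<..} s * (b s / s))" using True by simp
      finally show ?thesis unfolding real_norm_def by linarith
    qed (simp add: A_def)
    then have i: "integrable lborel (A \<phi>)"
      using m by (intro Bochner_Integration.integrable_bound[OF integrable_mult_right[OF bi, of "1 / sin \<theta>"]]) auto
    have "\<forall>\<^sub>F L in at_top. (LINT s|lborel. indicator {..L} s *\<^sub>R A \<phi> s) = B \<phi> L"
      using eventually_gt_at_top[of 0]
    proof eventually_elim
      case (elim L)
      have "B \<phi> L = (LINT s|lborel. indicator {0..L} s *\<^sub>R (f (of_real s * cis \<phi>) * cis \<phi>))"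
        unfolding B_def rcis_def using elim cont[OF phi]
        by (intro contour_integral_linepath_ray) (auto elim: continuous_on_subset)
      also have "\<dots> = (LINT s|lborel. indicator {..L} s *\<^sub>R A \<phi> s)"
      proof (rule integral_discrete_difference[where X="{0}"])
        show "\<And>s. s \<in> space lborel \<Longrightarrow> s \<notin> {0} \<Longrightarrow> indicator {0..L} s *\<^sub>R (f (of_real s * cis \<phi>) * cis \<phi>) = indicator {..L} s *\<^sub>R A \<phi> s"
          by (auto simp: Aeq indicator_def)
      qed auto
      finally show ?case ..
    qed
    then have "(B \<phi> \<longlongrightarrow> (LINT s|lborel. A \<phi> s)) at_top"
      using tendsto_integral_at_top[OF _ i] by (auto intro: tendsto_cong[THEN iffD1])
    with i show ?thesis by blast
  qed
  have V0: "(V \<longlongrightarrow> 0) at_top"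
  proof (rule tendstoI)
    fix e :: real assume e: "e > 0"
    define \<epsilon> where "\<epsilon> = e * cos \<theta> / (8 * sin \<theta>)"
    have eps: "\<epsilon> > 0" using e cs by (simp add: \<epsilon>_def)
    obtain R where R: "\<And>r. r \<ge> R \<Longrightarrow> b r < \<epsilon>"
      using order_tendstoD(2)[OF b0 eps] by (auto simp: eventually_at_top_linorder)
    have "\<forall>\<^sub>F L in at_top. L > max (max 1 (R / cos \<theta>)) (2 * x / cos \<theta>)" by (rule eventually_gt_at_top)
    then show "\<forall>\<^sub>F L in at_top. dist (V L) 0 < e"
    proof eventually_elim
      case (elim L)
      then have L: "L > 1" "R < L * cos \<theta>" "2 * x < L * cos \<theta>" using cs by (auto simp: field_simps)
      have xL: "x < L * cos \<theta>" using L x by simp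
      note tri = Cauchy_formula_triangle[OF th G x xL]
      have "norm (V L) \<le> (\<epsilon> / (L * cos \<theta> / 2)) * norm (rcis L \<theta> - rcis L (-\<theta>))"
        unfolding V_def
      proof (rule contour_integral_bound_linepath)
        show "f contour_integrable_on linepath (rcis L (-\<theta>)) (rcis L \<theta>)" using tri(2) by (simp add: f_def[abs_def])
        show "0 \<le> \<epsilon> / (L * cos \<theta> / 2)" using eps L cs by simp
        fix w assume "w \<in> closed_segment (rcis L (-\<theta>)) (rcis L \<theta>)"
        then have w: "w \<in> sector \<theta>" "Re w = L * cos \<theta>" using tri(3) by auto
        then have nw: "norm w \<ge> L * cos \<theta>" using complex_Re_le_cmod[of w] by simp
        have "w \<noteq> 0" using w L cs by auto
        then have "norm (G w) \<le> \<epsilon>" using b[OF w(1)] R[of "norm w"] nw L by auto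
        moreover have "norm (w - of_real x) \<ge> L * cos \<theta> / 2"
          using complex_Re_le_cmod[of "w - of_real x"] w L by simp
        ultimately show "norm (f w) \<le> \<epsilon> / (L * cos \<theta> / 2)"
          unfolding f_def norm_divide using L cs eps by (intro frac_le) auto
      qed
      also have "rcis L \<theta> - rcis L (-\<theta>) = of_real (2 * L * sin \<theta>) * \<i>" by (simp add: complex_eq_iff)
      also have "norm (of_real (2 * L * sin \<theta>) * \<i>) = 2 * L * sin \<theta>" using L cs by (simp add: norm_mult)
      also have "(\<epsilon> / (L * cos \<theta> / 2)) * (2 * L * sin \<theta>) = e / 2" using L cs by (simp add: \<epsilon>_def field_simps)
      finally show ?case using e by simp
    qed
  qed
  have "((\<lambda>L. 2 * pi * \<i> * G (of_real x) - (B (-\<theta>) L - B \<theta> L)) \<longlongrightarrow>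
      2 * pi * \<i> * G (of_real x) - ((LINT s|lborel. A (-\<theta>) s) - (LINT s|lborel. A \<theta> s))) at_top"
    using lim[of "-\<theta>"] lim[of \<theta>] th by (intro tendsto_intros) auto
  moreover have "\<forall>\<^sub>F L in at_top. 2 * pi * \<i> * G (of_real x) - (B (-\<theta>) L - B \<theta> L) = V L"
    using eventually_gt_at_top[of "x / cos \<theta>"] by eventually_elim (rule eq, use cs in \<open>simp add: field_simps\<close>)
  ultimately have "(V \<longlongrightarrow> 2 * pi * \<i> * G (of_real x) - ((LINT s|lborel. A (-\<theta>) s) - (LINT s|lborel. A \<theta> s))) at_top"
    by (rule Lim_transform_eventually)
  from tendsto_unique[OF _ this V0] show ?thesis by simp
qed

text \<open>
  Cauchy formula and resolvents combined: the two rays contribute one kernel each.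
\<close>

lemma L1_mult_sector:
  fixes G :: "complex \<Rightarrow> complex" and b :: "real \<Rightarrow> real"
  assumes th: "0 < \<theta>" "\<theta> < pi/2" and G: "continuous_on (sector \<theta>) G" "G holomorphic_on {w. 0 < Re w}"
    and b: "\<And>w. w \<in> sector \<theta> \<Longrightarrow> w \<noteq> 0 \<Longrightarrow> norm (G w) \<le> b (norm w)"
    and bi: "integrable lborel (\<lambda>s. indicator {0<..} s * (b s / s))" and b0: "(b \<longlongrightarrow> 0) at_top"
  shows "L1_mult (\<lambda>\<xi>::real^'n::finite. G (of_real ((norm \<xi>)\<^sup>2)))
     (sin (\<theta>/2) powr (- CARD('n) / 2 - 1) * (LINT s|lborel. indicator {0<..} s * (b s / s)))"
proof -
  define T where "T = sin (\<theta>/2) powr (- CARD('n) / 2 - 1) * (LINT s|lborel. indicator {0<..} s * (b s / s))"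
  have ray: "of_real s * cis \<phi> \<in> sector \<theta>" if "s \<ge> 0" "\<bar>\<phi>\<bar> \<le> \<theta>" for s \<phi>
    using rcis_in_sector[OF th that] by (simp add: rcis_def)
  have "\<exists>k :: real^'n \<Rightarrow> complex. integrable lborel k \<and> L1_norm k \<le> T
    \<and> (\<forall>\<xi>. fourier k \<xi> = (LINT s|lborel. indicator {0<..} s *\<^sub>R (G (of_real s * cis (d * \<theta>)) * cis (d * \<theta>) / (of_real s * cis (d * \<theta>) - of_real ((norm \<xi>)\<^sup>2)))))"
    if d: "d = 1 \<or> d = -1" for d :: real
  proof -
    define g where "g s = indicator {0..} s *\<^sub>R G (of_real s * cis (d * \<theta>))" for s
    have [measurable]: "g \<in> borel_measurable borel" unfolding g_def[abs_def]
      using d th ray by (intro borel_measurable_continuous_on_indicator continuous_on_compose2[OF G(1)] continuous_intros) auto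
    have gb: "indicator {0<..} s * (norm (g s) / s) \<le> indicator {0<..} s * (b s / s)" for s
    proof (cases "s > 0")
      case True
      then have "norm (g s) \<le> b s" using b[OF ray[of s "d * \<theta>"]] d th by (auto simp: g_def norm_mult)
      with True show ?thesis by (simp add: divide_right_mono)
    qed simp
    have gpos: "0 \<le> indicator {0<..} s * (norm (g s) / s)" for s by (simp add: indicator_def)
    have gi: "integrable lborel (\<lambda>s. indicator {0<..} s * (norm (g s) / s))"
    proof (rule Bochner_Integration.integrable_bound[OF bi])
      have "norm (indicator {0<..} s * (norm (g s) / s)) \<le> norm (indicator {0<..} s * (b s / s))" for s
        unfolding real_norm_def using gb[of s] gpos[of s] by linarith
      then show "AE s in lborel. norm (indicator {0<..} s * (norm (g s) / s)) \<le> norm (indicator {0<..} s * (b s / s))" by blast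
    qed measurable
    have th': "\<theta> < pi" using th by simp
    obtain k :: "real^'n \<Rightarrow> complex" where k: "integrable lborel k"
      "L1_norm k \<le> sin (\<theta>/2) powr (- CARD('n) / 2 - 1) * (LINT s|lborel. indicator {0<..} s * (norm (g s) / s))"
      "\<And>\<xi>. fourier k \<xi> = (LINT s|lborel. indicator {0<..} s *\<^sub>R (g s * cis (d * \<theta>) / (of_real s * cis (d * \<theta>) - of_real ((norm \<xi>)\<^sup>2))))"
      using resolvent_superposition[OF th(1) th' d _ gi, where 'n='n] by auto
    have "(LINT s|lborel. indicator {0<..} s * (norm (g s) / s)) \<le> (LINT s|lborel. indicator {0<..} s * (b s / s))"
      by (rule integral_mono_AE[OF gi bi]) (use gb in auto)
    then have "L1_norm k \<le> T" unfolding T_def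
      by (intro order.trans[OF k(2)] mult_left_mono) auto
    moreover have geq: "indicator {0<..} s *\<^sub>R (g s * z / y) = indicator {0<..} s *\<^sub>R (G (of_real s * cis (d * \<theta>)) * z / y)" for s z y
      by (simp add: g_def indicator_def)
    ultimately show ?thesis using k(1) by (intro exI[of _ k]) (simp only: k(3) geq simp_thms)
  qed
  from this[of 1] this[of "-1"] obtain k1 k2 :: "real^'n \<Rightarrow> complex" where
    k: "integrable lborel k1" "integrable lborel k2" "L1_norm k1 \<le> T" "L1_norm k2 \<le> T"
      "\<And>\<xi>. fourier k1 \<xi> = (LINT s|lborel. indicator {0<..} s *\<^sub>R (G (of_real s * cis \<theta>) * cis \<theta> / (of_real s * cis \<theta> - of_real ((norm \<xi>)\<^sup>2))))"
      "\<And>\<xi>. fourier k2 \<xi> = (LINT s|lborel. indicator {0<..} s *\<^sub>R (G (of_real s * cis (-\<theta>)) * cis (-\<theta>) / (of_real s * cis (-\<theta>) - of_real ((norm \<xi>)\<^sup>2))))"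
    by auto
  define k where "k = (\<lambda>x. (1 / (2 * pi * \<i>)) * (k2 x + (- 1) * k1 x))"
  have ki: "integrable lborel (\<lambda>x. (- 1) * k1 x)" using k by auto
  have "has_fourier k (\<lambda>\<xi>. G (of_real ((norm \<xi>)\<^sup>2)))"
    unfolding has_fourier_def
  proof
    show "integrable lborel k" unfolding k_def using k by auto
    show "AE \<xi> in lborel. fourier k \<xi> = G (of_real ((norm \<xi>)\<^sup>2))"
      using AE_lborel_singleton[of "0::real^'n"]
    proof eventually_elim
      case (elim \<xi>)
      then have x: "(norm \<xi>)\<^sup>2 > 0" by simp
      have "fourier k \<xi> = (1 / (2 * pi * \<i>)) * (fourier k2 \<xi> - fourier k1 \<xi>)"
        unfolding k_def fourier_cmult fourier_add[OF k(2) ki] by simp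
      also have "fourier k2 \<xi> - fourier k1 \<xi> = 2 * pi * \<i> * G (of_real ((norm \<xi>)\<^sup>2))"
        unfolding k using Cauchy_formula_sector[OF th G b bi b0 x] by simp
      finally show ?case by simp
    qed
  qed
  from L1_mult_kernel[OF this] show ?thesis
  proof (rule L1_mult_mono)
    have "L1_norm k = (1 / (2 * pi)) * L1_norm (\<lambda>x. k2 x + (- 1) * k1 x)"
      unfolding k_def L1_norm_cmult by (simp add: norm_divide norm_mult)
    also have "\<dots> \<le> (1 / (2 * pi)) * (L1_norm k2 + L1_norm k1)"
      using L1_norm_add_le[OF k(2) ki] unfolding L1_norm_cmult by (intro mult_left_mono) auto
    also have "\<dots> \<le> (1 / (2 * pi)) * (2 * T)" using k by (intro mult_left_mono) auto
    also have "\<dots> = T / pi" by simp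
    also have "\<dots> \<le> T" using order.trans[OF L1_norm_nonneg k(3)] pi_gt3 mult_left_mono[of 1 pi T] by (simp add: divide_le_eq)
    finally show "L1_norm k \<le> sin (\<theta>/2) powr (- CARD('n) / 2 - 1) * (LINT s|lborel. indicator {0<..} s * (b s / s))"
      by (simp add: T_def)
  qed
qed

section \<open>Holomorphic functions of the Laplacian\<close>

text \<open>
  On the left half plane \<open>|exp'|\<close> is at most \<open>1\<close>.
\<close>

lemma norm_one_minus_exp_le:
  fixes z :: complex assumes "Re z \<le> 0"
  shows "norm (exp z - 1) \<le> norm z"
proof -
  have "norm (exp z - exp 0) \<le> 1 * norm (z - 0)"
  proof (rule field_differentiable_bound[where S="{w. Re w \<le> 0}" and f'=exp])
    show "convex {w. Re w \<le> 0}" by (rule convex_halfspace_Re_le)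
  qed (use assms in \<open>auto intro: derivative_eq_intros simp: norm_exp_eq_Re DERIV_exp has_field_derivative_at_within\<close>)
  then show ?thesis by simp
qed

lemma le_powr: "0 \<le> x \<Longrightarrow> x \<le> 1 \<Longrightarrow> e \<le> 1 \<Longrightarrow> x \<le> x powr e" for x :: real
  using powr_mono'[of e 1 x] by simp

text \<open>
  The majorant \<open>min (s/R) (R/s)\<close> to the power \<open>e\<close>, whose integral against \<open>ds/s\<close> does not depend on \<open>R\<close>. This scale
  invariance lets the Hoelder exponent at \<open>0\<close> and the decay at infinity be measured at any frequency.
\<close>

definition hump :: "real \<Rightarrow> real \<Rightarrow> real \<Rightarrow> real" where
  "hump e R s = (if s \<le> R then (s / R) powr e else (R / s) powr e)"

lemma
  assumes e: "e > 0" and R: "R > 0"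
  shows integrable_hump: "integrable lborel (\<lambda>s. indicator {0<..} s * (hump e R s / s))"
    and integral_hump: "(LINT s|lborel. indicator {0<..} s * (hump e R s / s)) = 2 / e"
    and tendsto_hump: "(hump e R \<longlongrightarrow> 0) at_top"
proof -
  let ?f = "\<lambda>s. indicator {0<..} s * (hump e R s / s)"
  have fm: "?f \<in> borel_measurable borel" unfolding hump_def by measurable
  have pos: "?f s \<ge> 0" for s by (simp add: hump_def indicator_def)
  have "((\<lambda>s. R powr (- e) * s powr (e - 1)) has_integral R powr (- e) * (R powr (e - 1 + 1) / (e - 1 + 1))) {0..R}"
    using e R by (intro has_integral_mult_right has_integral_powr_from_0) auto
  then have "(?f has_integral R powr (- e) * (R powr (e - 1 + 1) / (e - 1 + 1))) {0..R}"
    by (rule has_integral_eq[rotated]) (use R in \<open>auto simp: indicator_def hump_def powr_divide powr_minus powr_diff field_simps\<close>)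
  then have 1: "(?f has_integral 1 / e) {0..R}"
    using e R by (simp add: powr_minus)
  have "((\<lambda>s. R powr e * s powr (- e - 1)) has_integral R powr e * (- (R powr (- e - 1 + 1)) / (- e - 1 + 1))) {R..}"
    using e R by (intro has_integral_mult_right has_integral_powr_to_inf) auto
  then have "(?f has_integral R powr e * (- (R powr (- e - 1 + 1)) / (- e - 1 + 1))) {R..}"
    by (rule has_integral_eq[rotated]) (use R in \<open>auto simp: indicator_def hump_def powr_divide powr_minus powr_diff field_simps\<close>)
  then have 2: "(?f has_integral 1 / e) {R..}"
    using e R by (simp add: powr_minus)
  have "(?f has_integral 1 / e + 1 / e) ({0..R} \<union> {R..})"
    by (intro has_integral_Un 1 2) (auto intro: negligible_subset[of "{R}"])
  also have "{0..R} \<union> {R..} = {0..}" using R by auto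
  finally have "(?f has_integral 2 / e) {0..}" by simp
  then have "(?f has_integral 2 / e) UNIV"
    by (rule has_integral_on_superset) auto
  then have nn: "integral\<^sup>N lborel ?f = ennreal (2 / e)"
    by (rule nn_integral_has_integral_lborel[OF fm pos])
  then have hb: "has_bochner_integral lborel ?f (2 / e)"
    using pos e fm by (intro has_bochner_integral_nn_integral) auto
  then show "integrable lborel ?f" "(LINT s|lborel. ?f s) = 2 / e" by (auto simp: has_bochner_integral_iff)
  have "((\<lambda>s. (R / s) powr e) \<longlongrightarrow> 0) at_top" using e R by real_asymp
  moreover have "\<forall>\<^sub>F s in at_top. (R / s) powr e = hump e R s"
    using eventually_gt_at_top[of R] by eventually_elim (simp add: hump_def)
  ultimately show "(hump e R \<longlongrightarrow> 0) at_top" by (rule Lim_transform_eventually)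
qed

lemma half_le_sin:
  fixes x :: real
  shows "0 \<le> x \<Longrightarrow> x \<le> 1 \<Longrightarrow> x / 2 \<le> sin x"
proof -
  assume x: "0 \<le> x" "x \<le> 1"
  have "(\<lambda>x. sin x - x / 2) 0 \<le> (\<lambda>x. sin x - x / 2) x"
  proof (rule DERIV_nonneg_imp_nondecreasing[OF x(1)])
    fix y assume y: "0 \<le> y" "y \<le> x"
    have "cos (pi/3) \<le> cos y" using y x pi_gt3 by (intro cos_monotone_0_pi_le) auto
    then show "\<exists>d. ((\<lambda>x. sin x - x / 2) has_real_derivative d) (at y) \<and> 0 \<le> d"
      by (intro exI[of _ "cos y - 1/2"]) (auto intro!: derivative_eq_intros simp: cos_60)
  qed
  then show ?thesis by simp
qed

lemma L1_mult_gaussian: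
  assumes "R > 0"
  shows "L1_mult (\<lambda>\<xi>::real^'n::finite. c * exp (- of_real ((norm \<xi>)\<^sup>2) / of_real R)) (norm c)"
proof -
  have z: "Re (of_real (1 / R)) > 0" using assms by simp
  have "has_fourier (\<lambda>x. c * heat_kernel (of_real (1 / R)) x) (\<lambda>\<xi>::real^'n. c * exp (- of_real ((norm \<xi>)\<^sup>2) / of_real R))"
    unfolding has_fourier_def fourier_cmult fourier_heat_kernel[OF z]
    using integrable_heat_kernel[OF z] by auto
  from L1_mult_kernel[OF this] show ?thesis
    unfolding L1_norm_cmult L1_norm_heat_kernel[OF z] using assms by (simp add: norm_divide)
qed

text \<open>
  A limit \<open>c \<noteq> 0\<close> at the origin would make the integral of \<open>|F| ds/s\<close> diverge. So \<open>c exp (- w/R)\<close>, which is the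
  symbol of a contraction up to the factor \<open>|c|\<close>, is subtracted first.
\<close>

lemma L1_mult_of_sector_bounds:
  fixes F :: "complex \<Rightarrow> complex"
  assumes th: "0 < \<theta>" "\<theta> \<le> 1" and F: "F holomorphic_on {w. 0 < Re w}" and R: "R > 0" and e: "0 < e" "e \<le> 1"
    and c: "norm c \<le> M"
    and small: "\<And>w. w \<in> sector \<theta> \<Longrightarrow> w \<noteq> 0 \<Longrightarrow> norm w \<le> R \<Longrightarrow> norm (F w - c) \<le> M * (norm w / R) powr e"
    and large: "\<And>w. w \<in> sector \<theta> \<Longrightarrow> R \<le> norm w \<Longrightarrow> norm (F w) \<le> M * (R / norm w) powr e"
  shows "L1_mult (\<lambda>\<xi>::real^'n::finite. F (of_real ((norm \<xi>)\<^sup>2)))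
     ((6 / e * 4 powr (CARD('n) / 2 + 1) + 1) * M * \<theta> powr (- CARD('n) / 2 - 1))"
proof -
  have M: "M \<ge> 0" using c norm_ge_zero order_trans by blast
  have th': "\<theta> < pi/2" using th pi_gt3 by simp
  define G where "G w = (if w = 0 then 0 else F w - c * exp (- w / of_real R))" for w
  define b where "b s = 3 * M * hump e R s" for s
  have Gb: "norm (G w) \<le> b (norm w)" if w: "w \<in> sector \<theta>" "w \<noteq> 0" for w
  proof -
    have nw: "norm w > 0" using w by simp
    have A: "Re w > 0" "w = rcis (norm w) (Arg w)" "\<bar>Arg w\<bar> \<le> \<theta>" using sector_polar[OF th(1) th' w] by auto
    show ?thesis
    proof (cases "norm w \<le> R")
      case True
      have "norm (1 - exp (- w / of_real R)) \<le> norm w / R"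
        using norm_one_minus_exp_le[of "- w / of_real R"] A R by (simp add: norm_divide norm_minus_commute)
      also have "norm w / R \<le> (norm w / R) powr e"
      proof -
        have "0 \<le> norm w / R" "norm w / R \<le> 1" using True R by simp_all
        then show ?thesis using e by (intro le_powr) auto
      qed
      finally have 1: "norm (1 - exp (- w / of_real R)) \<le> (norm w / R) powr e" .
      have "G w = (F w - c) + c * (1 - exp (- w / of_real R))" using w by (simp add: G_def algebra_simps)
      then have "norm (G w) \<le> norm (F w - c) + norm c * norm (1 - exp (- w / of_real R))"
        by (metis norm_mult norm_triangle_ineq)
      also have "\<dots> \<le> M * (norm w / R) powr e + M * (norm w / R) powr e"
        using small[OF w True] 1 c M by (intro add_mono mult_mono) auto
      also have "\<dots> \<le> b (norm w)" using True M by (simp add: b_def hump_def)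
      finally show ?thesis .
    next
      case False
      have "cos (pi/3) \<le> cos (\<bar>Arg w\<bar>)" using A th pi_gt3 by (intro cos_monotone_0_pi_le) auto
      then have "norm w * (1/2) \<le> norm w * cos (Arg w)" using nw by (intro mult_left_mono) (auto simp: cos_60)
      also have "\<dots> = Re w" using A(2) by (metis Re_rcis)
      finally have Rw: "norm w / 2 \<le> Re w" by simp
      define y where "y = norm w / R"
      have y: "y > 1" using False R by (simp add: y_def)
      have "norm (exp (- w / of_real R)) = exp (- (Re w / R))" by (simp add: norm_exp_eq_Re)
      also have "\<dots> \<le> exp (- (y / 2))" using Rw R by (simp add: y_def field_simps)
      also have "\<dots> \<le> 2 * (1 / y)"
        using exp_ge_add_one_self[of "y/2"] y by (simp add: exp_minus field_simps)
      also have "1 / y \<le> (1 / y) powr e" using y e by (intro le_powr) auto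
      also have "1 / y = R / norm w" by (simp add: y_def)
      finally have 1: "norm (exp (- w / of_real R)) \<le> 2 * (R / norm w) powr e" by simp
      have "norm (G w) \<le> norm (F w) + norm c * norm (exp (- w / of_real R))"
        using w norm_triangle_ineq4[of "F w" "c * exp (- w / of_real R)"] by (simp add: G_def norm_mult)
      also have "\<dots> \<le> M * (R / norm w) powr e + M * (2 * (R / norm w) powr e)"
        using large[OF w(1)] 1 c M False by (intro add_mono mult_mono) auto
      also have "\<dots> = b (norm w)" using False by (simp add: b_def hump_def)
      finally show ?thesis .
    qed
  qed
  have hol: "(\<lambda>w. F w - c * exp (- w / of_real R)) holomorphic_on {w. 0 < Re w}"
    using R by (intro holomorphic_intros F) auto
  then have G: "G holomorphic_on {w. 0 < Re w}"
    by (rule holomorphic_transform) (auto simp: G_def)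
  have cont: "continuous_on (sector \<theta>) G"
    unfolding continuous_on_eq_continuous_within
  proof
    fix w assume w: "w \<in> sector \<theta>"
    show "continuous (at w within sector \<theta>) G"
    proof (cases "w = 0")
      case False
      then have "w \<in> {w. 0 < Re w}" using sector_polar(1)[OF th(1) th' w] by simp
      then have "isCont G w" using holomorphic_on_imp_continuous_on[OF G]
        by (simp add: continuous_on_eq_continuous_at open_halfspace_Re_gt)
      then show ?thesis by (rule continuous_at_imp_continuous_within)
    next
      case [simp]: True
      have "((\<lambda>w. b (norm w)) \<longlongrightarrow> 0) (at 0 within sector \<theta>)"
      proof -
        have "((\<lambda>w::complex. 3 * M * (norm w / R) powr e) \<longlongrightarrow> 3 * M * (norm (0::complex) / R) powr e) (at 0 within sector \<theta>)"
          using e R by (intro tendsto_intros) auto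
        moreover have "\<forall>\<^sub>F w in at 0 within sector \<theta>. 3 * M * (norm w / R) powr e = b (norm w)"
          unfolding eventually_at using R by (intro exI[of _ R]) (auto simp: b_def hump_def)
        ultimately show ?thesis using R e by (auto intro: Lim_transform_eventually)
      qed
      then have "(G \<longlongrightarrow> 0) (at 0 within sector \<theta>)"
        by (rule Lim_null_comparison[rotated]) (use Gb in \<open>auto simp: eventually_at intro!: exI[of _ 1]\<close>)
      then show ?thesis by (simp add: continuous_within G_def)
    qed
  qed
  have bs: "indicator {0<..} s * (b s / s) = 3 * M * (indicator {0<..} s * (hump e R s / s))" for s
    by (simp add: b_def)
  have bi: "integrable lborel (\<lambda>s. indicator {0<..} s * (b s / s))"
    unfolding bs by (intro integrable_mult_right integrable_hump e R)
  have bI: "(LINT s|lborel. indicator {0<..} s * (b s / s)) = 6 * M / e"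
    unfolding bs integral_mult_right_zero integral_hump[OF e(1) R] by simp
  have b0: "(b \<longlongrightarrow> 0) at_top"
    unfolding b_def[abs_def] using tendsto_mult_right_zero[OF tendsto_hump[OF e(1) R], of "3 * M"] by simp
  have "L1_mult (\<lambda>\<xi>::real^'n. G (of_real ((norm \<xi>)\<^sup>2)) + c * exp (- of_real ((norm \<xi>)\<^sup>2) / of_real R))
     (sin (\<theta>/2) powr (- CARD('n) / 2 - 1) * (6 * M / e) + norm c)"
    using L1_mult_sector[OF th(1) th' cont G Gb bi b0, where 'n='n] unfolding bI
    by (intro L1_mult_add L1_mult_gaussian R) auto
  then have "L1_mult (\<lambda>\<xi>::real^'n. F (of_real ((norm \<xi>)\<^sup>2))) (sin (\<theta>/2) powr (- CARD('n) / 2 - 1) * (6 * M / e) + norm c)"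
  proof (rule L1_mult_cong)
    show "AE \<xi>::real^'n in lborel. G (of_real ((norm \<xi>)\<^sup>2)) + c * exp (- of_real ((norm \<xi>)\<^sup>2) / of_real R) = F (of_real ((norm \<xi>)\<^sup>2))"
      using AE_lborel_singleton[of "0::real^'n"] by eventually_elim (simp add: G_def)
  qed
  then show ?thesis
  proof (rule L1_mult_mono)
    define q where "q = real CARD('n) / 2 + 1"
    have q: "- CARD('n) / 2 - 1 = - q" "q > 0" by (simp_all add: q_def)
    have "sin (\<theta>/2) powr (- q) \<le> (\<theta>/4) powr (- q)"
      using half_le_sin[of "\<theta>/2"] th q by (intro powr_mono2') auto
    also have "\<dots> = 4 powr q * \<theta> powr (- q)" using th by (simp add: powr_divide powr_minus divide_simps)
    finally have "sin (\<theta>/2) powr (- q) * (6 * M / e) \<le> 4 powr q * \<theta> powr (- q) * (6 * M / e)"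
      using M e by (intro mult_right_mono) auto
    moreover have "1 \<le> \<theta> powr (- q)" using th q powr_mono2'[of "- q" \<theta> 1] by simp
    then have "norm c \<le> M * \<theta> powr (- q)" using mult_left_mono[of 1 "\<theta> powr (- q)" M] c M by simp
    ultimately show "sin (\<theta>/2) powr (- CARD('n) / 2 - 1) * (6 * M / e) + norm c
      \<le> (6 / e * 4 powr (CARD('n) / 2 + 1) + 1) * M * \<theta> powr (- CARD('n) / 2 - 1)"
      unfolding q q_def[symmetric] by (simp add: algebra_simps)
  qed
qed

section \<open>The fundamental solutions as entire functions\<close>

text \<open>
  The entire function with \<open>x sinhc (x\<^sup>2) = sinh x\<close>. It makes the symmetric functions of \<open>\<plusminus> \<surd>z\<close> below holomorphic
  across the branch point \<open>z = 0\<close>.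
\<close>

definition sinhc :: "complex \<Rightarrow> complex" where
  "sinhc z = (\<Sum>n. z ^ n / fact (2 * n + 1))"

lemma sums_sinhc: "(\<lambda>n. z ^ n / fact (2 * n + 1)) sums sinhc z"
  unfolding sinhc_def
proof (rule summable_sums, rule summable_comparison_test')
  show "summable (\<lambda>n. inverse (fact n) * norm z ^ n)"
    using summable_exp[of "norm z"] .
  show "norm (z ^ n / fact (2 * n + 1)) \<le> inverse (fact n) * norm z ^ n" if "n \<ge> 0" for n
  proof -
    have "(fact n :: real) \<le> fact (2 * n + 1)" by (rule fact_mono) simp
    then show ?thesis
      unfolding norm_divide norm_power norm_fact
      unfolding divide_inverse mult.commute[of "norm z ^ n"]
      by (intro mult_right_mono le_imp_inverse_le) auto
  qed
qed

lemma holomorphic_sinhc: "sinhc holomorphic_on A"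
proof -
  have "sinhc field_differentiable at z" for z
  proof -
    have "sinhc holomorphic_on ball 0 (norm z + 1)"
      by (rule power_series_holomorphic[where a="\<lambda>n. 1 / fact (2 * n + 1)"]) (use sums_sinhc in simp)
    then show ?thesis
      by (rule holomorphic_on_imp_differentiable_at) auto
  qed
  then show ?thesis
    by (simp add: holomorphic_on_def field_differentiable_at_within)
qed

lemma mult_sinhc: "x * sinhc (x\<^sup>2) = sinh x"
proof -
  have "(\<lambda>n. (\<lambda>n. if even n then 0 else x ^ n /\<^sub>R fact n) (2 * n + 1)) sums sinh x"
    using sinh_converges[of x]
    by (subst sums_mono_reindex) (auto simp: strict_mono_def elim!: oddE)
  moreover have "(\<lambda>n. if even n then 0 else x ^ n /\<^sub>R fact n) (2 * n + 1) = x * ((x\<^sup>2) ^ n / fact (2 * n + 1))" for n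
    by (simp add: scaleR_conv_of_real divide_inverse mult_ac flip: power_mult del: fact_Suc)
  ultimately have "(\<lambda>n. x * ((x\<^sup>2) ^ n / fact (2 * n + 1))) sums sinh x" by simp
  then show ?thesis using sums_mult[OF sums_sinhc, of x "x\<^sup>2"] sums_unique2 by blast
qed

lemma sinhc_0: "sinhc 0 = 1"
proof -
  have "(\<lambda>n. 0 ^ n / fact (2 * n + 1)) sums (1::complex)"
    using powser_sums_zero[of "\<lambda>n. 1 / fact (2 * n + 1) :: complex"] by simp
  then show ?thesis using sums_sinhc[of 0] sums_unique2 by blast
qed

text \<open>
  \<open>cosh x = 1 + 2 sinh\<^sup>2 (x/2)\<close> as a function of \<open>x\<^sup>2\<close>.
\<close>

definition coshc :: "complex \<Rightarrow> complex" where
  "coshc z = 1 + z / 2 * (sinhc (z / 4))\<^sup>2"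

lemma coshc_square: "coshc (x\<^sup>2) = cosh x"
proof -
  have "x\<^sup>2 / 4 = (x / 2)\<^sup>2" by (simp add: power_divide)
  then have "coshc (x\<^sup>2) = 1 + 2 * (x / 2 * sinhc ((x / 2)\<^sup>2))\<^sup>2"
    by (simp add: coshc_def power_mult_distrib power_divide)
  also have "\<dots> = 1 + 2 * (sinh (x / 2))\<^sup>2" by (simp only: mult_sinhc)
  also have "\<dots> = cosh (2 * (x / 2))"
    unfolding cosh_double by (simp add: cosh_square_eq)
  finally show ?thesis by simp
qed

text \<open>
  The fundamental solutions of \<open>y'' + p y' + p y = 0\<close> with data \<open>(1, 0)\<close> and \<open>(0, 1)\<close>, as entire functions of \<open>p\<close>. The
  characteristic roots are \<open>- p/2 \<plusminus> d\<close> with \<open>d\<^sup>2 = p\<^sup>2/4 - p\<close>.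
\<close>

definition k1 :: "real \<Rightarrow> complex \<Rightarrow> complex" where
  "k1 t p = of_real t * exp (- p * of_real t / 2) * sinhc ((of_real t)\<^sup>2 * (p\<^sup>2 / 4 - p))"

definition k0 :: "real \<Rightarrow> complex \<Rightarrow> complex" where
  "k0 t p = exp (- p * of_real t / 2) * coshc ((of_real t)\<^sup>2 * (p\<^sup>2 / 4 - p)) + p / 2 * k1 t p"

lemma holomorphic_k1 [holomorphic_intros]: "f holomorphic_on A \<Longrightarrow> (\<lambda>w. k1 t (f w)) holomorphic_on A"
  unfolding k1_def
  by (intro holomorphic_intros holomorphic_on_compose_gen[OF _ holomorphic_sinhc[of UNIV], unfolded o_def]) auto

lemma holomorphic_k0 [holomorphic_intros]: "f holomorphic_on A \<Longrightarrow> (\<lambda>w. k0 t (f w)) holomorphic_on A"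
  unfolding k0_def coshc_def
  by (intro holomorphic_intros holomorphic_on_compose_gen[OF _ holomorphic_sinhc[of UNIV], unfolded o_def]) auto

context
  fixes p d :: complex
  assumes d: "d\<^sup>2 = p\<^sup>2 / 4 - p"
begin

lemma exp_root_eq:
  "exp (- p * of_real t / 2) * exp (of_real t * d) = exp ((- p / 2 + d) * of_real t)"
  "exp (- p * of_real t / 2) * exp (- (of_real t * d)) = exp ((- p / 2 - d) * of_real t)"
  unfolding exp_add[symmetric] by (rule arg_cong[of _ _ exp], simp add: algebra_simps)+

lemma k1_mult_root:
  "2 * d * k1 t p = exp ((- p / 2 + d) * of_real t) - exp ((- p / 2 - d) * of_real t)"
proof -
  have "2 * d * k1 t p = exp (- p * of_real t / 2) * (2 * ((of_real t * d) * sinhc ((of_real t * d)\<^sup>2)))"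
    by (simp add: k1_def d power_mult_distrib)
  also have "\<dots> = exp (- p * of_real t / 2) * (exp (of_real t * d) - exp (- (of_real t * d)))"
    unfolding mult_sinhc by (simp add: sinh_field_def)
  also have "\<dots> = exp ((- p / 2 + d) * of_real t) - exp ((- p / 2 - d) * of_real t)"
    by (simp only: right_diff_distrib exp_root_eq)
  finally show ?thesis .
qed

lemma k1_double_root: "d = 0 \<Longrightarrow> k1 t p = of_real t * exp (- p / 2 * of_real t)"
  using d by (simp add: k1_def sinhc_0)

lemma k0_eq:
  "k0 t p = (exp ((- p / 2 + d) * of_real t) + exp ((- p / 2 - d) * of_real t)) / 2 + p / 2 * k1 t p"
proof -
  have "exp (- p * of_real t / 2) * coshc ((of_real t)\<^sup>2 * (p\<^sup>2 / 4 - p))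
      = exp (- p * of_real t / 2) * cosh (of_real t * d)"
    unfolding coshc_square[symmetric] by (simp add: d power_mult_distrib)
  also have "\<dots> = exp (- p * of_real t / 2) * (exp (of_real t * d) + exp (- (of_real t * d))) / 2"
    by (simp add: cosh_field_def)
  also have "\<dots> = (exp ((- p / 2 + d) * of_real t) + exp ((- p / 2 - d) * of_real t)) / 2"
    by (simp only: distrib_left exp_root_eq)
  finally show ?thesis by (simp add: k0_def)
qed

lemma k0_eq': "k0 t p = exp ((- p / 2 + d) * of_real t) - (- p / 2 + d) * k1 t p"
proof -
  define x y where "x = exp ((- p / 2 + d) * of_real t)" and "y = exp ((- p / 2 - d) * of_real t)"
  have "k0 t p = (x + y) / 2 + p / 2 * k1 t p" "2 * d * k1 t p = x - y"
    unfolding x_def y_def by (rule k0_eq, rule k1_mult_root)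
  moreover have "(x + y) / 2 = x - (x - y) / 2" by (simp add: field_simps)
  ultimately have "k0 t p = x - 2 * d * k1 t p / 2 + p / 2 * k1 t p" by simp
  then show ?thesis unfolding x_def[symmetric] by (simp add: algebra_simps)
qed

lemma
  shows k1_derivative: "((\<lambda>t. k1 t p) has_vector_derivative (k0 t p - p * k1 t p)) (at t)"
    and k0_derivative: "((\<lambda>t. k0 t p) has_vector_derivative - p * k1 t p) (at t)"
proof -
  have e: "((\<lambda>t. exp (c * of_real t)) has_vector_derivative c * exp (c * of_real t)) (at t)" for c :: complex and t
    by (rule has_vector_derivative_real_field) (auto intro!: derivative_eq_intros)
  show 1: "((\<lambda>t. k1 t p) has_vector_derivative (k0 t p - p * k1 t p)) (at t)" for t
  proof (cases "d = 0")
    case True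
    have "((\<lambda>t. of_real t * exp (- p / 2 * of_real t)) has_vector_derivative
        of_real t * (- p / 2 * exp (- p / 2 * of_real t)) + 1 * exp (- p / 2 * of_real t)) (at t)"
      by (intro has_vector_derivative_mult e has_vector_derivative_of_real) (auto intro!: derivative_eq_intros)
    moreover have "k0 t p - p * k1 t p
        = of_real t * (- p / 2 * exp (- p / 2 * of_real t)) + 1 * exp (- p / 2 * of_real t)"
      unfolding k0_eq' k1_double_root[OF True] True by simp
    ultimately show ?thesis unfolding k1_double_root[OF True] by simp
  next
    case False
    have k: "k1 t p = (1 / (2 * d)) * (exp ((- p / 2 + d) * of_real t) - exp ((- p / 2 - d) * of_real t))" for t
      unfolding k1_mult_root[symmetric] using False by simp
    have "((\<lambda>t. k1 t p) has_vector_derivative (1 / (2 * d)) *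
       ((- p / 2 + d) * exp ((- p / 2 + d) * of_real t) - (- p / 2 - d) * exp ((- p / 2 - d) * of_real t))) (at t)"
      unfolding k by (intro has_vector_derivative_mult_right has_vector_derivative_diff e)
    moreover have "(1 / (2 * d)) * ((- p / 2 + d) * x - (- p / 2 - d) * y)
       = (x + y) / 2 - p / 2 * ((1 / (2 * d)) * (x - y))" for x y
      using False by (simp add: field_simps)
    moreover have "k0 t p - p * k1 t p = (exp ((- p / 2 + d) * of_real t) + exp ((- p / 2 - d) * of_real t)) / 2 - p / 2 * k1 t p"
      unfolding k0_eq by (simp add: algebra_simps)
    ultimately show ?thesis unfolding k by simp
  qed
  have "((\<lambda>t. exp ((- p / 2 + d) * of_real t) - (- p / 2 + d) * k1 t p) has_vector_derivative
      (- p / 2 + d) * exp ((- p / 2 + d) * of_real t) - (- p / 2 + d) * (k0 t p - p * k1 t p)) (at t)"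
    by (intro has_vector_derivative_diff has_vector_derivative_mult_right e 1)
  moreover have "(- p / 2 + d) * exp ((- p / 2 + d) * of_real t) - (- p / 2 + d) * (k0 t p - p * k1 t p) = - p * k1 t p"
  proof -
    have "(- p / 2 + d) * exp ((- p / 2 + d) * of_real t) - (- p / 2 + d) * (k0 t p - p * k1 t p)
       = ((d + - p / 2)\<^sup>2 + p * (d + - p / 2)) * k1 t p"
      unfolding k0_eq' by (simp add: field_simps power2_eq_square)
    also have "(d + - p / 2)\<^sup>2 + p * (d + - p / 2) = d\<^sup>2 - p\<^sup>2 / 4" by (simp add: power2_eq_square field_simps)
    also have "\<dots> = - p" by (simp add: d)
    finally show ?thesis .
  qed
  ultimately show "((\<lambda>t. k0 t p) has_vector_derivative - p * k1 t p) (at t)" unfolding k0_eq' by simp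
qed

text \<open>
  Mean value bound for the divided difference of \<open>exp\<close> on a half plane, and the direct bound by the two
  exponentials; the former is useful where the roots are close, the latter where \<open>d\<close> is large.
\<close>

lemma
  assumes E: "norm (exp ((- p / 2 + d) * of_real t)) \<le> E" "norm (exp ((- p / 2 - d) * of_real t)) \<le> E" and t: "t \<ge> 0"
  shows norm_k1_le: "norm (k1 t p) \<le> t * E"
    and norm_k1_root_le: "norm (k1 t p) * norm d \<le> E"
    and norm_k0_le: "norm (k0 t p) \<le> E + norm p / 2 * norm (k1 t p)"
proof -
  define x y where "x = (- p / 2 + d) * of_real t" and "y = (- p / 2 - d) * of_real t"
  have xy: "norm (exp x) \<le> E" "norm (exp y) \<le> E" using E by (simp_all add: x_def y_def)
  have Epos: "E > 0" using xy(1) by (auto intro: less_le_trans[of 0 "norm (exp x)"])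
  have k: "2 * d * k1 t p = exp x - exp y" using k1_mult_root[of t] by (simp add: x_def y_def)
  have "norm (exp x - exp y) \<le> E * norm (x - y)"
  proof (rule field_differentiable_bound[where S="{w. Re w \<le> ln E}" and f'=exp])
    show "convex {w. Re w \<le> ln E}" by (rule convex_halfspace_Re_le)
    show "norm (exp w) \<le> E" if "w \<in> {w. Re w \<le> ln E}" for w
      using that Epos by (simp add: norm_exp_eq_Re ln_ge_iff)
  qed (use xy Epos in \<open>auto simp: norm_exp_eq_Re ln_ge_iff DERIV_exp has_field_derivative_at_within\<close>)
  also have "x - y = 2 * d * of_real t" by (simp add: x_def y_def algebra_simps)
  finally have "norm d * norm (k1 t p) \<le> norm d * (t * E)"
    unfolding k[symmetric] using t by (simp add: norm_mult mult_ac)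
  then show "norm (k1 t p) \<le> t * E"
  proof (cases "d = 0")
    case True
    then show ?thesis using E(1) t by (simp add: k1_double_root norm_mult mult_left_mono)
  qed (auto)
  have "norm (2 * d * k1 t p) \<le> norm (exp x) + norm (exp y)" unfolding k by (rule norm_triangle_ineq4)
  then show "norm (k1 t p) * norm d \<le> E" using xy by (simp add: norm_mult mult_ac)
  have "norm (k0 t p) \<le> norm ((exp x + exp y) / 2) + norm (p / 2 * k1 t p)"
    unfolding k0_eq x_def y_def by (rule norm_triangle_ineq)
  also have "norm ((exp x + exp y) / 2) \<le> E"
    using norm_triangle_ineq[of "exp x" "exp y"] xy by (simp add: norm_divide)
  finally show "norm (k0 t p) \<le> E + norm p / 2 * norm (k1 t p)"
    by (simp add: norm_mult norm_divide)
qed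

end

lemma characteristic_root:
  fixes p :: complex
  assumes "d\<^sup>2 = p\<^sup>2 / 4 - p" and "l = - p / 2 + d \<or> l = - p / 2 - d"
  shows "l\<^sup>2 = - p * (l + 1)"
proof -
  have "(l + p / 2)\<^sup>2 = d\<^sup>2" using assms(2) by auto
  moreover have "(l + p / 2)\<^sup>2 = l\<^sup>2 + p * l + p\<^sup>2 / 4" by (simp add: power2_eq_square field_simps)
  ultimately have "l\<^sup>2 + p * l = - p" using assms(1) by simp
  then show ?thesis by (simp add: algebra_simps add_eq_0_iff eq_diff_eq)
qed

text \<open>
  For \<open>|p| \<ge> 1\<close> the roots have a spectral gap. Were \<open>Re l > - 1/8\<close>, then \<open>|l|\<^sup>2 = |p| |l + 1|\<close> would force
  \<open>|l|\<^sup>2 \<ge> 3/2\<close>. Multiplying \<open>- p (l + 1) = l\<^sup>2\<close> by the conjugate of \<open>l + 1\<close> gives real and imaginary part of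
  \<open>p |l + 1|\<^sup>2\<close>. Positivity of the first makes \<open>l\<close> nearly imaginary, so that the second is comparable to \<open>|l|\<^sup>3\<close>,
  too large for \<open>p\<close> in a narrow sector.
\<close>

lemma Re_root_le:
  fixes p l :: complex
  assumes l: "l\<^sup>2 = - p * (l + 1)" and p: "norm p \<ge> 1" "Re p > 0" "\<bar>Im p\<bar> \<le> Re p / 2"
  shows "Re l \<le> - 1 / 8"
proof (rule ccontr)
  assume contr: "\<not> ?thesis"
  define x y N where "x = Re l" and "y = Im l" and "N = x\<^sup>2 + y\<^sup>2"
  have x: "x > - 1 / 8" using contr by (simp add: x_def)
  have N: "N = (norm l)\<^sup>2" by (simp add: N_def x_def y_def cmod_power2)
  define q where "q = (norm (l + 1))\<^sup>2"
  have q: "q = N + 2 * x + 1" unfolding q_def cmod_power2 by (simp add: N_def x_def y_def power2_eq_square algebra_simps)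
  have "N = norm p * norm (l + 1)"
    using arg_cong[OF l, of norm] unfolding N by (simp add: norm_power norm_mult)
  then have "N\<^sup>2 = (norm p)\<^sup>2 * q" by (simp add: q_def power_mult_distrib)
  moreover have "(norm p)\<^sup>2 \<ge> 1" using p(1) by simp
  moreover have "q \<ge> 0" by (simp add: q_def)
  ultimately have "N\<^sup>2 \<ge> q" using mult_right_mono[of 1 "(norm p)\<^sup>2" q] by simp
  then have N2: "N * N \<ge> N + 3 / 4" using q x by (simp add: power2_eq_square)
  have N0: "N \<ge> 0" by (simp add: N)
  have N32: "N \<ge> 3 / 2"
  proof (rule ccontr)
    assume "\<not> N \<ge> 3 / 2"
    then have "(N - 3/2) * (N + 1/2) < 0" using N0 by (intro mult_neg_pos) auto
    then show False using N2 by (simp add: algebra_simps)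
  qed
  have pq: "p * of_real q = - (l\<^sup>2 * cnj (l + 1))"
    unfolding q_def complex_norm_square l by (simp add: mult_ac)
  have re: "Re p * q = y\<^sup>2 - x\<^sup>2 - N * x" and im: "Im p * q = - (y * (N + 2 * x))"
    using arg_cong[OF pq, of Re] arg_cong[OF pq, of Im]
    by (simp_all add: N_def x_def y_def power2_eq_square algebra_simps)
  have "q > 0" using q x N32 by simp
  then have "0 < y\<^sup>2 - x\<^sup>2 - N * x" using p(2) unfolding re[symmetric] by simp
  have "N * x \<ge> - (N / 8)" using mult_left_mono[of "- 1 / 8" x N] x N0 by simp
  have Nxy: "N = x\<^sup>2 + y\<^sup>2" "x\<^sup>2 \<ge> 0" by (simp_all add: N_def)
  have y2: "y\<^sup>2 \<ge> 7 * N / 16" using \<open>0 < y\<^sup>2 - x\<^sup>2 - N * x\<close> \<open>N * x \<ge> - (N / 8)\<close> Nxy by linarith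
  have "\<bar>y\<bar> * (N + 2 * x) = \<bar>Im p\<bar> * q" using arg_cong[OF im, of abs] N32 x \<open>q > 0\<close> by (simp add: abs_mult)
  also have "\<dots> \<le> Re p / 2 * q" using p(3) \<open>q > 0\<close> by (intro mult_right_mono) auto
  also have "\<dots> = (y\<^sup>2 - x\<^sup>2 - N * x) / 2" using re by simp
  also have "\<dots> \<le> 9 / 16 * N"
  proof -
    have "y\<^sup>2 - x\<^sup>2 - N * x \<le> N + N / 8" using \<open>N * x \<ge> - (N / 8)\<close> Nxy by linarith
    then show ?thesis by simp
  qed
  finally have A: "\<bar>y\<bar> * (N + 2 * x) \<le> 9 / 16 * N" .
  have "\<bar>y\<bar> \<ge> 4 / 5"
  proof (rule ccontr)
    assume "\<not> ?thesis"
    then have "\<bar>y\<bar>\<^sup>2 < (4/5)\<^sup>2" by (intro power_strict_mono) auto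
    then show False using y2 N32 by (simp add: power2_eq_square)
  qed
  then have "4 / 5 * (5 / 6 * N) \<le> \<bar>y\<bar> * (N + 2 * x)"
    using x N32 by (intro mult_mono) auto
  with A N32 show False by simp
qed

lemma cos_ge_three_quarters:
  fixes \<psi> :: real
  shows "\<bar>\<psi>\<bar> \<le> 1/4 \<Longrightarrow> 3 / 4 \<le> cos \<psi>"
proof -
  assume p: "\<bar>\<psi>\<bar> \<le> 1/4"
  have "cos (pi/3) \<le> cos \<bar>\<psi>\<bar>" using p pi_gt3 by (intro cos_monotone_0_pi_le) auto
  then have c: "1 / 2 \<le> cos \<psi>" by (simp add: cos_60)
  have "\<bar>sin \<psi>\<bar> \<le> 1/4" using abs_sin_x_le_abs_x[of \<psi>] p by simp
  then have "(sin \<psi>)\<^sup>2 \<le> (1/4)\<^sup>2" using abs_le_square_iff[of "sin \<psi>" "1/4"] by simp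
  then have "(cos \<psi>)\<^sup>2 \<ge> (3/4)\<^sup>2" using sin_cos_squared_add[of \<psi>] by (simp add: power2_eq_square)
  then show ?thesis by (rule power2_le_imp_le) (use c in simp)
qed

text \<open>
  On the real axis \<open>d\<close> is imaginary of modulus about \<open>\<surd>\<rho>\<close>. Off it, \<open>2 Re d Im d = Im (d\<^sup>2)\<close> is at most
  \<open>\<rho> |\<psi>|\<close>, which bounds \<open>Re d\<close>.
\<close>

lemma
  fixes p d :: complex
  assumes d: "d\<^sup>2 = p\<^sup>2 / 4 - p" and p: "p = rcis \<rho> \<psi>" "0 < \<rho>" "\<rho> \<le> 1" "\<bar>\<psi>\<bar> \<le> 1/4"
  shows abs_Re_root_le: "\<bar>Re d\<bar> \<le> sqrt \<rho> * \<bar>\<psi>\<bar>"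
    and norm_root_ge: "(norm d)\<^sup>2 \<ge> \<rho> / 2"
proof -
  have c1: "cos \<psi> \<ge> 3 / 4" by (rule cos_ge_three_quarters[OF p(4)])
  have s: "\<bar>sin \<psi>\<bar> \<le> \<bar>\<psi>\<bar>" by (rule abs_sin_x_le_abs_x)
  have R: "Re (d\<^sup>2) = \<rho>\<^sup>2 * ((cos \<psi>)\<^sup>2 - (sin \<psi>)\<^sup>2) / 4 - \<rho> * cos \<psi>"
    and I: "Im (d\<^sup>2) = \<rho> * sin \<psi> * (\<rho> * cos \<psi> / 2 - 1)"
    unfolding d p(1) by (simp_all add: power2_eq_square algebra_simps)
  have "(cos \<psi>)\<^sup>2 - (sin \<psi>)\<^sup>2 \<le> 1" using cos_squared_eq[of \<psi>] by simp
  then have "\<rho>\<^sup>2 * ((cos \<psi>)\<^sup>2 - (sin \<psi>)\<^sup>2) \<le> \<rho>\<^sup>2 * 1"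
    by (rule mult_left_mono) simp
  also have "\<dots> \<le> \<rho>" using p mult_left_mono[of \<rho> 1 \<rho>] unfolding power2_eq_square by linarith
  finally have "\<rho>\<^sup>2 * ((cos \<psi>)\<^sup>2 - (sin \<psi>)\<^sup>2) \<le> \<rho>" .
  moreover have "\<rho> * cos \<psi> \<ge> \<rho> * (3 / 4)" using c1 p by (intro mult_left_mono) auto
  ultimately have R2: "Re (d\<^sup>2) \<le> - (\<rho> / 2)" unfolding R by simp
  have "0 \<le> \<rho> * cos \<psi>" using p c1 by simp
  moreover have "\<rho> * cos \<psi> \<le> 1 * 1" using p c1 by (intro mult_mono) auto
  ultimately have "\<bar>\<rho> * cos \<psi> / 2 - 1\<bar> \<le> 1" by linarith
  then have "\<bar>Im (d\<^sup>2)\<bar> \<le> \<rho> * \<bar>\<psi>\<bar> * 1"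
    unfolding I abs_mult using p s by (intro mult_mono) auto
  then have I2: "2 * \<bar>Re d\<bar> * \<bar>Im d\<bar> \<le> \<rho> * \<bar>\<psi>\<bar>"
    by (simp add: power2_eq_square abs_mult mult_ac)
  have RI: "(Im d)\<^sup>2 - (Re d)\<^sup>2 \<ge> \<rho> / 2" using R2 by (simp add: power2_eq_square)
  then show "(norm d)\<^sup>2 \<ge> \<rho> / 2" unfolding cmod_power2 using zero_le_power2[of "Re d"] by linarith
  have "(Im d)\<^sup>2 \<ge> \<rho> / 2" using RI zero_le_power2[of "Re d"] by linarith
  then have Id: "sqrt (\<rho> / 2) \<le> \<bar>Im d\<bar>" using real_sqrt_le_mono[of "\<rho> / 2" "(Im d)\<^sup>2"] by simp
  have "sqrt \<rho> / 2 \<le> sqrt (\<rho> / 2)"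
  proof -
    have "sqrt \<rho> / 2 = sqrt (\<rho> / 4)" by (simp add: real_sqrt_divide)
    also have "\<dots> \<le> sqrt (\<rho> / 2)" using p by simp
    finally show ?thesis .
  qed
  then have "2 * \<bar>Re d\<bar> * (sqrt \<rho> / 2) \<le> 2 * \<bar>Re d\<bar> * \<bar>Im d\<bar>" using Id by (intro mult_left_mono) auto
  also have "\<dots> \<le> \<rho> * \<bar>\<psi>\<bar>" by (rule I2)
  also have "\<dots> = sqrt \<rho> * (sqrt \<rho> * \<bar>\<psi>\<bar>)"
    unfolding mult.assoc[symmetric] using p by simp
  finally show "\<bar>Re d\<bar> \<le> sqrt \<rho> * \<bar>\<psi>\<bar>" using p by simp
qed

lemma norm_root_ge_large:
  fixes p d :: complex
  assumes d: "d\<^sup>2 = p\<^sup>2 / 4 - p" and p: "norm p \<ge> 8"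
  shows "norm d \<ge> norm p / 3"
proof -
  have "d\<^sup>2 = p * (p / 4 - 1)" unfolding d by (simp add: power2_eq_square field_simps)
  then have "norm (d\<^sup>2) = norm (p * (p / 4 - 1))" by (rule arg_cong)
  then have "(norm d)\<^sup>2 = norm p * norm (p / 4 - 1)" by (simp only: norm_mult norm_power)
  moreover have "norm (p / 4 - 1) \<ge> norm p / 4 - 1"
    using norm_triangle_ineq2[of "p / 4" 1] by (simp add: norm_divide)
  then have "norm p * norm (p / 4 - 1) \<ge> norm p * (norm p / 8)"
    using p by (intro mult_left_mono) auto
  ultimately have "(norm d)\<^sup>2 \<ge> (norm p)\<^sup>2 / 8" by (simp add: power2_eq_square)
  moreover have "(norm d)\<^sup>2 \<ge> 0" by simp
  ultimately have "(norm p)\<^sup>2 / 9 \<le> (norm d)\<^sup>2" by linarith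
  then have "(norm p / 3)\<^sup>2 \<le> (norm d)\<^sup>2" by (simp add: power_divide)
  then show ?thesis by (rule power2_le_imp_le) simp
qed

text \<open>
  The growth \<open>\<surd>\<rho> |\<psi>|\<close> of \<open>exp (d t)\<close> is absorbed by half of the damping, \<open>\<surd>\<rho> |\<psi>| \<le> \<rho>/4 + \<psi>\<^sup>2\<close>, at the price of
  \<open>exp (t \<psi>\<^sup>2) \<le> exp 1\<close>.
\<close>

lemma
  assumes p: "p = rcis \<rho> \<psi>" "0 < \<rho>" "\<rho> \<le> 1" "\<bar>\<psi>\<bar> \<le> 1/4" and t: "t \<ge> 0" "t * \<psi>\<^sup>2 \<le> 1"
  shows norm_k1_low: "norm (k1 t p) \<le> 3 * t * exp (- (t * \<rho> / 8))"
    and norm_k1_low': "norm (k1 t p) \<le> 5 * \<rho> powr (- 1/2) * exp (- (t * \<rho> / 8))"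
    and norm_k0_low: "norm (k0 t p) \<le> 6 * exp (- (t * \<rho> / 8))"
proof -
  define d where "d = csqrt (p\<^sup>2 / 4 - p)"
  have d: "d\<^sup>2 = p\<^sup>2 / 4 - p" by (simp add: d_def)
  define e where "e = exp (- (t * \<rho> / 8))"
  have e0: "e > 0" by (simp add: e_def)
  have Rd: "\<bar>Re d\<bar> \<le> sqrt \<rho> * \<bar>\<psi>\<bar>" by (rule abs_Re_root_le[OF d p])
  have "0 \<le> (sqrt \<rho> / 2 - \<bar>\<psi>\<bar>)\<^sup>2" by simp
  also have "\<dots> = \<rho> / 4 + \<psi>\<^sup>2 - sqrt \<rho> * \<bar>\<psi>\<bar>" using p by (simp add: power2_diff power_divide)
  finally have Rd2: "\<bar>Re d\<bar> \<le> \<rho> / 4 + \<psi>\<^sup>2" using Rd by simp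
  have Rp: "Re p \<ge> 3 / 4 * \<rho>" using cos_ge_three_quarters[OF p(4)] p(2) by (simp add: p(1))
  have Re: "norm (exp ((- p / 2 + s * d) * of_real t)) \<le> 3 * e" if s: "s = 1 \<or> s = -1" for s :: complex
  proof -
    have "Re (- p / 2 + s * d) \<le> \<psi>\<^sup>2 - \<rho> / 8" using Rp Rd2 s by (auto simp: abs_le_iff)
    then have "Re (- p / 2 + s * d) * t \<le> (\<psi>\<^sup>2 - \<rho> / 8) * t" using t by (intro mult_right_mono)
    also have "\<dots> \<le> 1 + - (t * \<rho> / 8)" using t(2) by (simp add: algebra_simps)
    finally have "exp (Re (- p / 2 + s * d) * t) \<le> exp 1 * e" by (simp add: e_def flip: exp_add)
    also have "\<dots> \<le> 3 * e" using exp_le e0 by (intro mult_right_mono) auto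
    finally show ?thesis by (simp add: norm_exp_eq_Re)
  qed
  note E = Re[of 1, simplified] Re[of "-1", simplified]
  have E1: "norm (exp ((- p / 2 + d) * of_real t)) \<le> 3 * e" "norm (exp ((- p / 2 - d) * of_real t)) \<le> 3 * e"
    using E by simp_all
  show k1: "norm (k1 t p) \<le> 3 * t * exp (- (t * \<rho> / 8))"
    using norm_k1_le[OF d E1 t(1)] unfolding e_def by (simp only: mult.assoc mult.left_commute)
  have "sqrt \<rho> * (3/5) \<le> norm d"
  proof (rule power2_le_imp_le)
    have "(sqrt \<rho> * (3/5))\<^sup>2 = \<rho> * (9/25)" using p by (simp add: power_mult_distrib power_divide)
    also have "\<dots> \<le> \<rho> / 2" using p by simp
    also have "\<dots> \<le> (norm d)\<^sup>2" by (rule norm_root_ge[OF d p])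
    finally show "(sqrt \<rho> * (3/5))\<^sup>2 \<le> (norm d)\<^sup>2" .
  qed simp
  then have "norm (k1 t p) * (sqrt \<rho> * (3/5)) \<le> norm (k1 t p) * norm d" by (intro mult_left_mono) auto
  also have "\<dots> \<le> 3 * e" by (rule norm_k1_root_le[OF d E1 t(1)])
  finally have "norm (k1 t p) * sqrt \<rho> * (3/5) \<le> 3 * e" by (simp only: mult.assoc)
  then have A: "norm (k1 t p) * sqrt \<rho> \<le> 5 * e" by linarith
  then have "norm (k1 t p) \<le> 5 * e / sqrt \<rho>" using p(2) by (subst pos_le_divide_eq) auto
  then show k1': "norm (k1 t p) \<le> 5 * \<rho> powr (- 1/2) * exp (- (t * \<rho> / 8))"
    using p(2) powr_minus_divide[of \<rho> "1/2"] unfolding e_def[symmetric] by (simp add: powr_half_sqrt)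
  have "\<rho>\<^sup>2 \<le> \<rho>" using mult_left_mono[of \<rho> 1 \<rho>] p unfolding power2_eq_square by linarith
  then have "\<rho> \<le> sqrt \<rho>" by (rule real_le_rsqrt)
  then have "norm (k1 t p) * \<rho> \<le> norm (k1 t p) * sqrt \<rho>" by (intro mult_left_mono) auto
  then have "norm (k1 t p) * \<rho> \<le> 5 * e" using A by linarith
  moreover have "norm p = \<rho>" using p by simp
  ultimately have "norm p / 2 * norm (k1 t p) \<le> 5 * e / 2" by (simp only: mult.commute[of "norm (k1 t p)"] times_divide_eq_left divide_right_mono)
  with norm_k0_le[OF d E1 t(1)] e0 show "norm (k0 t p) \<le> 6 * exp (- (t * \<rho> / 8))" unfolding e_def[symmetric] by simp
qed

text \<open>
  Near \<open>p = 0\<close> the solutions \<open>k\<^sub>0, k\<^sub>1\<close> are close to \<open>1\<close> and \<open>t\<close>: integrate \<open>\<partial>\<^sub>t k\<^sub>0 = - p k\<^sub>1\<close> and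
  \<open>\<partial>\<^sub>t k\<^sub>1 = k\<^sub>0 - p k\<^sub>1\<close> from \<open>0\<close> to \<open>t\<close>.
\<close>

lemma
  assumes p: "p = rcis \<rho> \<psi>" "0 < \<rho>" "\<rho> \<le> 1" "\<bar>\<psi>\<bar> \<le> 1/4" and t: "t \<ge> 0" "t * (sqrt \<rho> * \<bar>\<psi>\<bar>) \<le> 1"
  shows norm_k1_linear: "norm (k1 t p) \<le> 3 * t"
    and norm_k0_minus_1: "norm (k0 t p - 1) \<le> 3 * \<rho> * t\<^sup>2"
    and norm_k1_minus_t: "norm (k1 t p - of_real t) \<le> 3 * \<rho> * (t\<^sup>2 + t) * t"
proof -
  define d where "d = csqrt (p\<^sup>2 / 4 - p)"
  have d: "d\<^sup>2 = p\<^sup>2 / 4 - p" by (simp add: d_def)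
  have Rd: "\<bar>Re d\<bar> \<le> sqrt \<rho> * \<bar>\<psi>\<bar>" by (rule abs_Re_root_le[OF d p])
  have Rp: "Re p \<ge> 0" using cos_ge_three_quarters[OF p(4)] p(2) by (simp add: p(1))
  have k1: "norm (k1 s p) \<le> 3 * s" if s: "0 \<le> s" "s \<le> t" for s
  proof -
    have E: "norm (exp ((- p / 2 + e * d) * of_real s)) \<le> 3" if e: "e = 1 \<or> e = -1" for e :: complex
    proof -
      have "Re (- p / 2 + e * d) \<le> sqrt \<rho> * \<bar>\<psi>\<bar>" using Rp Rd e by (auto simp: abs_le_iff)
      then have "Re (- p / 2 + e * d) * s \<le> (sqrt \<rho> * \<bar>\<psi>\<bar>) * s" using s by (intro mult_right_mono)
      also have "\<dots> \<le> (sqrt \<rho> * \<bar>\<psi>\<bar>) * t" using s p by (intro mult_left_mono) auto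
      also have "\<dots> \<le> 1" using t by (simp add: mult.commute)
      finally have "exp (Re (- p / 2 + e * d) * s) \<le> exp 1" by simp
      also have "\<dots> \<le> 3" by (rule exp_le)
      finally show ?thesis by (simp add: norm_exp_eq_Re)
    qed
    have E1: "norm (exp ((- p / 2 + d) * of_real s)) \<le> 3" "norm (exp ((- p / 2 - d) * of_real s)) \<le> 3"
      using E[of 1] E[of "-1"] by simp_all
    show ?thesis using norm_k1_le[OF d E1 s(1)] by simp
  qed
  then show "norm (k1 t p) \<le> 3 * t" using t by simp
  have mvt: "norm (f s - f 0) \<le> B * s"
    if f: "\<And>r. (f has_vector_derivative f' r) (at r)" and B: "\<And>r. 0 \<le> r \<Longrightarrow> r \<le> s \<Longrightarrow> norm (f' r) \<le> B" and s: "0 \<le> s"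
    for f f' :: "real \<Rightarrow> complex" and B s
  proof -
    show ?thesis
    proof (cases "s = 0")
      case False
      have "continuous_on {0..s} f"
        by (intro continuous_at_imp_continuous_on ballI) (rule has_vector_derivative_continuous[OF f])
      moreover have "((\<lambda>r. B * r) has_vector_derivative B) (at r)" for r
        unfolding has_real_derivative_iff_has_vector_derivative[symmetric]
        by (auto intro!: derivative_eq_intros)
      ultimately have "norm (f s - f 0) \<le> B * s - B * 0"
        using B s False
        by (intro differentiable_bound_general[where \<phi>'="\<lambda>_. B" and f'=f'] f continuous_intros) auto
      then show ?thesis by simp
    qed simp
  qed
  have np: "norm p = \<rho>" using p by simp
  have k00: "k0 0 p = 1" "k1 0 p = 0" by (simp_all add: k0_def k1_def coshc_def)
  have k0: "norm (k0 s p - 1) \<le> 3 * \<rho> * t\<^sup>2" if s: "0 \<le> s" "s \<le> t" for s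
  proof -
    have "norm (k0 s p - k0 0 p) \<le> (\<rho> * (3 * t)) * s"
    proof (rule mvt[where f="\<lambda>t. k0 t p" and f'="\<lambda>t. - p * k1 t p", OF k0_derivative[OF d]])
      fix r assume r: "0 \<le> r" "r \<le> s"
      then have "norm (k1 r p) \<le> 3 * t" using k1[of r] s by simp
      then show "norm (- p * k1 r p) \<le> \<rho> * (3 * t)" using p by (simp add: norm_mult np mult_left_mono)
    qed (use s in auto)
    also have "\<dots> \<le> (\<rho> * (3 * t)) * t" using s p t by (intro mult_left_mono) auto
    finally show ?thesis by (simp add: k00 power2_eq_square mult_ac)
  qed
  then show "norm (k0 t p - 1) \<le> 3 * \<rho> * t\<^sup>2" using t by simp
  have "norm ((k1 t p - of_real t) - (k1 0 p - of_real 0)) \<le> (3 * \<rho> * (t\<^sup>2 + t)) * t"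
  proof (rule mvt[where f="\<lambda>t. k1 t p - of_real t" and f'="\<lambda>t. k0 t p - p * k1 t p - 1"])
    show "((\<lambda>t. k1 t p - of_real t) has_vector_derivative k0 r p - p * k1 r p - 1) (at r)" for r
      by (intro has_vector_derivative_diff k1_derivative[OF d]) (auto intro!: derivative_eq_intros has_vector_derivative_real_field)
    fix r assume r: "0 \<le> r" "r \<le> t"
    have "norm (k0 r p - p * k1 r p - 1) \<le> norm (k0 r p - 1) + norm (p * k1 r p)"
      using norm_triangle_ineq4[of "k0 r p - 1" "p * k1 r p"] by (simp add: algebra_simps)
    also have "norm (p * k1 r p) \<le> \<rho> * (3 * t)"
      unfolding norm_mult np using k1[OF r] r p by (intro mult_left_mono) auto
    finally show "norm (k0 r p - p * k1 r p - 1) \<le> 3 * \<rho> * (t\<^sup>2 + t)"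
      using k0[OF r] by (simp add: algebra_simps)
  qed (use t in auto)
  then show "norm (k1 t p - of_real t) \<le> 3 * \<rho> * (t\<^sup>2 + t) * t" by (simp add: k00)
qed

text \<open>
  For wider sectors, where \<open>\<psi>\<^sup>2 t\<close> is not bounded. The growth is compensated by an additional
  factor \<open>exp (- A p)\<close>.
\<close>

lemma norm_k1_growth:
  assumes p: "p = rcis \<rho> \<psi>" "0 < \<rho>" "\<rho> \<le> 1" "\<bar>\<psi>\<bar> \<le> 1/4" and t: "t \<ge> 0"
  shows "norm (k1 t p) \<le> t * exp (t * (sqrt \<rho> * \<bar>\<psi>\<bar>))"
proof -
  define d where "d = csqrt (p\<^sup>2 / 4 - p)"
  have d: "d\<^sup>2 = p\<^sup>2 / 4 - p" by (simp add: d_def)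
  have Rd: "\<bar>Re d\<bar> \<le> sqrt \<rho> * \<bar>\<psi>\<bar>" by (rule abs_Re_root_le[OF d p])
  have Rp: "Re p \<ge> 0" using cos_ge_three_quarters[OF p(4)] p(2) by (simp add: p(1))
  have E: "norm (exp ((- p / 2 + e * d) * of_real t)) \<le> exp (t * (sqrt \<rho> * \<bar>\<psi>\<bar>))"
    if e: "e = 1 \<or> e = -1" for e :: complex
  proof -
    have "Re (- p / 2 + e * d) \<le> sqrt \<rho> * \<bar>\<psi>\<bar>" using Rp Rd e by (auto simp: abs_le_iff)
    then have "t * Re (- p / 2 + e * d) \<le> t * (sqrt \<rho> * \<bar>\<psi>\<bar>)" using t by (rule mult_left_mono)
    then show ?thesis by (simp add: norm_exp_eq_Re mult.commute)
  qed
  have E1: "norm (exp ((- p / 2 + d) * of_real t)) \<le> exp (t * (sqrt \<rho> * \<bar>\<psi>\<bar>))"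
    "norm (exp ((- p / 2 - d) * of_real t)) \<le> exp (t * (sqrt \<rho> * \<bar>\<psi>\<bar>))"
    using E[of 1] E[of "-1"] by simp_all
  show ?thesis by (rule norm_k1_le[OF d E1 t])
qed

lemma mult_exp_neg_le: "(t::real) * exp (- (t / 8)) \<le> 16 * exp (- (t / 16))"
proof -
  have "t / 16 \<le> exp (t / 16)" using exp_ge_add_one_self[of "t / 16"] by linarith
  then have "t / 16 * exp (- (t / 8)) \<le> exp (t / 16) * exp (- (t / 8))" by (intro mult_right_mono) auto
  also have "\<dots> = exp (- (t / 16))" by (simp flip: exp_add)
  finally show ?thesis by simp
qed

text \<open>
  High frequencies decay exponentially in time. One of the roots stays bounded, and by \<open>l\<^sup>2 = - p (l + 1)\<close>
  it converges to \<open>-1\<close> like \<open>1/|p|\<close>; this is the part of the solution that gains no regularity.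
\<close>

lemma
  assumes p: "p = rcis \<rho> \<psi>" "1 \<le> \<rho>" "\<bar>\<psi>\<bar> \<le> 1/4" and t: "t \<ge> 0"
  shows norm_k1_high: "norm (k1 t p) \<le> 128 / \<rho> * exp (- (t / 16))"
    and norm_k0_high: "norm (k0 t p - exp (- of_real t)) \<le> 528 / \<rho> * exp (- (t / 16))"
proof -
  define d where "d = csqrt (p\<^sup>2 / 4 - p)"
  have d: "d\<^sup>2 = p\<^sup>2 / 4 - p" by (simp add: d_def)
  have np: "norm p = \<rho>" using p by simp
  have c: "3 / 4 \<le> cos \<psi>" by (rule cos_ge_three_quarters[OF p(3)])
  have "\<bar>sin \<psi>\<bar> \<le> 1/4" using abs_sin_x_le_abs_x[of \<psi>] p by simp
  then have "\<bar>sin \<psi>\<bar> \<le> cos \<psi> / 2" using c by linarith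
  then have "\<rho> * \<bar>sin \<psi>\<bar> \<le> \<rho> * (cos \<psi> / 2)" using p by (intro mult_left_mono) auto
  then have Im: "\<bar>Im p\<bar> \<le> Re p / 2" using p by (simp add: abs_mult)
  have Rep: "Re p > 0" using p c by simp
  have root: "l\<^sup>2 = - p * (l + 1)" "Re l \<le> - 1 / 8" if "l = - p / 2 + d \<or> l = - p / 2 - d" for l
    using characteristic_root[OF d that] Re_root_le[OF characteristic_root[OF d that] _ Rep Im] np p(2) by auto
  have ex: "norm (exp (l * of_real t)) \<le> exp (- (t / 8))" if "Re l \<le> - 1 / 8" for l
    using mult_right_mono[OF that t] by (simp add: norm_exp_eq_Re)
  note E = ex[OF root(2), OF disjI1[OF refl]] ex[OF root(2), OF disjI2[OF refl]]
  have e8: "exp (- (t / 8)) \<le> exp (- (t / 16))" "exp (- t) \<le> exp (- (t / 16))" using t by simp_all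
  show k1: "norm (k1 t p) \<le> 128 / \<rho> * exp (- (t / 16))"
  proof (cases "\<rho> \<le> 8")
    case True
    have "norm (k1 t p) \<le> 16 * exp (- (t / 16))"
      using norm_k1_le[OF d E t] mult_exp_neg_le[of t] by linarith
    also have "\<dots> \<le> 128 / \<rho> * exp (- (t / 16))"
      using True p by (intro mult_right_mono) (auto simp: field_simps)
    finally show ?thesis .
  next
    case False
    have "norm (k1 t p) * (\<rho> / 3) \<le> norm (k1 t p) * norm d"
      using norm_root_ge_large[OF d] False np by (intro mult_left_mono) auto
    also have "\<dots> \<le> exp (- (t / 16))" using norm_k1_root_le[OF d E t] e8 by linarith
    finally have "norm (k1 t p) \<le> 3 / \<rho> * exp (- (t / 16))" using p by (simp add: field_simps)
    also have "\<dots> \<le> 128 / \<rho> * exp (- (t / 16))" using p by (intro mult_right_mono divide_right_mono) auto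
    finally show ?thesis .
  qed
  have ne: "norm (exp (- of_real t) :: complex) = exp (- t)" by (simp add: norm_exp_eq_Re)
  show "norm (k0 t p - exp (- of_real t)) \<le> 528 / \<rho> * exp (- (t / 16))"
  proof (cases "\<rho> \<le> 8")
    case True
    have "norm p / 2 * norm (k1 t p) \<le> \<rho> / 2 * (128 / \<rho> * exp (- (t / 16)))"
      unfolding np using k1 p by (intro mult_left_mono) auto
    also have "\<dots> = 64 * exp (- (t / 16))" using p by simp
    finally have "norm (k0 t p) \<le> 65 * exp (- (t / 16))" using norm_k0_le[OF d E t] e8 by linarith
    then have "norm (k0 t p - exp (- of_real t)) \<le> 66 * exp (- (t / 16))"
      using norm_triangle_ineq4[of "k0 t p" "exp (- of_real t)"] ne e8 by linarith
    also have "\<dots> \<le> 528 / \<rho> * exp (- (t / 16))"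
      using True p by (intro mult_right_mono) (auto simp: field_simps)
    finally show ?thesis .
  next
    case False
    \<comment> \<open>the roots have product \<open>p\<close> and sum \<open>- p\<close>, hence one of them has modulus at most 2\<close>
    have small: "norm l \<le> 2" if l: "l * l' = p" "l + l' = - p" "norm l \<le> norm l'" for l l'
    proof -
      have "\<rho> \<le> norm l + norm l'" using norm_triangle_ineq[of l l'] l(2) np by simp
      then have "\<rho> / 2 \<le> norm l'" using l(3) by simp
      then have "norm l * (\<rho> / 2) \<le> norm l * norm l'" by (intro mult_left_mono) auto
      also have "\<dots> = \<rho>" using l(1) np by (simp flip: norm_mult)
      finally show ?thesis using p(2) by simp
    qed
    define a b where "a = - p / 2 + d" and "b = - p / 2 - d"
    have ab: "a * b = p" "a + b = - p"
      using d by (simp_all add: a_def b_def algebra_simps power2_eq_square)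
    obtain l where l: "l = a \<or> l = b" "norm l \<le> 2"
      using small[of a b] small[of b a] ab by (cases "norm a \<le> norm b") (auto simp: mult.commute add.commute)
    have k0l: "k0 t p = exp (l * of_real t) - l * k1 t p"
      using k0_eq'[OF d, of t] k0_eq'[of "- d" p t] d l(1) by (auto simp: a_def b_def)
    have rl: "l\<^sup>2 = - p * (l + 1)" "Re l \<le> - 1 / 8" using root[of l] l(1) by (auto simp: a_def b_def)
    have "\<rho> * norm (l + 1) = (norm l)\<^sup>2" using arg_cong[OF rl(1), of norm] np by (simp add: norm_mult norm_power)
    also have "\<dots> \<le> 2\<^sup>2" using l(2) by (intro power_mono) auto
    finally have l1: "norm (l + 1) \<le> 4 / \<rho>" using p by (simp add: field_simps)
    have "norm (exp (l * of_real t) - exp (- 1 * of_real t)) \<le> exp (- (t / 8)) * norm (l * of_real t - (- 1 * of_real t))"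
    proof (rule field_differentiable_bound[where S="{w. Re w \<le> - (t / 8)}" and f'=exp])
      show "convex {w. Re w \<le> - (t / 8)}" by (rule convex_halfspace_Re_le)
      show "l * of_real t \<in> {w. Re w \<le> - (t / 8)}" using mult_right_mono[OF rl(2) t] by simp
    qed (use t in \<open>auto simp: norm_exp_eq_Re DERIV_exp has_field_derivative_at_within\<close>)
    also have "l * of_real t - (- 1 * of_real t) = (l + 1) * of_real t" by (simp add: algebra_simps)
    also have "exp (- (t / 8)) * norm ((l + 1) * of_real t) = norm (l + 1) * (t * exp (- (t / 8)))" using t by (simp add: norm_mult)
    also have "\<dots> \<le> 4 / \<rho> * (16 * exp (- (t / 16)))"
      by (rule mult_mono[OF l1 mult_exp_neg_le]) (use t p in auto)
    finally have 1: "norm (exp (l * of_real t) - exp (- of_real t)) \<le> 64 / \<rho> * exp (- (t / 16))" by simp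
    have 2: "norm (l * k1 t p) \<le> 2 * (128 / \<rho> * exp (- (t / 16)))"
      unfolding norm_mult using l(2) k1 by (intro mult_mono) auto
    have "norm (k0 t p - exp (- of_real t)) \<le> norm (exp (l * of_real t) - exp (- of_real t)) + norm (l * k1 t p)"
      unfolding k0l using norm_triangle_ineq4[of "exp (l * of_real t) - exp (- of_real t)" "l * k1 t p"] by (simp add: algebra_simps)
    also have "\<dots> \<le> 320 / \<rho> * exp (- (t / 16))" using 1 2 by (simp add: add_divide_distrib[symmetric] distrib_right[symmetric])
    also have "\<dots> \<le> 528 / \<rho> * exp (- (t / 16))" using p by (intro mult_right_mono divide_right_mono) auto
    finally show ?thesis .
  qed
qed

section \<open>Bessel potentials\<close>

lemma rcis_powr:
  assumes "r > 0" "\<bar>\<phi>\<bar> < pi"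
  shows "rcis r \<phi> powr of_real a = rcis (r powr a) (a * \<phi>)"
proof -
  have "rcis r \<phi> = exp (Complex (ln r) \<phi>)"
    using assms by (simp add: rcis_def exp_eq_polar)
  moreover have "Ln (exp (Complex (ln r) \<phi>)) = Complex (ln r) \<phi>"
    using assms by (intro Ln_exp) auto
  ultimately have "rcis r \<phi> powr of_real a = exp (of_real a * Complex (ln r) \<phi>)"
    using assms by (simp add: powr_def)
  also have "\<dots> = rcis (exp (a * ln r)) (a * \<phi>)"
    by (simp add: exp_eq_polar rcis_def)
  finally show ?thesis using assms by (simp add: powr_def)
qed

text \<open>
  The same with \<open>p = w\<^sup>\<sigma>\<close> as the variable that measures frequency: \<open>Q |p|\<close> is the frequency relative to the scale at
  which the two bounds meet.
\<close>

lemma L1_mult_of_polar_bounds: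
  fixes F :: "complex \<Rightarrow> complex"
  assumes th: "0 < \<theta>" "\<theta> \<le> 1" and F: "F holomorphic_on {w. 0 < Re w}" and Q: "Q > 0" and sg: "1 \<le> \<sigma>"
    and e: "0 < e" "e \<le> 1 / \<sigma>" and c: "norm c \<le> M"
    and small: "\<And>r \<phi>. 0 < r \<Longrightarrow> \<bar>\<phi>\<bar> \<le> \<theta> \<Longrightarrow> Q * r powr \<sigma> \<le> 1 \<Longrightarrow> norm (F (rcis r \<phi>) - c) \<le> M * (Q * r powr \<sigma>) powr e"
    and large: "\<And>r \<phi>. 0 < r \<Longrightarrow> \<bar>\<phi>\<bar> \<le> \<theta> \<Longrightarrow> 1 \<le> Q * r powr \<sigma> \<Longrightarrow> norm (F (rcis r \<phi>)) \<le> M * (Q * r powr \<sigma>) powr (- e)"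
  shows "L1_mult (\<lambda>\<xi>::real^'n::finite. F (of_real ((norm \<xi>)\<^sup>2)))
     ((6 / (\<sigma> * e) * 4 powr (CARD('n) / 2 + 1) + 1) * M * \<theta> powr (- CARD('n) / 2 - 1))"
proof -
  have th': "\<theta> < pi/2" using th pi_gt3 by simp
  define R where "R = Q powr (- (1 / \<sigma>))"
  have R: "R > 0" using Q by (simp add: R_def)
  have Rs: "R powr \<sigma> = 1 / Q"
  proof -
    have "- (1 / \<sigma>) * \<sigma> = - 1" using sg by simp
    then have "R powr \<sigma> = Q powr (- 1)" unfolding R_def powr_powr by (simp only:)
    then show ?thesis using Q by (simp add: powr_minus_divide)
  qed
  have q: "(r / R) powr \<sigma> = Q * r powr \<sigma>" if "r > 0" for r
    using that R Rs Q by (simp add: powr_divide)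
  have q1: "(r / R) powr (\<sigma> * e) = (Q * r powr \<sigma>) powr e" if "r > 0" for r
    using q[OF that] by (simp flip: powr_powr)
  have q2: "(R / r) powr (\<sigma> * e) = (Q * r powr \<sigma>) powr (- e)" if "r > 0" for r
  proof -
    have "(R / r) powr (\<sigma> * e) = 1 / (r / R) powr (\<sigma> * e)"
      using that R by (simp add: powr_divide)
    then show ?thesis unfolding q1[OF that] powr_minus_divide .
  qed
  show ?thesis
  proof (rule L1_mult_of_sector_bounds[OF th F R _ _ c])
    show "0 < \<sigma> * e" "\<sigma> * e \<le> 1" using sg e by (simp_all add: field_simps)
    fix w assume w: "w \<in> sector \<theta>" "w \<noteq> 0"
    then have nw: "norm w > 0" by simp
    note P = sector_polar[OF th(1) th' w]
    show "norm (F w - c) \<le> M * (norm w / R) powr (\<sigma> * e)" if "norm w \<le> R"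
    proof -
      have "norm w / R \<le> 1" using that by (simp add: pos_divide_le_eq[OF R])
      then have "(norm w / R) powr \<sigma> \<le> 1" using R sg by (intro powr_le1) auto
      then show ?thesis unfolding q1[OF nw] using small[OF nw P(3)] q[OF nw] P(2) by simp
    qed
  next
    fix w assume w: "w \<in> sector \<theta>" "R \<le> norm w"
    then have nw: "norm w > 0" "w \<noteq> 0" using R by auto
    note P = sector_polar[OF th(1) th' w(1) nw(2)]
    have "1 \<le> norm w / R" using w by (simp add: pos_le_divide_eq[OF R])
    then have "1 \<le> (norm w / R) powr \<sigma>" using sg by (intro ge_one_powr_ge_zero) auto
    then show "norm (F w) \<le> M * (R / norm w) powr (\<sigma> * e)"
      unfolding q2[OF nw(1)] using large[OF nw(1) P(3)] q[OF nw(1)] P(2) by simp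
  qed
qed

text \<open>
  The constants that convert exponential decay into powers; the rate \<open>1/16\<close> is the one of \<open>norm_k1_high\<close>.
\<close>

lemma powr_exp_bounded: "\<exists>C>0. \<forall>x\<ge>1. x powr q * exp (- (x / 16)) \<le> (C::real)"
proof -
  define k where "k = max q 1"
  have "x powr q * exp (- (x / 16)) \<le> exp (k * ln (16 * k))" if x: "x \<ge> 1" for x
  proof -
    have k: "k \<ge> 1" "q \<le> k" by (simp_all add: k_def)
    have "ln (x / (16 * k)) \<le> x / (16 * k)" using ln_le_minus_one[of "x / (16 * k)"] x k by simp
    then have "ln x \<le> x / (16 * k) + ln (16 * k)" using x k by (simp add: ln_div)
    then have "k * ln x \<le> k * (x / (16 * k) + ln (16 * k))" using k by (intro mult_left_mono) auto
    also have "\<dots> = x / 16 + k * ln (16 * k)" using k by (simp add: distrib_left)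
    finally have le: "k * ln x - x / 16 \<le> k * ln (16 * k)" by simp
    have "x powr q \<le> x powr k" using x k by (intro powr_mono)
    then have "x powr q * exp (- (x / 16)) \<le> x powr k * exp (- (x / 16))" by (intro mult_right_mono) auto
    also have "\<dots> = exp (k * ln x - x / 16)" using x by (simp add: powr_def flip: exp_add)
    also have "\<dots> \<le> exp (k * ln (16 * k))" using le by simp
    finally show ?thesis .
  qed
  then show ?thesis using exp_gt_zero by blast
qed

lemma right_half_plane_norm:
  assumes "Re w \<ge> 0"
  shows "1 \<le> norm (1 + w)" "norm w \<le> norm (1 + w)"
proof -
  have "(norm (1 + w))\<^sup>2 = 1 + 2 * Re w + (norm w)\<^sup>2"
    unfolding cmod_power2 by (simp add: power2_eq_square algebra_simps)
  then have "1\<^sup>2 \<le> (norm (1 + w))\<^sup>2" "(norm w)\<^sup>2 \<le> (norm (1 + w))\<^sup>2" using assms by simp_all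
  from this[THEN power2_le_imp_le] show "1 \<le> norm (1 + w)" "norm w \<le> norm (1 + w)"
    by simp_all
qed

lemma right_half_plane_one_plus: "0 < Re w \<Longrightarrow> 1 + w \<notin> \<real>\<^sub>\<le>\<^sub>0"
  by (auto simp: complex_nonpos_Reals_iff)

lemma norm_powr_minus_1_le:
  fixes u :: complex and s :: real
  assumes u: "1 + u \<noteq> 0" and v: "s * ln (norm (1 + u)) \<le> 0"
  shows "norm ((1 + u) powr of_real s - 1) \<le> (4 + 2 * \<bar>s\<bar>) * norm u"
proof (cases "norm u < 1/2")
  case True
  have "Re (of_real s * Ln (1 + u)) \<le> 0" using u v by simp
  then have "norm (exp (of_real s * Ln (1 + u)) - 1) \<le> norm (of_real s * Ln (1 + u))"
    by (rule norm_one_minus_exp_le)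
  also have "\<dots> \<le> \<bar>s\<bar> * (2 * norm u)"
    unfolding norm_mult using norm_Ln_le[OF True] by (simp add: mult_left_mono)
  also have "\<dots> \<le> (4 + 2 * \<bar>s\<bar>) * norm u" by (simp add: algebra_simps)
  finally show ?thesis using u by (simp add: powr_def)
next
  case False
  have "norm ((1 + u) powr of_real s) = exp (s * ln (norm (1 + u)))"
    using u by (simp add: powr_def norm_exp_eq_Re)
  also have "\<dots> \<le> 1" using v by simp
  finally have "norm ((1 + u) powr of_real s - 1) \<le> 2"
    using norm_triangle_ineq4[of "(1 + u) powr of_real s" 1] by simp
  also have "2 \<le> 4 * norm u" using False by simp
  also have "\<dots> \<le> (4 + 2 * \<bar>s\<bar>) * norm u" by (simp add: algebra_simps)
  finally show ?thesis .
qed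

lemma Re_rcis_pos: "0 < r \<Longrightarrow> \<bar>\<phi>\<bar> \<le> 1 \<Longrightarrow> 0 < Re (rcis r \<phi>)"
  using cos_gt_zero_pi[of \<phi>] pi_gt3 by simp

text \<open>
  A sector of fixed angle suffices here, since nothing depends on time.
\<close>

lemma L1_mult_bessel:
  assumes s: "s \<ge> 0"
  shows "\<exists>C>0. L1_mult (\<lambda>\<xi>::real^'n::finite. of_real ((1 + (norm \<xi>)\<^sup>2) powr (- s / 2))) C"
proof (cases "s = 0")
  case True
  have "(\<lambda>\<xi>::real^'n. of_real ((1 + (norm \<xi>)\<^sup>2) powr (- s / 2))) = (\<lambda>_. 1 :: complex)"
    using True by (auto simp: fun_eq_iff add_nonneg_eq_0_iff)
  then show ?thesis using L1_mult_const[of 1, where 'n='n] by (intro exI[of _ 1]) simp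
next
  case False
  define F where "F w = (1 + w) powr of_real (- s / 2)" for w :: complex
  define e where "e = min 1 (s / 2)"
  define M where "M = 4 + s"
  have *: "L1_mult (\<lambda>\<xi>::real^'n. F (of_real ((norm \<xi>)\<^sup>2))) ((6 / (1 * e) * 4 powr (CARD('n) / 2 + 1) + 1) * M * 1 powr (- CARD('n) / 2 - 1))"
  proof (rule L1_mult_of_polar_bounds[where Q=1 and c=1])
    show "F holomorphic_on {w. 0 < Re w}" unfolding F_def
      by (intro holomorphic_intros) (use right_half_plane_one_plus in auto)
    show "0 < e" "e \<le> 1 / 1" using False s by (auto simp: e_def)
    show "norm (1::complex) \<le> M" using s by (simp add: M_def)
    fix r \<phi> :: real assume r: "0 < r" "\<bar>\<phi>\<bar> \<le> 1"
    define w where "w = rcis r \<phi>"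
    have w: "Re w > 0" "norm w = r" using Re_rcis_pos[OF r] r by (auto simp: w_def)
    have w1: "1 \<le> norm (1 + w)" "r \<le> norm (1 + w)" using right_half_plane_norm[of w] w by auto
    have w0: "1 + w \<noteq> 0" using w1 by auto
    show "norm (F w - 1) \<le> M * (1 * r powr 1) powr e" if "1 * r powr 1 \<le> 1"
    proof -
      have "- s / 2 * ln (norm (1 + w)) \<le> 0" using s w1 by (intro mult_nonpos_nonneg) auto
      then have "norm (F w - 1) \<le> (4 + 2 * \<bar>- s / 2\<bar>) * norm w"
        unfolding F_def by (intro norm_powr_minus_1_le w0)
      also have "\<dots> = M * r" using s w by (simp add: M_def)
      also have "\<dots> \<le> M * r powr e" using that r s
        by (intro mult_left_mono le_powr) (auto simp: M_def e_def)
      finally show ?thesis using r by simp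
    qed
    show "norm (F w) \<le> M * (1 * r powr 1) powr (- e)" if "1 \<le> 1 * r powr 1"
    proof -
      have "norm (F w) = norm (1 + w) powr (- s / 2)"
        unfolding F_def using w0 by (subst norm_powr_real_powr') auto
      also have "\<dots> \<le> r powr (- s / 2)" using s r w1 by (intro powr_mono2') auto
      also have "\<dots> \<le> r powr (- e)" using that r by (intro powr_mono) (auto simp: e_def)
      also have "\<dots> \<le> M * r powr (- e)" using s mult_right_mono[of 1 M "r powr (- e)"] by (simp add: M_def)
      finally show ?thesis using r by simp
    qed
  qed auto
  have "F (of_real ((norm \<xi>)\<^sup>2)) = of_real ((1 + (norm \<xi>)\<^sup>2) powr (- s / 2))" for \<xi> :: "real^'n"
    using powr_of_real[of "1 + (norm \<xi>)\<^sup>2" "- s / 2"] by (simp add: F_def add_nonneg_nonneg)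
  with * have **: "L1_mult (\<lambda>\<xi>::real^'n. of_real ((1 + (norm \<xi>)\<^sup>2) powr (- s / 2))) ((6 / (1 * e) * 4 powr (CARD('n) / 2 + 1) + 1) * M * 1 powr (- CARD('n) / 2 - 1))"
    by simp
  have "0 < (6 / (1 * e) * 4 powr (CARD('n) / 2 + 1) + 1) * M * 1 powr (- CARD('n) / 2 - 1)"
    using s False by (auto simp: e_def M_def intro!: mult_pos_pos add_nonneg_pos)
  with ** show ?thesis by blast
qed

section \<open>Estimates along the boundary of a narrow sector\<close>

text \<open>
  The angle \<open>\<psi> = \<sigma> \<phi>\<close> of \<open>p = w\<^sup>\<sigma>\<close> is at most \<open>\<tau>\<^bsup>-1/2\<^esup>/4\<close>, so that both hypotheses \<open>t \<psi>\<^sup>2 \<le> 1\<close> and, for \<open>\<rho> \<le> 1/\<tau>\<close>,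
  \<open>t \<surd>\<rho> |\<psi>| \<le> 1\<close> of the low frequency estimates hold.
\<close>

lemma sector_angle:
  assumes s: "\<sigma> > 1" and t: "t \<ge> 0" and phi: "\<bar>\<phi>\<bar> \<le> 1 / (4 * \<sigma>) * (1 + t) powr (- 1/2)"
  shows "\<bar>\<sigma> * \<phi>\<bar> \<le> 1 / 4" "t * (\<sigma> * \<phi>)\<^sup>2 \<le> 1"
    and "0 < \<rho> \<Longrightarrow> (1 + t) * \<rho> \<le> 1 \<Longrightarrow> t * (sqrt \<rho> * \<bar>\<sigma> * \<phi>\<bar>) \<le> 1"
    and "\<bar>\<phi>\<bar> \<le> 1"
proof -
  define q where "q = (1 + t) powr (- 1/2)"
  have "q \<le> (1 + t) powr 0" unfolding q_def using t by (intro powr_mono) auto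
  then have q: "0 < q" "q \<le> 1" using t by (auto simp: q_def)
  have qq: "q\<^sup>2 * (1 + t) = 1"
  proof -
    have "q\<^sup>2 = (1 + t) powr (- 1)" by (simp add: q_def power2_eq_square flip: powr_add)
    then show ?thesis using t by (simp add: powr_minus_divide)
  qed
  have "\<bar>\<sigma> * \<phi>\<bar> = \<sigma> * \<bar>\<phi>\<bar>" using s by (simp add: abs_mult)
  also have "\<dots> \<le> \<sigma> * (1 / (4 * \<sigma>) * q)" using phi s by (intro mult_left_mono) (auto simp: q_def)
  also have "\<dots> = q / 4" using s by simp
  finally have a: "\<bar>\<sigma> * \<phi>\<bar> \<le> q / 4" .
  then show "\<bar>\<sigma> * \<phi>\<bar> \<le> 1 / 4" using q by linarith
  have "\<bar>\<sigma> * \<phi>\<bar>\<^sup>2 \<le> (q / 4)\<^sup>2" using a by (intro power_mono) auto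
  then have "(\<sigma> * \<phi>)\<^sup>2 \<le> q\<^sup>2 / 16" by (simp add: power_divide)
  then have "t * (\<sigma> * \<phi>)\<^sup>2 \<le> (1 + t) * (q\<^sup>2 / 16)" using t by (intro mult_mono) auto
  then show "t * (\<sigma> * \<phi>)\<^sup>2 \<le> 1" using qq by (simp add: mult.commute)
  show "t * (sqrt \<rho> * \<bar>\<sigma> * \<phi>\<bar>) \<le> 1" if r: "0 < \<rho>" "(1 + t) * \<rho> \<le> 1"
  proof (rule power2_le_imp_le)
    have "t * (sqrt \<rho> * \<bar>\<sigma> * \<phi>\<bar>) \<le> (1 + t) * (sqrt \<rho> * q)"
      using a t r q by (intro mult_mono) auto
    then have "(t * (sqrt \<rho> * \<bar>\<sigma> * \<phi>\<bar>))\<^sup>2 \<le> ((1 + t) * (sqrt \<rho> * q))\<^sup>2"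
      using t r by (intro power_mono) auto
    also have "\<dots> = (q\<^sup>2 * (1 + t)) * ((1 + t) * \<rho>)"
      using r by (simp add: power_mult_distrib power2_eq_square[of "1 + t"])
    also have "\<dots> \<le> 1\<^sup>2" unfolding qq using r by simp
    finally show "(t * (sqrt \<rho> * \<bar>\<sigma> * \<phi>\<bar>))\<^sup>2 \<le> 1\<^sup>2" .
  qed simp
  have "1 / (4 * \<sigma>) * q \<le> 1 * 1" using q s by (intro mult_mono) auto
  then show "\<bar>\<phi>\<bar> \<le> 1" using phi unfolding q_def[symmetric] by linarith
qed

lemma holomorphic_powr_right_half_plane: "(\<lambda>w. w powr of_real s) holomorphic_on {w. 0 < Re w}"
  by (intro holomorphic_intros) (auto simp: complex_nonpos_Reals_iff)

lemma norm_weight_le: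
  assumes "0 < r" "\<bar>\<phi>\<bar> \<le> 1" "0 \<le> b"
  shows "norm (rcis r \<phi> powr of_real a * (1 + rcis r \<phi>) powr of_real (- b)) \<le> r powr a"
    and "norm (rcis r \<phi> powr of_real a * (1 + rcis r \<phi>) powr of_real (- b)) \<le> r powr (a - b)"
proof -
  define w where "w = rcis r \<phi>"
  have w: "Re w > 0" "norm w = r" using Re_rcis_pos[OF assms(1,2)] assms by (auto simp: w_def)
  have w1: "1 \<le> norm (1 + w)" "r \<le> norm (1 + w)" using right_half_plane_norm[of w] w by auto
  have w0: "w \<noteq> 0" "1 + w \<noteq> 0" using w w1 by auto
  have eq: "norm (w powr of_real a * (1 + w) powr of_real (- b)) = r powr a * norm (1 + w) powr (- b)"
    using w0 w unfolding norm_mult by (simp add: norm_powr_real_powr')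
  have "norm (1 + w) powr (- b) \<le> norm (1 + w) powr 0" using w1 assms by (intro powr_mono) auto
  then have "norm (1 + w) powr (- b) \<le> 1" using w0 by simp
  then have "r powr a * norm (1 + w) powr (- b) \<le> r powr a * 1" by (intro mult_left_mono) auto
  then show "norm (rcis r \<phi> powr of_real a * (1 + rcis r \<phi>) powr of_real (- b)) \<le> r powr a"
    using eq by (simp add: w_def)
  have "norm (1 + w) powr (- b) \<le> r powr (- b)" using w1 assms by (intro powr_mono2') auto
  then have "r powr a * norm (1 + w) powr (- b) \<le> r powr a * r powr (- b)" by (intro mult_left_mono) auto
  also have "\<dots> = r powr (a - b)" by (simp flip: powr_add)
  finally show "norm (rcis r \<phi> powr of_real a * (1 + rcis r \<phi>) powr of_real (- b)) \<le> r powr (a - b)"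
    using eq by (simp add: w_def)
qed

text \<open>
  The symbol of \<open>|D|\<^sup>a \<langle>D\<rangle>\<^sup>-\<^sup>a\<close> tends to \<open>1\<close> at infinity with a rate. Its deviation from \<open>1\<close> multiplies the
  part \<open>exp (- t)\<close> of \<open>k\<^sub>0\<close>, which has no decay in \<open>\<xi>\<close>.
\<close>

lemma
  assumes "0 < r" "\<bar>\<phi>\<bar> \<le> 1" "0 \<le> s"
  defines "z \<equiv> rcis r \<phi> / (1 + rcis r \<phi>)"
  shows norm_quotient_powr_le: "norm (z powr of_real s) \<le> r powr s" "norm (z powr of_real s) \<le> 1"
    and norm_quotient_powr_minus_1_le: "norm (z powr of_real s - 1) \<le> (4 + 2 * s) / r"
proof -
  define w where "w = rcis r \<phi>"
  have w: "Re w > 0" "norm w = r" using Re_rcis_pos[OF assms(1,2)] assms by (auto simp: w_def)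
  have w1: "1 \<le> norm (1 + w)" "r \<le> norm (1 + w)" using right_half_plane_norm[of w] w by auto
  have w0: "w \<noteq> 0" "1 + w \<noteq> 0" using w w1 by auto
  have z: "z = w / (1 + w)" "z \<noteq> 0" using w0 by (simp_all add: z_def w_def)
  have nz: "norm z = r / norm (1 + w)" using z w by (simp add: norm_divide)
  have "r * 1 \<le> r * norm (1 + w)" using w1 assms(1) by (intro mult_left_mono) auto
  then have nz1: "norm z \<le> r" "norm z \<le> 1" unfolding nz using w1 assms(1) w0
    by (auto simp: pos_divide_le_eq)
  have n: "norm (z powr of_real s) = norm z powr s" using z by (simp add: norm_powr_real_powr')
  show "norm (z powr of_real s) \<le> r powr s" unfolding n using nz1 assms by (intro powr_mono2) auto
  show "norm (z powr of_real s) \<le> 1" unfolding n using nz1 assms by (intro powr_le1) auto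
  have zu: "z = 1 + - (1 / (1 + w))" using w0 z by (simp add: field_simps)
  have "s * ln (norm z) \<le> 0" using nz1 z assms by (intro mult_nonneg_nonpos) auto
  then have "norm (z powr of_real s - 1) \<le> (4 + 2 * \<bar>s\<bar>) * norm (- (1 / (1 + w)))"
    using norm_powr_minus_1_le[of "- (1 / (1 + w))" s] z(2) unfolding zu[symmetric] by blast
  also have "norm (- (1 / (1 + w))) \<le> 1 / r" using w1 assms(1) by (simp add: norm_divide frac_le)
  then have "(4 + 2 * \<bar>s\<bar>) * norm (- (1 / (1 + w))) \<le> (4 + 2 * \<bar>s\<bar>) * (1 / r)" by (intro mult_left_mono) auto
  finally show "norm (z powr of_real s - 1) \<le> (4 + 2 * s) / r" using assms by simp
qed

text \<open>
  Interpolation between a Lipschitz bound and a trivial bound.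
\<close>

lemma min_le_powr:
  fixes y :: real
  assumes "0 < y" "0 \<le> e" "e \<le> 1" "z \<le> c * y" "z \<le> c" "0 \<le> c"
  shows "z \<le> c * y powr e"
proof (cases "y \<le> 1")
  case True
  then have "c * y \<le> c * y powr e" using assms by (intro mult_left_mono le_powr) auto
  then show ?thesis using assms by linarith
next
  case False
  then have "1 \<le> y powr e" using assms by (intro ge_one_powr_ge_zero) auto
  then have "c * 1 \<le> c * y powr e" using assms by (intro mult_left_mono) auto
  then show ?thesis using assms by linarith
qed

lemma real_symbol_powr:
  assumes "(\<xi>::real^'n::finite) \<noteq> 0"
  shows "of_real ((norm \<xi>)\<^sup>2) powr of_real s = (of_real (norm \<xi> powr (2 * s)) :: complex)"
proof -
  have "((norm \<xi>)\<^sup>2) powr s = norm \<xi> powr (2 * s)"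
    using assms by (simp add: powr_powr flip: powr_numeral)
  then show ?thesis using powr_of_real[of "(norm \<xi>)\<^sup>2" s] by simp
qed

lemma real_symbol_powr_one_plus:
  "(1 + of_real ((norm (\<xi>::real^'n::finite))\<^sup>2)) powr of_real s = (of_real ((1 + (norm \<xi>)\<^sup>2) powr s) :: complex)"
  using powr_of_real[of "1 + (norm \<xi>)\<^sup>2" s] by (simp add: add_nonneg_nonneg)

lemma exp_le_of_powr_exp_le:
  fixes x q C :: real
  assumes "x powr q * exp (- (x / 16)) \<le> C" "1 \<le> x"
  shows "exp (- (x / 16)) \<le> C * x powr (- q)"
proof -
  have "x powr q * x powr (- q) = 1" using assms by (simp flip: powr_add)
  then have "exp (- (x / 16)) = (x powr q * x powr (- q)) * exp (- (x / 16))" by simp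
  also have "\<dots> = (x powr q * exp (- (x / 16))) * x powr (- q)" by (simp only: mult_ac)
  also have "\<dots> \<le> C * x powr (- q)" using assms by (intro mult_right_mono) auto
  finally show ?thesis .
qed

text \<open>
  With \<open>x = \<tau> \<rho>\<close> one has \<open>t \<rho> = x - \<rho>\<close>, and \<open>\<rho> \<le> 1\<close>.
\<close>

lemma exp_decay_low:
  fixes t \<rho> q C :: real
  assumes C: "\<forall>x\<ge>1. x powr q * exp (- (x / 16)) \<le> C" and t: "t \<ge> 0" and r: "\<rho> \<le> 1" "1 \<le> (1 + t) * \<rho>"
  shows "exp (- (t * \<rho> / 8)) \<le> 2 * C * ((1 + t) * \<rho>) powr (- q)"
proof -
  define x where "x = (1 + t) * \<rho>"
  have x: "x \<ge> 1" using r by (simp add: x_def)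
  have "exp (- (t * \<rho> / 8)) = exp (\<rho> / 8) * exp (- (x / 8))" by (simp add: x_def algebra_simps flip: exp_add)
  also have "\<dots> \<le> 2 * exp (- (x / 16))"
  proof (rule mult_mono)
    have "exp (\<rho> / 8) \<le> exp (1 / 2)" using r by simp
    also have "\<dots> \<le> 2" using exp_half_le2 .
    finally show "exp (\<rho> / 8) \<le> 2" .
  qed (use x in auto)
  also have "exp (- (x / 16)) \<le> C * x powr (- q)" using C x by (intro exp_le_of_powr_exp_le) auto
  finally show ?thesis by (simp add: x_def)
qed

lemma exp_decay_high:
  fixes t q C :: real
  assumes C: "\<forall>x\<ge>1. x powr q * exp (- (x / 16)) \<le> C" and t: "t \<ge> 0"
  shows "exp (- (t / 16)) \<le> 2 * C * (1 + t) powr (- q)"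
proof -
  define x where "x = 1 + t"
  have x: "x \<ge> 1" using t by (simp add: x_def)
  have "exp (- (t / 16)) = exp (1 / 16) * exp (- (x / 16))" by (simp add: x_def field_simps flip: exp_add)
  also have "\<dots> \<le> 2 * exp (- (x / 16))"
  proof (rule mult_right_mono)
    have "exp (1 / 16) \<le> exp (1 / 2 :: real)" by simp
    also have "\<dots> \<le> 2" using exp_half_le2 .
    finally show "exp (1 / 16) \<le> (2::real)" .
  qed simp
  also have "exp (- (x / 16)) \<le> C * x powr (- q)" using C x by (intro exp_le_of_powr_exp_le) auto
  finally show ?thesis by (simp add: x_def)
qed

section \<open>The multiplier of the first datum\<close>

lemma powr_ratio:
  fixes x y s :: real
  shows "0 < x \<Longrightarrow> 0 < y \<Longrightarrow> (x / y) powr s = y powr (- s) * x powr s"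
  by (simp add: powr_divide powr_minus_divide)

lemma one_over_powr: "0 < y \<Longrightarrow> (1 / y) powr (- q) = y powr q" for y q :: real
  by (simp add: powr_divide powr_minus_divide)

text \<open>
  The price of the angle \<open>\<theta> = \<tau>\<^bsup>-s\<^esup> / (4 \<sigma>)\<close> in the sector bound.
\<close>

lemma theta_powr:
  assumes "\<sigma> > 1" "t \<ge> 0"
  shows "(1 / (4 * \<sigma>) * (1 + t) powr (- s)) powr (- real n / 2 - 1)
    = (4 * \<sigma>) powr (real n / 2 + 1) * (1 + t) powr (s * (real n / 2 + 1))"
proof -
  define q where "q = real n / 2 + 1"
  have q: "- real n / 2 - 1 = - q" by (simp add: q_def)
  have "(1 / (4 * \<sigma>) * (1 + t) powr (- s)) powr (- q) = (1 / (4 * \<sigma>)) powr (- q) * ((1 + t) powr (- s)) powr (- q)"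
    by (rule powr_mult)
  also have "(1 / (4 * \<sigma>)) powr (- q) = (4 * \<sigma>) powr q"
    using assms by (intro one_over_powr) auto
  also have "((1 + t) powr (- s)) powr (- q) = (1 + t) powr (s * q)"
    unfolding powr_powr by (simp only: minus_mult_minus)
  finally show ?thesis unfolding q q_def .
qed

text \<open>
  The symbols of \<open>|D|\<^sup>a \<langle>D\<rangle>\<^sup>-\<^sup>b\<close> and of \<open>(-\<Delta>)\<^sup>\<sigma>\<close>.
\<close>

abbreviation riesz_bessel :: "real \<Rightarrow> real \<Rightarrow> 'a::real_normed_vector \<Rightarrow> real" where
  "riesz_bessel a b x \<equiv> norm x powr a * (1 + (norm x)\<^sup>2) powr (- b / 2)"

abbreviation laplace_power :: "real \<Rightarrow> 'a::real_normed_vector \<Rightarrow> complex" where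
  "laplace_power \<sigma> x \<equiv> of_real (norm x powr (2 * \<sigma>))"

text \<open>
  The function \<open>F\<close> is the symbol minus its limit \<open>exp (- t)\<close> at infinity, where it decays like a power of
  \<open>1/\<rho>\<close> and exponentially in time. For \<open>\<rho> \<le> 1\<close> the symbol has size \<open>\<rho>\<^sup>\<alpha> exp (- t \<rho>/8)\<close> with \<open>\<alpha> = a/(2\<sigma>)\<close>, so the
  natural scale is \<open>\<rho> = 1/\<tau>\<close>, and \<open>\<tau>\<^bsup>-\<alpha>\<^esup>\<close> is its value there. If \<open>a = 0\<close> the symbol is \<open>1\<close> at the origin, and the
  deviation from \<open>1\<close> has to be Hoelder continuous there. It only is \<open>\<rho> t\<^sup>2\<close>, that is \<open>\<tau> x\<close> in the scaled variable
  \<open>x = \<tau> \<rho>\<close>; interpolated with exponent \<open>e\<close> this loses \<open>\<tau>\<^sup>e\<close>, and \<open>e \<le> 1/4\<close> is what the exponent of the claim allows.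
\<close>

lemma K0_multiplier:
  fixes \<sigma> a N :: real
  assumes s: "\<sigma> > 1" and a: "a \<ge> 0" and N: "N \<ge> (real CARD('n::finite) - 1) / 2"
  shows "\<exists>C>0. \<forall>t\<ge>0. L1_mult (\<lambda>\<xi>::real^'n.
      of_real (riesz_bessel a a \<xi>) * k0 t (laplace_power \<sigma> \<xi>))
      (C * (1 + t) powr ((2 + N) / 2 - a / (2 * \<sigma>)))"
proof -
  define \<alpha> where "\<alpha> = a / (2 * \<sigma>)"
  have al: "\<alpha> \<ge> 0" "\<sigma> * \<alpha> = a / 2" using s a by (simp_all add: \<alpha>_def)
  define e where "e = min (if a = 0 then 1/4 else \<alpha>) (1 / \<sigma>)"
  have e: "0 < e" "e \<le> 1 / \<sigma>" "a = 0 \<Longrightarrow> e \<le> 1/4" "a \<noteq> 0 \<Longrightarrow> e \<le> \<alpha>"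
    using s a by (auto simp: e_def \<alpha>_def)
  have "1 / \<sigma> \<le> 1" using s by simp
  then have e1: "e \<le> 1" using e by linarith
  \<comment> \<open>the loss \<open>\<tau>\<^sup>h\<close> occurs only for \<open>a = 0\<close>\<close>
  define h where "h = (if a = 0 then e else 0)"
  have h: "0 \<le> h" "h \<le> 1/4" using e by (auto simp: h_def)
  obtain C where C: "C > 0" "\<forall>x\<ge>1. x powr (\<alpha> + e) * exp (- (x / 16)) \<le> C"
    using powr_exp_bounded[of "\<alpha> + e"] by auto
  \<comment> \<open>large enough for each of the bounds by \<open>M\<close> below\<close>
  define K where "K = 7 + (2000 + 2 * a) * C"
  have K: "K \<ge> 7" "K \<ge> 14 * C" "K \<ge> (1064 + 2 * a) * C" "K \<ge> 2 * C"
    using C a by (simp_all add: K_def algebra_simps)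
  define D where "D = (6 / (\<sigma> * e) * 4 powr (CARD('n) / 2 + 1) + 1) * K * (4 * \<sigma>) powr (CARD('n) / 2 + 1)"
  have D: "D > 0" unfolding D_def using K s e by (intro mult_pos_pos add_nonneg_pos) auto
  have "L1_mult (\<lambda>\<xi>::real^'n.
      of_real (riesz_bessel a a \<xi>) * k0 t (laplace_power \<sigma> \<xi>))
      ((D + K) * (1 + t) powr ((2 + N) / 2 - \<alpha>))" if t: "t \<ge> 0" for t
  proof -
    define \<theta> where "\<theta> = 1 / (4 * \<sigma>) * (1 + t) powr (- 1/2)"
    define G where "G w = (w / (1 + w)) powr of_real (a / 2)" for w :: complex
    define F where "F w = G w * k0 t (w powr of_real \<sigma>) - exp (- of_real t)" for w
    define c :: complex where "c = (if a = 0 then 1 else 0) - exp (- of_real t)"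
    define M where "M = K * (1 + t) powr (h - \<alpha>)"
    have th: "0 < \<theta>" using s t by (simp add: \<theta>_def)
    \<comment> \<open>\<open>sector_angle\<close> for the boundary ray itself\<close>
    have "\<bar>\<theta>\<bar> \<le> 1"
      by (rule sector_angle(4)[OF s t]) (simp only: abs_of_pos[OF th], simp only: \<theta>_def)
    then have th1: "\<theta> \<le> 1" by simp
    have KM: "B * (1 + t) powr (- \<alpha>) \<le> M" if "B \<le> K" for B
    proof -
      have "B * (1 + t) powr (- \<alpha>) \<le> K * (1 + t) powr (- \<alpha>)" using that by (intro mult_right_mono) auto
      also have "\<dots> \<le> M" unfolding M_def using h t K by (intro mult_left_mono powr_mono) auto
      finally show ?thesis .
    qed
    have dec: "exp (- (t / 16)) \<le> 2 * C * (1 + t) powr (- (\<alpha> + e))" by (rule exp_decay_high[OF C(2) t])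
    have et: "exp (- t) \<le> exp (- (t / 16))" using t by simp
    have tp: "(1 + t) powr (- (\<alpha> + e)) = (1 + t) powr (- \<alpha>) * (1 + t) powr (- e)" by (simp flip: powr_add)
    have te1: "(1 + t) powr (- e) \<le> 1"
      using powr_mono[of "- e" 0 "1 + t"] t e by simp
    have ne: "norm (exp (- of_real t) :: complex) = exp (- t)" by (simp add: norm_exp_eq_Re)
    have cM: "norm c \<le> M"
    proof (cases "a = 0")
      case True
      have "c = of_real (1 - exp (- t))" using True by (simp add: c_def exp_of_real[symmetric])
      then have "norm c = \<bar>1 - exp (- t)\<bar>" by (simp only: norm_of_real)
      also have "\<dots> \<le> 1" using t by simp
      also have "\<dots> \<le> K * 1" using K by simp
      also have "\<dots> \<le> M" unfolding M_def
      proof (intro mult_left_mono)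
        have "(1 + t) powr 0 \<le> (1 + t) powr (h - \<alpha>)"
          using t e True by (intro powr_mono) (auto simp: h_def \<alpha>_def)
        then show "1 \<le> (1 + t) powr (h - \<alpha>)" using t by simp
      qed (use K in auto)
      finally show ?thesis .
    next
      case False
      have "norm c = exp (- t)" using False ne by (simp add: c_def)
      also have "\<dots> \<le> 2 * C * ((1 + t) powr (- \<alpha>) * 1)"
      proof -
        have "2 * C * (1 + t) powr (- (\<alpha> + e)) \<le> 2 * C * ((1 + t) powr (- \<alpha>) * 1)"
          unfolding tp using te1 C by (intro mult_left_mono) auto
        then show ?thesis using dec et by linarith
      qed
      also have "\<dots> \<le> M" using KM[of "2 * C"] K by simp
      finally show ?thesis .
    qed
    have L: "L1_mult (\<lambda>\<xi>::real^'n. F (of_real ((norm \<xi>)\<^sup>2)))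
       ((6 / (\<sigma> * e) * 4 powr (CARD('n) / 2 + 1) + 1) * M * \<theta> powr (- CARD('n) / 2 - 1))"
    proof (rule L1_mult_of_polar_bounds[OF th th1, where Q="1 + t" and c=c])
      show "F holomorphic_on {w. 0 < Re w}"
      proof -
        have np: "w / (1 + w) \<notin> \<real>\<^sub>\<le>\<^sub>0" if "0 < Re w" for w
        proof -
          have "Re (w / (1 + w)) = (Re w * (1 + Re w) + (Im w)\<^sup>2) / ((1 + Re w)\<^sup>2 + (Im w)\<^sup>2)"
            by (simp add: Re_divide power2_eq_square)
          also have "\<dots> > 0" using that by (intro divide_pos_pos add_pos_nonneg) auto
          finally show ?thesis by (auto simp: complex_nonpos_Reals_iff)
        qed
        have "1 + w \<noteq> 0" if "0 < Re w" for w
          using right_half_plane_one_plus[OF that] by auto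
        with np show ?thesis unfolding F_def G_def
          by (intro holomorphic_intros holomorphic_powr_right_half_plane) auto
      qed
    next
      fix r \<phi> :: real assume r: "0 < r" and phi: "\<bar>\<phi>\<bar> \<le> \<theta>"
      define w where "w = rcis r \<phi>"
      define \<rho> where "\<rho> = r powr \<sigma>"
      note ang = sector_angle[OF s t phi[unfolded \<theta>_def]]
      have rho: "\<rho> > 0" using r by (simp add: \<rho>_def)
      have p: "w powr of_real \<sigma> = rcis \<rho> (\<sigma> * \<phi>)"
        unfolding w_def \<rho>_def using r ang(4) pi_gt3 by (intro rcis_powr) auto
      have ra: "r powr (a / 2) = \<rho> powr \<alpha>" unfolding \<rho>_def powr_powr al(2) ..
      define x where "x = (1 + t) * \<rho>"
      have x: "x > 0" using rho t by (simp add: x_def)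
      have rx: "\<rho> = x / (1 + t)" using t by (simp add: x_def)
      have rxa: "\<rho> powr \<alpha> = (1 + t) powr (- \<alpha>) * x powr \<alpha>"
        unfolding rx using x t by (simp add: powr_ratio)
      have G1: "norm (G w) \<le> \<rho> powr \<alpha>" "norm (G w) \<le> 1" "norm (G w - 1) \<le> (4 + a) / r"
        using norm_quotient_powr_le[OF r ang(4), of "a / 2"] norm_quotient_powr_minus_1_le[OF r ang(4), of "a / 2"] a
        unfolding G_def w_def ra by simp_all
      have w0: "w \<noteq> 0" "1 + w \<noteq> 0"
        using r Re_rcis_pos[OF r ang(4)] right_half_plane_one_plus[of w] by (auto simp: w_def)
      show "norm (F (rcis r \<phi>) - c) \<le> M * ((1 + t) * r powr \<sigma>) powr e" if "(1 + t) * r powr \<sigma> \<le> 1"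
      proof -
        have x1: "x \<le> 1" using that by (simp add: x_def \<rho>_def)
        have "\<rho> + t * \<rho> \<le> 1" using x1 by (simp add: x_def distrib_right)
        then have r1: "\<rho> \<le> 1" using t rho mult_nonneg_nonneg[of t \<rho>] by linarith
        have k: "norm (k0 t (w powr of_real \<sigma>)) \<le> 6"
        proof -
          have "exp (- (t * \<rho> / 8)) \<le> 1" using t rho by simp
          then show ?thesis using norm_k0_low[OF p rho r1 ang(1) t ang(2)] by linarith
        qed
        have "norm (F w - c) \<le> M * x powr e"
        proof (cases "a = 0")
          case True
          have "F w - c = k0 t (w powr of_real \<sigma>) - 1" using True w0 by (simp add: F_def G_def c_def)
          moreover have "norm (k0 t (w powr of_real \<sigma>) - 1) \<le> 7 * ((1 + t)\<^sup>2 * \<rho>) powr e"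
          proof (rule min_le_powr)
            have x1': "(1 + t) * \<rho> \<le> 1" using x1 by (simp add: x_def)
            have "norm (k0 t (w powr of_real \<sigma>) - 1) \<le> 3 * \<rho> * t\<^sup>2"
              by (rule norm_k0_minus_1[OF p rho r1 ang(1) t ang(3)[OF rho x1']])
            also have "\<dots> \<le> 7 * \<rho> * (1 + t)\<^sup>2" using rho t by (intro mult_mono power_mono) auto
            finally show "norm (k0 t (w powr of_real \<sigma>) - 1) \<le> 7 * ((1 + t)\<^sup>2 * \<rho>)" by (simp only: mult_ac)
            show "norm (k0 t (w powr of_real \<sigma>) - 1) \<le> 7"
              using norm_triangle_ineq4[of "k0 t (w powr of_real \<sigma>)" 1] k by simp
          qed (use rho t e e1 in auto)
          moreover have "((1 + t)\<^sup>2 * \<rho>) powr e = (1 + t) powr (h - \<alpha>) * x powr e"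
          proof -
            have "(1 + t)\<^sup>2 * \<rho> = (1 + t) * x" by (simp add: x_def power2_eq_square)
            moreover have "h - \<alpha> = e" using True by (simp add: h_def \<alpha>_def)
            ultimately show ?thesis using t x by (simp add: powr_mult)
          qed
          moreover have "7 * ((1 + t) powr (h - \<alpha>) * x powr e) \<le> K * ((1 + t) powr (h - \<alpha>) * x powr e)"
            using K by (intro mult_right_mono) auto
          ultimately show ?thesis by (simp add: M_def mult.assoc)
        next
          case False
          have "F w - c = G w * k0 t (w powr of_real \<sigma>)" using False by (simp add: F_def c_def)
          then have "norm (F w - c) \<le> \<rho> powr \<alpha> * 6"
            unfolding norm_mult using G1(1) k by (simp add: norm_mult mult_mono)
          also have "\<dots> = (6 * (1 + t) powr (- \<alpha>)) * x powr \<alpha>" by (simp add: rxa)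
          also have "\<dots> \<le> M * x powr e"
            using KM[of 6] K x1 x e(4)[OF False] order.trans[OF norm_ge_zero cM] by (intro mult_mono powr_mono') auto
          finally show ?thesis .
        qed
        then show ?thesis by (simp add: w_def x_def \<rho>_def)
      qed
      show "norm (F (rcis r \<phi>)) \<le> M * ((1 + t) * r powr \<sigma>) powr (- e)" if "1 \<le> (1 + t) * r powr \<sigma>"
      proof -
        have x1: "1 \<le> x" "1 \<le> (1 + t) * \<rho>" using that by (simp_all add: x_def \<rho>_def)
        have xe: "x powr (- (\<alpha> + e)) = x powr (- \<alpha>) * x powr (- e)" by (simp flip: powr_add)
        have xa: "x powr \<alpha> * x powr (- \<alpha>) = 1" using x by (simp flip: powr_add)
        have "norm (F w) \<le> M * x powr (- e)"
        proof (cases "\<rho> \<le> 1")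
          case True
          have "norm (G w * k0 t (w powr of_real \<sigma>)) \<le> \<rho> powr \<alpha> * (6 * exp (- (t * \<rho> / 8)))"
            unfolding norm_mult using G1(1) norm_k0_low(1)[OF p rho True ang(1) t ang(2)] by (intro mult_mono) auto
          also have "\<dots> \<le> \<rho> powr \<alpha> * (6 * (2 * C * x powr (- (\<alpha> + e))))"
            using exp_decay_low[OF C(2) t True x1(2)] by (intro mult_left_mono) (auto simp: x_def)
          also have "\<dots> = 12 * C * (1 + t) powr (- \<alpha>) * x powr (- e) * (x powr \<alpha> * x powr (- \<alpha>))"
            unfolding rxa xe by (simp add: mult_ac)
          finally have 1: "norm (G w * k0 t (w powr of_real \<sigma>)) \<le> 12 * C * (1 + t) powr (- \<alpha>) * x powr (- e)"
            by (simp add: xa)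
          have xt: "x \<le> 1 + t" using True t mult_left_mono[of \<rho> 1 "1 + t"] by (simp add: x_def)
          have "exp (- t) \<le> 2 * C * ((1 + t) powr (- \<alpha>) * (1 + t) powr (- e))" using dec et unfolding tp by linarith
          also have "\<dots> \<le> 2 * C * ((1 + t) powr (- \<alpha>) * x powr (- e))"
            using C xt x e by (intro mult_left_mono powr_mono2') auto
          finally have 2: "exp (- t) \<le> 2 * C * ((1 + t) powr (- \<alpha>) * x powr (- e))" .
          have "norm (F w) \<le> norm (G w * k0 t (w powr of_real \<sigma>)) + exp (- t)"
            unfolding F_def ne[symmetric] by (rule norm_triangle_ineq4)
          also have "\<dots> \<le> 12 * C * (1 + t) powr (- \<alpha>) * x powr (- e) + 2 * C * ((1 + t) powr (- \<alpha>) * x powr (- e))"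
            using 1 2 by (rule add_mono)
          also have "\<dots> = 14 * C * (1 + t) powr (- \<alpha>) * x powr (- e)" by (simp only: mult.assoc)
          also have "\<dots> \<le> M * x powr (- e)" using KM[of "14 * C"] K by (intro mult_right_mono) auto
          finally show ?thesis .
        next
          case False
          then have r1: "1 \<le> \<rho>" by simp
          have ring: "(532 + a) * (P * X) * (2 * C * (Q * R)) = (1064 + 2 * a) * C * Q * X * (P * R)" for P X Q R
            by (simp add: algebra_simps)
          have re: "1 / \<rho> \<le> \<rho> powr (- e)" "1 / r \<le> \<rho> powr (- e)"
          proof -
            have "\<rho> powr (- 1) \<le> \<rho> powr (- e)" using r1 e1 by (intro powr_mono) auto
            then show "1 / \<rho> \<le> \<rho> powr (- e)" using rho by (simp add: powr_minus_divide)
            have "1 / r = \<rho> powr (- (1 / \<sigma>))" using s r unfolding \<rho>_def powr_powr by (simp add: powr_minus_divide)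
            also have "\<dots> \<le> \<rho> powr (- e)" using r1 e by (intro powr_mono) auto
            finally show "1 / r \<le> \<rho> powr (- e)" .
          qed
          have "norm (G w * (k0 t (w powr of_real \<sigma>) - exp (- of_real t))) \<le> 1 * (528 / \<rho> * exp (- (t / 16)))"
            unfolding norm_mult using G1(2) norm_k0_high[OF p r1 ang(1) t] by (intro mult_mono) auto
          also have "\<dots> \<le> 528 * \<rho> powr (- e) * exp (- (t / 16))"
          proof -
            have "528 / \<rho> \<le> 528 * \<rho> powr (- e)" using mult_left_mono[OF re(1), of 528] by simp
            then have "528 / \<rho> * exp (- (t / 16)) \<le> 528 * \<rho> powr (- e) * exp (- (t / 16))"
              by (rule mult_right_mono) simp
            then show ?thesis by simp
          qed
          finally have 1: "norm (G w * (k0 t (w powr of_real \<sigma>) - exp (- of_real t))) \<le> 528 * \<rho> powr (- e) * exp (- (t / 16))" .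
          have "norm ((G w - 1) * exp (- of_real t)) \<le> ((4 + a) * (1 / r)) * exp (- (t / 16))"
            unfolding norm_mult ne using G1(3) et a r by (intro mult_mono) auto
          also have "\<dots> \<le> ((4 + a) * \<rho> powr (- e)) * exp (- (t / 16))"
            using re(2) a by (intro mult_right_mono mult_left_mono) auto
          finally have 2: "norm ((G w - 1) * exp (- of_real t)) \<le> (4 + a) * \<rho> powr (- e) * exp (- (t / 16))" .
          \<comment> \<open>neither factor of the leading term decays alone, so both are compared with their limits\<close>
          have "F w = G w * (k0 t (w powr of_real \<sigma>) - exp (- of_real t)) + (G w - 1) * exp (- of_real t)"
            by (simp add: F_def algebra_simps)
          then have "norm (F w) \<le> norm (G w * (k0 t (w powr of_real \<sigma>) - exp (- of_real t))) + norm ((G w - 1) * exp (- of_real t))"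
            by (simp only: norm_triangle_ineq)
          also have "\<dots> \<le> 528 * \<rho> powr (- e) * exp (- (t / 16)) + (4 + a) * \<rho> powr (- e) * exp (- (t / 16))"
            by (rule add_mono[OF 1 2])
          also have "\<dots> = (532 + a) * \<rho> powr (- e) * exp (- (t / 16))" by (simp add: distrib_right)
          also have "\<dots> \<le> (532 + a) * \<rho> powr (- e) * (2 * C * (1 + t) powr (- (\<alpha> + e)))"
            using dec a by (intro mult_left_mono) auto
          also have "\<rho> powr (- e) = (1 + t) powr e * x powr (- e)"
            unfolding rx using x t by (simp add: powr_ratio)
          also have "(532 + a) * ((1 + t) powr e * x powr (- e)) * (2 * C * (1 + t) powr (- (\<alpha> + e)))
             = (1064 + 2 * a) * C * (1 + t) powr (- \<alpha>) * x powr (- e) * ((1 + t) powr e * (1 + t) powr (- e))"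
            unfolding tp by (rule ring)
          also have "(1 + t) powr e * (1 + t) powr (- e) = 1" using t by (simp flip: powr_add)
          also have "(1064 + 2 * a) * C * (1 + t) powr (- \<alpha>) * x powr (- e) * 1 \<le> M * x powr (- e)"
            unfolding mult_1_right using KM[of "(1064 + 2 * a) * C"] K by (intro mult_right_mono) auto
          finally show ?thesis .
        qed
        then show ?thesis by (simp add: w_def x_def \<rho>_def)
      qed
    qed (use s t e cM in auto)
    have "L1_mult (\<lambda>\<xi>::real^'n. F (of_real ((norm \<xi>)\<^sup>2)) + exp (- of_real t))
       ((6 / (\<sigma> * e) * 4 powr (CARD('n) / 2 + 1) + 1) * M * \<theta> powr (- CARD('n) / 2 - 1) + exp (- t))"
      using L1_mult_add[OF L L1_mult_const[of "exp (- of_real t)"]] unfolding ne .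
    then have "L1_mult (\<lambda>\<xi>::real^'n.
      of_real (riesz_bessel a a \<xi>) * k0 t (laplace_power \<sigma> \<xi>))
       ((6 / (\<sigma> * e) * 4 powr (CARD('n) / 2 + 1) + 1) * M * \<theta> powr (- CARD('n) / 2 - 1) + exp (- t))"
    proof (rule L1_mult_cong)
      show "AE \<xi>::real^'n in lborel. F (of_real ((norm \<xi>)\<^sup>2)) + exp (- of_real t)
        = of_real (riesz_bessel a a \<xi>) * k0 t (laplace_power \<sigma> \<xi>)"
        using AE_lborel_singleton[of "0::real^'n"]
      proof eventually_elim
        case (elim \<xi>)
        have "of_real ((norm \<xi>)\<^sup>2) / (1 + of_real ((norm \<xi>)\<^sup>2)) = (of_real ((norm \<xi>)\<^sup>2 / (1 + (norm \<xi>)\<^sup>2)) :: complex)" by simp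
        then have "G (of_real ((norm \<xi>)\<^sup>2)) = of_real (((norm \<xi>)\<^sup>2 / (1 + (norm \<xi>)\<^sup>2)) powr (a / 2))"
          unfolding G_def by (simp only: powr_of_real[OF divide_nonneg_nonneg[OF zero_le_power2 add_nonneg_nonneg[OF zero_le_one zero_le_power2]]])
        also have "((norm \<xi>)\<^sup>2 / (1 + (norm \<xi>)\<^sup>2)) powr (a / 2) = riesz_bessel a a \<xi>"
        proof -
          have "((norm \<xi>)\<^sup>2) powr (a / 2) = norm \<xi> powr a" using elim by (simp add: powr_powr flip: powr_numeral)
          then show ?thesis using elim powr_ratio[of "(norm \<xi>)\<^sup>2" "1 + (norm \<xi>)\<^sup>2" "a / 2"] by (simp add: add_pos_nonneg mult.commute)
        qed
        finally show ?case unfolding F_def using real_symbol_powr[OF elim, of \<sigma>] by simp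
      qed
    qed
    then show ?thesis
    proof (rule L1_mult_mono)
      define q where "q = real CARD('n) / 2 + 1"
      \<comment> \<open>for odd \<open>n\<close> the room for \<open>h\<close> is exactly \<open>1/4\<close>\<close>
      have le: "h - \<alpha> + 1/2 * q \<le> (2 + N) / 2 - \<alpha>"
        using h N unfolding q_def by (simp add: field_simps)
      have "(6 / (\<sigma> * e) * 4 powr q + 1) * M * \<theta> powr (- CARD('n) / 2 - 1)
        = D * ((1 + t) powr (h - \<alpha>) * (1 + t) powr (1/2 * q))"
        unfolding \<theta>_def M_def D_def q_def using theta_powr[OF s t, of "1/2" "CARD('n)"] by (simp add: mult_ac)
      also have "(1 + t) powr (h - \<alpha>) * (1 + t) powr (1/2 * q) = (1 + t) powr (h - \<alpha> + 1/2 * q)"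
        by (simp flip: powr_add)
      also have "D * (1 + t) powr (h - \<alpha> + 1/2 * q) \<le> D * (1 + t) powr ((2 + N) / 2 - \<alpha>)"
        using D t le by (intro mult_left_mono powr_mono) auto
      finally have 1: "(6 / (\<sigma> * e) * 4 powr q + 1) * M * \<theta> powr (- CARD('n) / 2 - 1) \<le> D * (1 + t) powr ((2 + N) / 2 - \<alpha>)" .
      have "exp (- t) \<le> 2 * C * ((1 + t) powr (- \<alpha>) * (1 + t) powr (- e))" using dec et unfolding tp by linarith
      also have "\<dots> \<le> K * ((1 + t) powr (- \<alpha>) * 1)" using K te1 C by (intro mult_mono) auto
      also have "\<dots> \<le> K * (1 + t) powr ((2 + N) / 2 - \<alpha>)"
        unfolding mult_1_right using K N t by (intro mult_left_mono powr_mono) auto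
      finally show "(6 / (\<sigma> * e) * 4 powr (CARD('n) / 2 + 1) + 1) * M * \<theta> powr (- CARD('n) / 2 - 1) + exp (- t)
        \<le> (D + K) * (1 + t) powr ((2 + N) / 2 - \<alpha>)"
        using 1 unfolding q_def by (simp add: distrib_right)
    qed
  qed
  moreover have "D + K > 0" using D K by simp
  ultimately show ?thesis unfolding \<alpha>_def by blast
qed

section \<open>The multiplier of the second datum\<close>

text \<open>
  The holomorphic extension of \<open>riesz_bessel\<close> in the variable \<open>w = |\<xi>|\<^sup>2\<close>.
\<close>

definition weight :: "real \<Rightarrow> real \<Rightarrow> complex \<Rightarrow> complex" where
  "weight a b w = w powr of_real (a / 2) * (1 + w) powr of_real (- (b / 2))"

lemma holomorphic_weight: "weight a b holomorphic_on {w. 0 < Re w}"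
  unfolding weight_def
  by (intro holomorphic_intros) (use right_half_plane_one_plus in \<open>auto simp: complex_nonpos_Reals_iff\<close>)

lemma weight_of_real:
  assumes "(\<xi>::real^'n::finite) \<noteq> 0"
  shows "weight a b (of_real ((norm \<xi>)\<^sup>2)) = of_real (riesz_bessel a b \<xi>)"
  using real_symbol_powr[OF assms, of "a / 2"] real_symbol_powr_one_plus[of \<xi> "- (b / 2)"]
  by (simp only: weight_def of_real_mult mult_2[symmetric] field_sum_of_halves mult.commute minus_divide_left)
     simp

text \<open>
  The common part of all cases for \<open>k\<^sub>1\<close>: away from low frequencies \<open>|k\<^sub>1|\<close> is at most \<open>5 \<rho>\<^bsup>-1/2\<^esup> exp (- t \<rho>/8)\<close>,
  which at \<open>\<rho> = 1/\<tau>\<close> is the harmless \<open>\<tau>\<^bsup>1/2\<^esup>\<close>, and for \<open>\<rho> \<ge> 1\<close> the factor \<open>1/\<rho>\<close> compensates the weight, of size at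
  most \<open>\<rho>\<^bsup>1/2\<^esup>\<close> since \<open>a - b \<le> \<sigma>\<close>. What happens for \<open>\<rho> \<le> 1/\<tau>\<close> is left as a hypothesis with the largest loss
  \<open>\<tau>\<^bsup>3/4\<^esup>\<close> that the exponent permits. The entire factor \<open>H\<close> is a high-pass filter, or \<open>1\<close>.
\<close>

lemma K1_multiplier_high:
  fixes \<sigma> a N e :: real
  assumes s: "\<sigma> > 1" and a: "a \<ge> 0" and N: "N \<ge> (real CARD('n::finite) - 1) / 2"
    and e: "0 < e" "e \<le> 1 / \<sigma>" "e \<le> 1 / 2"
  defines "\<alpha> \<equiv> a / (2 * \<sigma>)" and "b \<equiv> max (a - \<sigma>) 0"
  shows "\<exists>C>0. \<forall>t\<ge>0. \<forall>H. H holomorphic_on UNIV \<longrightarrow>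
      (\<forall>\<rho> \<psi>. 0 < \<rho> \<longrightarrow> \<bar>\<psi>\<bar> \<le> 1/4 \<longrightarrow> norm (H (rcis \<rho> \<psi>)) \<le> 2) \<longrightarrow>
      (\<forall>\<rho> \<psi>. 0 < \<rho> \<longrightarrow> \<bar>\<psi>\<bar> \<le> 1/4 \<longrightarrow> t * \<psi>\<^sup>2 \<le> 1 \<longrightarrow> (1 + t) * \<rho> \<le> 1 \<longrightarrow>
         \<rho> powr \<alpha> * norm (k1 t (rcis \<rho> \<psi>) * H (rcis \<rho> \<psi>)) \<le> 10 * (1 + t) powr (3/4 - \<alpha>) * ((1 + t) * \<rho>) powr e) \<longrightarrow>
      L1_mult (\<lambda>\<xi>::real^'n. of_real (riesz_bessel a b \<xi>)
         * (k1 t (laplace_power \<sigma> \<xi>) * H (laplace_power \<sigma> \<xi>)))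
      (C * (1 + t) powr (1 + (1 + N) / 2 - \<alpha>))"
proof -
  have al: "\<alpha> \<ge> 0" "\<sigma> * \<alpha> = a / 2" using s a by (simp_all add: \<alpha>_def)
  have b: "b \<ge> 0" "a - b \<le> \<sigma>" using s a by (auto simp: b_def)
  obtain C1 where C1: "C1 > 0" "\<forall>x\<ge>1. x powr (\<alpha> - 1/2 + e) * exp (- (x / 16)) \<le> C1"
    using powr_exp_bounded[of "\<alpha> - 1/2 + e"] by auto
  obtain C2 where C2: "C2 > 0" "\<forall>x\<ge>1. x powr (\<alpha> + e) * exp (- (x / 16)) \<le> C2"
    using powr_exp_bounded[of "\<alpha> + e"] by auto
  define K where "K = 10 + 20 * C1 + 512 * C2"
  have K: "K \<ge> 10" "K \<ge> 20 * C1" "K \<ge> 512 * C2" using C1 C2 by (simp_all add: K_def)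
  define D where "D = (6 / (\<sigma> * e) * 4 powr (CARD('n) / 2 + 1) + 1) * K * (4 * \<sigma>) powr (CARD('n) / 2 + 1)"
  have D: "D > 0" unfolding D_def using K s e by (intro mult_pos_pos add_nonneg_pos) auto
  have "L1_mult (\<lambda>\<xi>::real^'n. of_real (riesz_bessel a b \<xi>)
         * (k1 t (laplace_power \<sigma> \<xi>) * H (laplace_power \<sigma> \<xi>)))
      (D * (1 + t) powr (1 + (1 + N) / 2 - \<alpha>))"
    if t: "t \<ge> 0" and H: "H holomorphic_on UNIV"
      and H2: "\<And>\<rho> \<psi>. 0 < \<rho> \<Longrightarrow> \<bar>\<psi>\<bar> \<le> 1/4 \<Longrightarrow> norm (H (rcis \<rho> \<psi>)) \<le> 2"
      and Hs: "\<And>\<rho> \<psi>. 0 < \<rho> \<Longrightarrow> \<bar>\<psi>\<bar> \<le> 1/4 \<Longrightarrow> t * \<psi>\<^sup>2 \<le> 1 \<Longrightarrow> (1 + t) * \<rho> \<le> 1 \<Longrightarrow>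
         \<rho> powr \<alpha> * norm (k1 t (rcis \<rho> \<psi>) * H (rcis \<rho> \<psi>)) \<le> 10 * (1 + t) powr (3/4 - \<alpha>) * ((1 + t) * \<rho>) powr e"
    for t H
  proof -
    define \<theta> where "\<theta> = 1 / (4 * \<sigma>) * (1 + t) powr (- 1/2)"
    define F where "F w = weight a b w * (k1 t (w powr of_real \<sigma>) * H (w powr of_real \<sigma>))" for w
    define M where "M = K * (1 + t) powr (3/4 - \<alpha>)"
    have th: "0 < \<theta>" using s t by (simp add: \<theta>_def)
    have "\<bar>\<theta>\<bar> \<le> 1"
      by (rule sector_angle(4)[OF s t]) (simp only: abs_of_pos[OF th], simp only: \<theta>_def)
    then have th1: "\<theta> \<le> 1" by simp
    have KM: "B * (1 + t) powr q \<le> M" if "B \<le> K" "q \<le> 3/4 - \<alpha>" for B q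
    proof -
      have "B * (1 + t) powr q \<le> K * (1 + t) powr q" using that by (intro mult_right_mono) auto
      also have "\<dots> \<le> M" unfolding M_def using that t K by (intro mult_left_mono powr_mono) auto
      finally show ?thesis .
    qed
    have L: "L1_mult (\<lambda>\<xi>::real^'n. F (of_real ((norm \<xi>)\<^sup>2)))
       ((6 / (\<sigma> * e) * 4 powr (CARD('n) / 2 + 1) + 1) * M * \<theta> powr (- CARD('n) / 2 - 1))"
    proof (rule L1_mult_of_polar_bounds[OF th th1, where Q="1 + t" and c=0])
      have "(\<lambda>w. H (w powr of_real \<sigma>)) holomorphic_on {w. 0 < Re w}"
        using holomorphic_on_compose_gen[OF holomorphic_powr_right_half_plane H] by (simp add: o_def)
      then show "F holomorphic_on {w. 0 < Re w}"
        unfolding F_def by (intro holomorphic_intros holomorphic_weight holomorphic_powr_right_half_plane)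
      show "norm (0::complex) \<le> M" using K by (simp add: M_def)
      fix r \<phi> :: real assume r: "0 < r" and phi: "\<bar>\<phi>\<bar> \<le> \<theta>"
      define w where "w = rcis r \<phi>"
      define \<rho> where "\<rho> = r powr \<sigma>"
      note ang = sector_angle[OF s t phi[unfolded \<theta>_def]]
      have rho: "\<rho> > 0" using r by (simp add: \<rho>_def)
      have p: "w powr of_real \<sigma> = rcis \<rho> (\<sigma> * \<phi>)"
        unfolding w_def \<rho>_def using r ang(4) pi_gt3 by (intro rcis_powr) auto
      have ra: "r powr (a / 2) = \<rho> powr \<alpha>" unfolding \<rho>_def powr_powr al(2) ..
      define x where "x = (1 + t) * \<rho>"
      have x: "x > 0" using rho t by (simp add: x_def)
      have rx: "\<rho> = x / (1 + t)" using t by (simp add: x_def)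
      have rxq: "\<rho> powr q = (1 + t) powr (- q) * x powr q" for q
        unfolding rx using x t by (simp add: powr_ratio)
      have W: "norm (weight a b w) \<le> \<rho> powr \<alpha>" "norm (weight a b w) \<le> r powr (a / 2 - b / 2)"
        using norm_weight_le[OF r ang(4), of "b / 2" "a / 2"] b unfolding weight_def w_def ra by simp_all
      have H2': "norm (H (w powr of_real \<sigma>)) \<le> 2" unfolding p by (rule H2[OF rho ang(1)])
      show "norm (F (rcis r \<phi>) - 0) \<le> M * ((1 + t) * r powr \<sigma>) powr e" if "(1 + t) * r powr \<sigma> \<le> 1"
      proof -
        have x1: "(1 + t) * \<rho> \<le> 1" using that by (simp add: \<rho>_def)
        have "norm (F w) \<le> \<rho> powr \<alpha> * norm (k1 t (w powr of_real \<sigma>) * H (w powr of_real \<sigma>))"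
          unfolding F_def norm_mult[of "weight a b w"] using W(1) by (intro mult_right_mono) auto
        also have "\<dots> \<le> 10 * (1 + t) powr (3/4 - \<alpha>) * x powr e"
          unfolding p x_def by (rule Hs[OF rho ang(1,2) x1])
        also have "\<dots> \<le> M * x powr e" using KM[of 10 "3/4 - \<alpha>"] K by (intro mult_right_mono) auto
        finally show ?thesis by (simp add: w_def x_def \<rho>_def)
      qed
      show "norm (F (rcis r \<phi>)) \<le> M * ((1 + t) * r powr \<sigma>) powr (- e)" if "1 \<le> (1 + t) * r powr \<sigma>"
      proof -
        have x1: "1 \<le> x" "1 \<le> (1 + t) * \<rho>" using that by (simp_all add: x_def \<rho>_def)
        have "norm (F w) \<le> M * x powr (- e)"
        proof (cases "\<rho> \<le> 1")
          case True
          have "norm (F w) \<le> \<rho> powr \<alpha> * ((5 * \<rho> powr (- 1/2) * exp (- (t * \<rho> / 8))) * 2)"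
            unfolding F_def norm_mult using W(1) H2' norm_k1_low'[OF p rho True ang(1) t ang(2)] by (intro mult_mono) auto
          also have "\<dots> = 10 * (\<rho> powr \<alpha> * \<rho> powr (- 1/2)) * exp (- (t * \<rho> / 8))" by (simp add: mult_ac)
          also have "\<rho> powr \<alpha> * \<rho> powr (- 1/2) = (1 + t) powr (1/2 - \<alpha>) * x powr (\<alpha> - 1/2)"
            using rxq[of "\<alpha> - 1/2"] by (simp flip: powr_add)
          also have "10 * ((1 + t) powr (1/2 - \<alpha>) * x powr (\<alpha> - 1/2)) * exp (- (t * \<rho> / 8))
             \<le> 10 * ((1 + t) powr (1/2 - \<alpha>) * x powr (\<alpha> - 1/2)) * (2 * C1 * x powr (- (\<alpha> - 1/2 + e)))"
            using exp_decay_low[OF C1(2) t True x1(2)] by (intro mult_left_mono) (auto simp: x_def)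
          also have "\<dots> = (20 * C1) * (1 + t) powr (1/2 - \<alpha>) * (x powr (\<alpha> - 1/2) * x powr (- (\<alpha> - 1/2 + e)))"
            by (simp only: mult_ac)
          also have "x powr (\<alpha> - 1/2) * x powr (- (\<alpha> - 1/2 + e)) = x powr (- e)" by (simp flip: powr_add)
          also have "(20 * C1) * (1 + t) powr (1/2 - \<alpha>) * x powr (- e) \<le> M * x powr (- e)"
            using KM[of "20 * C1" "1/2 - \<alpha>"] K by (intro mult_right_mono) auto
          finally show ?thesis .
        next
          case False
          then have r1: "1 \<le> \<rho>" by simp
          have "1 \<le> r"
          proof (rule ccontr)
            assume "\<not> 1 \<le> r"
            then have "r powr \<sigma> \<le> 1" using r s by (intro powr_le1) auto
            then show False using False by (simp add: \<rho>_def)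
          qed
          then have "r powr (a / 2 - b / 2) \<le> r powr (\<sigma> / 2)" using b by (intro powr_mono) auto
          also have "r powr (\<sigma> / 2) = \<rho> powr (1/2)" unfolding \<rho>_def powr_powr by simp
          finally have W2: "norm (weight a b w) \<le> \<rho> powr (1/2)" using W(2) by simp
          have "norm (F w) \<le> \<rho> powr (1/2) * ((128 / \<rho> * exp (- (t / 16))) * 2)"
            unfolding F_def norm_mult using W2 H2' norm_k1_high[OF p r1 ang(1) t] r1 by (intro mult_mono) auto
          also have "\<dots> = 256 * (\<rho> powr (1/2) * (1 / \<rho>)) * exp (- (t / 16))" by simp
          also have "1 / \<rho> = \<rho> powr (- 1)" using rho by (simp add: powr_minus_divide)
          also have "\<rho> powr (1/2) * \<rho> powr (- 1) = \<rho> powr (1/2 + - 1)" by (rule powr_add[symmetric])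
          also have "\<rho> powr (1/2 + - 1) = \<rho> powr (- 1/2)" by simp
          also have "256 * \<rho> powr (- 1/2) * exp (- (t / 16)) \<le> 256 * \<rho> powr (- e) * (2 * C2 * (1 + t) powr (- (\<alpha> + e)))"
            using r1 e exp_decay_high[OF C2(2) t] by (intro mult_mono powr_mono) auto
          also have "\<dots> = (512 * C2) * ((1 + t) powr e * (1 + t) powr (- (\<alpha> + e))) * x powr (- e)"
            unfolding rxq[of "- e"] by simp
          also have "(1 + t) powr e * (1 + t) powr (- (\<alpha> + e)) = (1 + t) powr (- \<alpha>)" by (simp flip: powr_add)
          also have "(512 * C2) * (1 + t) powr (- \<alpha>) * x powr (- e) \<le> M * x powr (- e)"
            using KM[of "512 * C2" "- \<alpha>"] K by (intro mult_right_mono) auto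
          finally show ?thesis .
        qed
        then show ?thesis by (simp add: w_def x_def \<rho>_def)
      qed
    qed (use s t e in auto)
    then have "L1_mult (\<lambda>\<xi>::real^'n. of_real (riesz_bessel a b \<xi>)
         * (k1 t (laplace_power \<sigma> \<xi>) * H (laplace_power \<sigma> \<xi>)))
       ((6 / (\<sigma> * e) * 4 powr (CARD('n) / 2 + 1) + 1) * M * \<theta> powr (- CARD('n) / 2 - 1))"
    proof (rule L1_mult_cong)
      show "AE \<xi>::real^'n in lborel. F (of_real ((norm \<xi>)\<^sup>2)) = of_real (riesz_bessel a b \<xi>)
         * (k1 t (laplace_power \<sigma> \<xi>) * H (laplace_power \<sigma> \<xi>))"
        using AE_lborel_singleton[of "0::real^'n"]
      proof eventually_elim
        case (elim \<xi>)
        show ?case unfolding F_def weight_of_real[OF elim] real_symbol_powr[OF elim] ..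
      qed
    qed
    then show ?thesis
    proof (rule L1_mult_mono)
      define q where "q = real CARD('n) / 2 + 1"
      have le: "3/4 - \<alpha> + 1/2 * q \<le> 1 + (1 + N) / 2 - \<alpha>"
        using N unfolding q_def by (simp add: field_simps)
      have "(6 / (\<sigma> * e) * 4 powr q + 1) * M * \<theta> powr (- CARD('n) / 2 - 1)
        = D * ((1 + t) powr (3/4 - \<alpha>) * (1 + t) powr (1/2 * q))"
        unfolding \<theta>_def M_def D_def q_def using theta_powr[OF s t, of "1/2" "CARD('n)"] by (simp add: mult_ac)
      also have "(1 + t) powr (3/4 - \<alpha>) * (1 + t) powr (1/2 * q) = (1 + t) powr (3/4 - \<alpha> + 1/2 * q)"
        by (simp flip: powr_add)
      also have "D * (1 + t) powr (3/4 - \<alpha> + 1/2 * q) \<le> D * (1 + t) powr (1 + (1 + N) / 2 - \<alpha>)"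
        using D t le by (intro mult_left_mono powr_mono) auto
      finally show "(6 / (\<sigma> * e) * 4 powr (CARD('n) / 2 + 1) + 1) * M * \<theta> powr (- CARD('n) / 2 - 1) \<le> D * (1 + t) powr (1 + (1 + N) / 2 - \<alpha>)"
        unfolding q_def .
    qed
  qed
  then show ?thesis using D by blast
qed

text \<open>
  For \<open>x = \<tau>\<^bsup>7/5\<^esup> \<rho>\<close> and \<open>|\<psi>| \<le> \<tau>\<^bsup>-3/10\<^esup>/4\<close> one has \<open>t \<surd>\<rho> |\<psi>| \<le> \<surd>x/4\<close>, because \<open>1 - 3/10 = 7/10\<close>.
\<close>

lemma sector_angle_wide:
  assumes s: "\<sigma> > 1" and t: "t \<ge> 0" and phi: "\<bar>\<phi>\<bar> \<le> 1 / (4 * \<sigma>) * (1 + t) powr (- 3/10)"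
  shows "\<bar>\<sigma> * \<phi>\<bar> \<le> 1 / 4" "\<bar>\<phi>\<bar> \<le> 1"
    and "0 < \<rho> \<Longrightarrow> t * (sqrt \<rho> * \<bar>\<sigma> * \<phi>\<bar>) \<le> sqrt ((1 + t) powr (7/5) * \<rho>) / 4"
proof -
  define q where "q = (1 + t) powr (- 3/10)"
  have "q \<le> (1 + t) powr 0" unfolding q_def using t by (intro powr_mono) auto
  then have q: "0 < q" "q \<le> 1" using t by (auto simp: q_def)
  have "\<bar>\<sigma> * \<phi>\<bar> = \<sigma> * \<bar>\<phi>\<bar>" using s by (simp add: abs_mult)
  also have "\<dots> \<le> \<sigma> * (1 / (4 * \<sigma>) * q)" using phi s by (intro mult_left_mono) (auto simp: q_def)
  also have "\<dots> = q / 4" using s by simp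
  finally have a: "\<bar>\<sigma> * \<phi>\<bar> \<le> q / 4" .
  then show "\<bar>\<sigma> * \<phi>\<bar> \<le> 1 / 4" using q by linarith
  have "1 / (4 * \<sigma>) * q \<le> 1 * 1" using q s by (intro mult_mono) auto
  then show "\<bar>\<phi>\<bar> \<le> 1" using phi unfolding q_def[symmetric] by linarith
  assume r: "0 < \<rho>"
  have tq: "(1 + t) * q = sqrt ((1 + t) powr (7/5))"
  proof -
    have "(1 + t) * q = (1 + t) powr 1 * (1 + t) powr (- 3/10)" using t by (simp add: q_def)
    also have "\<dots> = (1 + t) powr (1 + - 3/10)" by (rule powr_add[symmetric])
    also have "1 + - 3/10 = 7/5 * (1/2::real)" by simp
    also have "(1 + t) powr (7/5 * (1/2)) = ((1 + t) powr (7/5)) powr (1/2)" by (rule powr_powr[symmetric])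
    also have "\<dots> = sqrt ((1 + t) powr (7/5))" by (simp add: powr_half_sqrt)
    finally show ?thesis .
  qed
  have "t * (sqrt \<rho> * \<bar>\<sigma> * \<phi>\<bar>) \<le> (1 + t) * (sqrt \<rho> * (q / 4))"
    using a t r q by (intro mult_mono) auto
  also have "\<dots> = ((1 + t) * q) * sqrt \<rho> / 4" by simp
  also have "\<dots> = sqrt ((1 + t) powr (7/5) * \<rho>) / 4" unfolding tq by (simp add: real_sqrt_mult)
  finally show "t * (sqrt \<rho> * \<bar>\<sigma> * \<phi>\<bar>) \<le> sqrt ((1 + t) powr (7/5) * \<rho>) / 4" .
qed

lemma norm_exp_minus_le:
  assumes A: "A \<ge> 0" and p: "p = rcis \<rho> \<psi>" "0 < \<rho>" "\<bar>\<psi>\<bar> \<le> 1/4"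
  shows "norm (exp (- of_real A * p)) \<le> exp (- (3/4 * (A * \<rho>)))"
    and "norm (exp (- of_real A * p)) \<le> 1"
    and "norm (exp (- of_real A * p) - 1) \<le> A * \<rho>"
proof -
  have "A * \<rho> * (3/4) \<le> A * \<rho> * cos \<psi>"
    using A p cos_ge_three_quarters[OF p(3)] by (intro mult_left_mono) auto
  then have re: "Re (- of_real A * p) \<le> - (3/4 * (A * \<rho>))" using p by simp
  then show "norm (exp (- of_real A * p)) \<le> exp (- (3/4 * (A * \<rho>)))" by (simp add: norm_exp_eq_Re)
  have "A * \<rho> \<ge> 0" using A p by simp
  then have re0: "Re (- of_real A * p) \<le> 0" using re by linarith
  then show "norm (exp (- of_real A * p)) \<le> 1" by (simp add: norm_exp_eq_Re)
  show "norm (exp (- of_real A * p) - 1) \<le> A * \<rho>"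
    using norm_one_minus_exp_le[OF re0] A p by (simp add: norm_mult)
qed

text \<open>
  The filter \<open>exp (- A p)\<close> with \<open>A = \<tau>\<^bsup>7/5\<^esup>\<close> moves the natural scale down to \<open>\<rho> = 1/A\<close> and beats the growth
  \<open>exp (\<surd>(A \<rho>)/4)\<close> of \<open>k\<^sub>1\<close> on the wider sector. The angle costs only \<open>\<tau>\<^bsup>(3/10)(n/2+1)\<^esup>\<close>, which leaves room for the size
  \<open>t\<close> of \<open>k\<^sub>1\<close>. For \<open>a = 0\<close> the limit at the origin is \<open>t\<close>, with an error \<open>t (\<tau>\<^sup>2 \<rho>)\<^sup>e = t \<tau>\<^bsup>3e/5\<^esup> x\<^sup>e\<close>; with
  \<open>e \<le> 1/12\<close> the loss is at most \<open>\<tau>\<^bsup>1/20\<^esup>\<close>. The total \<open>21/20 + (3/10)(n/2+1)\<close> meets the claimed exponent exactly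
  for \<open>n = 1\<close> and stays below it for larger \<open>n\<close>, whence the values \<open>7/5\<close> and \<open>3/10\<close>.
\<close>

lemma K1_multiplier_low:
  fixes \<sigma> a N :: real
  assumes s: "\<sigma> > 1" and a: "a \<ge> 0" "a \<le> \<sigma> / 2" and N: "N \<ge> (real CARD('n::finite) - 1) / 2"
  defines "\<alpha> \<equiv> a / (2 * \<sigma>)"
  shows "\<exists>C>0. \<forall>t\<ge>0.
      L1_mult (\<lambda>\<xi>::real^'n. of_real (riesz_bessel a 0 \<xi>)
         * (k1 t (laplace_power \<sigma> \<xi>) * exp (- of_real ((1 + t) powr (7/5)) * laplace_power \<sigma> \<xi>)))
      (C * (1 + t) powr (1 + (1 + N) / 2 - \<alpha>))"
proof -
  have al: "\<alpha> \<ge> 0" "\<sigma> * \<alpha> = a / 2" using s a by (simp_all add: \<alpha>_def)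
  \<comment> \<open>\<open>1/12 = (1/20) / (3/5)\<close>\<close>
  define e where "e = min (if a = 0 then 1/12 else \<alpha>) (1 / \<sigma>)"
  have e: "0 < e" "e \<le> 1 / \<sigma>" "a = 0 \<Longrightarrow> e \<le> 1/12" "a \<noteq> 0 \<Longrightarrow> e \<le> \<alpha>"
    using s a by (auto simp: e_def \<alpha>_def)
  have "1 / \<sigma> \<le> 1" using s by simp
  then have e1: "e \<le> 1" using e by linarith
  obtain C where C: "C > 0" "\<forall>x\<ge>1. x powr (\<alpha> + e) * exp (- (x / 16)) \<le> C"
    using powr_exp_bounded[of "\<alpha> + e"] by auto
  define K where "K = 5 + 128 * C"
  have K: "K \<ge> 5" "K \<ge> 128 * C" using C by (simp_all add: K_def)
  define D where "D = (6 / (\<sigma> * e) * 4 powr (CARD('n) / 2 + 1) + 1) * K * (4 * \<sigma>) powr (CARD('n) / 2 + 1)"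
  have D: "D > 0" unfolding D_def using K s e by (intro mult_pos_pos add_nonneg_pos) auto
  have "L1_mult (\<lambda>\<xi>::real^'n. of_real (riesz_bessel a 0 \<xi>)
         * (k1 t (laplace_power \<sigma> \<xi>) * exp (- of_real ((1 + t) powr (7/5)) * laplace_power \<sigma> \<xi>)))
      (D * (1 + t) powr (1 + (1 + N) / 2 - \<alpha>))"
    if t: "t \<ge> 0" for t
  proof -
    \<comment> \<open>cut-off frequency \<open>1/A\<close>, between \<open>1/\<tau>\<^sup>2\<close> and \<open>1/\<tau>\<close>\<close>
    define A where "A = (1 + t) powr (7/5)"
    have "(1 + t) powr 0 \<le> A" unfolding A_def using t by (intro powr_mono) auto
    then have A: "A \<ge> 1" using t by simp
    define \<theta> where "\<theta> = 1 / (4 * \<sigma>) * (1 + t) powr (- 3/10)"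
    define F where "F w = weight a 0 w * (k1 t (w powr of_real \<sigma>) * exp (- of_real A * w powr of_real \<sigma>))" for w
    define c :: complex where "c = (if a = 0 then of_real t else 0)"
    define M where "M = K * (1 + t) powr (21/20 - \<alpha>)"
    have th: "0 < \<theta>" using s t by (simp add: \<theta>_def)
    have "\<bar>\<theta>\<bar> \<le> 1"
      by (rule sector_angle_wide(2)[OF s t]) (simp only: abs_of_pos[OF th], simp only: \<theta>_def)
    then have th1: "\<theta> \<le> 1" by simp
    have KM: "B * (1 + t) powr q \<le> M" if "B \<le> K" "q \<le> 21/20 - \<alpha>" for B q
    proof -
      have "B * (1 + t) powr q \<le> K * (1 + t) powr q" using that by (intro mult_right_mono) auto
      also have "\<dots> \<le> M" unfolding M_def using that t K by (intro mult_left_mono powr_mono) auto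
      finally show ?thesis .
    qed
    have M0: "M \<ge> 0" using K by (simp add: M_def)
    have tau1: "1 + t = (1 + t) powr 1" using t by simp
    have cM: "norm c \<le> M"
    proof (cases "a = 0")
      case True
      have "norm c \<le> 1 * (1 + t) powr 1" using True t by (simp add: c_def)
      also have "\<dots> \<le> M" using True K by (intro KM) (auto simp: \<alpha>_def)
      finally show ?thesis .
    qed (use M0 in \<open>simp add: c_def\<close>)
    have A\<alpha>: "A powr (- \<alpha>) \<le> (1 + t) powr (- \<alpha>)"
      unfolding A_def powr_powr using t al by (intro powr_mono) auto
    have L: "L1_mult (\<lambda>\<xi>::real^'n. F (of_real ((norm \<xi>)\<^sup>2)))
       ((6 / (\<sigma> * e) * 4 powr (CARD('n) / 2 + 1) + 1) * M * \<theta> powr (- CARD('n) / 2 - 1))"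
    proof (rule L1_mult_of_polar_bounds[OF th th1, where Q=A and c=c])
      show "F holomorphic_on {w. 0 < Re w}"
        unfolding F_def by (intro holomorphic_intros holomorphic_weight holomorphic_powr_right_half_plane)
      fix r \<phi> :: real assume r: "0 < r" and phi: "\<bar>\<phi>\<bar> \<le> \<theta>"
      define w where "w = rcis r \<phi>"
      define \<rho> where "\<rho> = r powr \<sigma>"
      note ang = sector_angle_wide[OF s t phi[unfolded \<theta>_def]]
      have rho: "\<rho> > 0" using r by (simp add: \<rho>_def)
      have p: "w powr of_real \<sigma> = rcis \<rho> (\<sigma> * \<phi>)"
        unfolding w_def \<rho>_def using r ang(2) pi_gt3 by (intro rcis_powr) auto
      have ra: "r powr (a / 2) = \<rho> powr \<alpha>" unfolding \<rho>_def powr_powr al(2) ..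
      define x where "x = A * \<rho>"
      have x: "x > 0" using rho A by (simp add: x_def)
      have rx: "\<rho> = x / A" using A by (simp add: x_def)
      have rxa: "\<rho> powr \<alpha> \<le> (1 + t) powr (- \<alpha>) * x powr \<alpha>"
        unfolding rx using x A A\<alpha> by (simp add: powr_ratio mult_right_mono)
      have W: "norm (weight a 0 w) \<le> \<rho> powr \<alpha>"
        using norm_weight_le[OF r ang(2), of "0" "a / 2"] unfolding weight_def w_def ra by simp
      have A0: "A \<ge> 0" using A by simp
      note Ep = norm_exp_minus_le[OF A0 p rho ang(1), folded x_def]
      have tr: "t * (sqrt \<rho> * \<bar>\<sigma> * \<phi>\<bar>) \<le> sqrt x / 4" using ang(3)[OF rho] by (simp add: x_def A_def)
      show "norm (F (rcis r \<phi>) - c) \<le> M * (A * r powr \<sigma>) powr e" if "A * r powr \<sigma> \<le> 1"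
      proof -
        have x1: "x \<le> 1" using that by (simp add: x_def \<rho>_def)
        have "1 * \<rho> \<le> A * \<rho>" using A rho by (intro mult_right_mono) auto
        then have r1: "\<rho> \<le> 1" using x1 by (simp add: x_def)
        have "sqrt x \<le> 1" using x1 by simp
        then have tr1: "t * (sqrt \<rho> * \<bar>\<sigma> * \<phi>\<bar>) \<le> 1" using tr by linarith
        note k = norm_k1_linear[OF p rho r1 ang(1) t tr1] norm_k1_minus_t[OF p rho r1 ang(1) t tr1]
        have "norm (F w - c) \<le> M * x powr e"
        proof (cases "a = 0")
          case False
          have "F w - c = F w" using False by (simp add: c_def)
          moreover have "norm (F w) \<le> \<rho> powr \<alpha> * (3 * t * 1)"
            unfolding F_def norm_mult by (intro mult_mono W k(1) Ep(2)) (use t in auto)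
          ultimately have "norm (F w - c) \<le> \<rho> powr \<alpha> * (3 * t * 1)" by simp
          also have "\<dots> \<le> ((1 + t) powr (- \<alpha>) * x powr \<alpha>) * (3 * (1 + t) powr 1)"
            by (rule mult_mono[OF rxa]) (use t in auto)
          also have "\<dots> = 3 * ((1 + t) powr 1 * (1 + t) powr (- \<alpha>)) * x powr \<alpha>" by (simp only: mult_ac)
          also have "(1 + t) powr 1 * (1 + t) powr (- \<alpha>) = (1 + t) powr (1 + - \<alpha>)" by (rule powr_add[symmetric])
          also have "3 * (1 + t) powr (1 + - \<alpha>) * x powr \<alpha> \<le> M * x powr e"
            using KM[of 3 "1 + - \<alpha>"] K x1 x e(4)[OF False] M0 by (intro mult_mono powr_mono') auto
          finally show ?thesis .
        next
          case True
          have ring: "4 * t * (P * X) + t * (P * X) = 5 * (t * P) * X" for P X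
            by (simp add: algebra_simps)
          have w0: "w \<noteq> 0" "1 + w \<noteq> 0"
            using r Re_rcis_pos[OF r ang(2)] right_half_plane_one_plus[of w] by (auto simp: w_def)
          define k where "k = k1 t (w powr of_real \<sigma>)"
          define E where "E = exp (- of_real A * w powr of_real \<sigma>)"
          have "F w - c = (k - of_real t) * E + of_real t * (E - 1)"
            using True w0 by (simp add: F_def weight_def c_def k_def E_def algebra_simps)
          then have F1: "norm (F w - c) \<le> norm ((k - of_real t) * E) + norm (of_real t * (E - 1))"
            using norm_triangle_ineq by metis
          have F2: "norm ((k - of_real t) * E) \<le> 4 * t * ((1 + t)\<^sup>2 * \<rho>) powr e"
          proof -
            have "norm ((k - of_real t) * E) \<le> norm (k - of_real t) * 1"
              unfolding norm_mult using Ep(2) by (intro mult_left_mono) (auto simp: E_def)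
            moreover have "norm (k - of_real t) \<le> 4 * t * ((1 + t)\<^sup>2 * \<rho>) powr e"
            proof (rule min_le_powr)
              have "t\<^sup>2 + t \<le> (1 + t)\<^sup>2" using t by (simp add: power2_eq_square algebra_simps)
              then have "3 * \<rho> * (t\<^sup>2 + t) * t \<le> 4 * \<rho> * (1 + t)\<^sup>2 * t"
                using rho t by (intro mult_mono) auto
              then show "norm (k - of_real t) \<le> 4 * t * ((1 + t)\<^sup>2 * \<rho>)"
                using k(2) unfolding k_def by (simp add: mult_ac)
              show "norm (k - of_real t) \<le> 4 * t"
                using k(1) norm_triangle_ineq4[of k "of_real t"] t unfolding k_def by simp
            qed (use rho t e e1 in auto)
            ultimately show ?thesis by simp
          qed
          have F3: "norm (of_real t * (E - 1)) \<le> t * x powr e"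
          proof -
            have "norm (E - 1) \<le> x" using Ep(3) by (simp add: E_def)
            also have "x \<le> x powr e" using x x1 e1 by (intro le_powr) auto
            finally show ?thesis using t by (simp add: norm_mult mult_left_mono)
          qed
          have F4: "((1 + t)\<^sup>2 * \<rho>) powr e \<le> (1 + t) powr (1/20) * x powr e"
          proof -
            have "(1 + t)\<^sup>2 = (1 + t) powr (3/5 + 7/5)" using t by (simp add: powr_numeral)
            also have "\<dots> = (1 + t) powr (3/5) * A" unfolding A_def by (rule powr_add)
            finally have "((1 + t)\<^sup>2 * \<rho>) powr e = ((1 + t) powr (3/5) * x) powr e" by (simp add: x_def mult_ac)
            also have "\<dots> = (1 + t) powr (3/5 * e) * x powr e" using x by (simp add: powr_mult powr_powr)
            also have "\<dots> \<le> (1 + t) powr (1/20) * x powr e"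
              using t e(3)[OF True] by (intro mult_right_mono powr_mono) auto
            finally show ?thesis .
          qed
          have "norm (F w - c) \<le> 4 * t * ((1 + t)\<^sup>2 * \<rho>) powr e + t * x powr e"
            using F1 F2 F3 by linarith
          also have "\<dots> \<le> 4 * t * ((1 + t) powr (1/20) * x powr e) + t * ((1 + t) powr (1/20) * x powr e)"
          proof (intro add_mono mult_left_mono F4)
            have "(1 + t) powr 0 \<le> (1 + t) powr (1/20)" using t by (intro powr_mono) auto
            then have "1 * x powr e \<le> (1 + t) powr (1/20) * x powr e" using t by (intro mult_right_mono) auto
            then show "x powr e \<le> (1 + t) powr (1/20) * x powr e" by simp
          qed (use t in auto)
          also have "\<dots> = 5 * (t * (1 + t) powr (1/20)) * x powr e" by (rule ring)
          also have "\<dots> \<le> 5 * ((1 + t) powr 1 * (1 + t) powr (1/20)) * x powr e"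
            using t by (intro mult_left_mono mult_right_mono) auto
          also have "(1 + t) powr 1 * (1 + t) powr (1/20) = (1 + t) powr (1 + 1/20)" by (rule powr_add[symmetric])
          also have "5 * (1 + t) powr (1 + 1/20) * x powr e \<le> M * x powr e"
            using KM[of 5 "1 + 1/20"] K True by (intro mult_right_mono) (auto simp: \<alpha>_def)
          finally show ?thesis .
        qed
        then show ?thesis by (simp add: w_def x_def \<rho>_def)
      qed
      show "norm (F (rcis r \<phi>)) \<le> M * (A * r powr \<sigma>) powr (- e)" if "1 \<le> A * r powr \<sigma>"
      proof -
        have x1: "1 \<le> x" using that by (simp add: x_def \<rho>_def)
        have kE: "norm (k1 t (w powr of_real \<sigma>)) \<le> 128 * (1 + t) * exp (x / 4)"
        proof (cases "\<rho> \<le> 1")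
          case True
          have "sqrt x \<le> x" using x1 by (intro real_le_lsqrt) (auto simp: power2_eq_square)
          then have "t * (sqrt \<rho> * \<bar>\<sigma> * \<phi>\<bar>) \<le> x / 4" using tr by linarith
          then have "t * exp (t * (sqrt \<rho> * \<bar>\<sigma> * \<phi>\<bar>)) \<le> (128 * (1 + t)) * exp (x / 4)"
            using t by (intro mult_mono) auto
          then show ?thesis using norm_k1_growth[OF p rho True ang(1) t] by linarith
        next
          case False
          then have r1: "1 \<le> \<rho>" by simp
          have "128 / \<rho> * exp (- (t / 16)) \<le> (128 * (1 + t)) * exp (x / 4)"
          proof (rule mult_mono)
            have "128 / \<rho> \<le> 128 * 1" using r1 by (simp add: divide_le_eq)
            also have "\<dots> \<le> 128 * (1 + t)" using t by simp
            finally show "128 / \<rho> \<le> 128 * (1 + t)" .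
          qed (use t x in auto)
          then show ?thesis using norm_k1_high[OF p r1 ang(1) t] by linarith
        qed
        have "norm (k1 t (w powr of_real \<sigma>) * exp (- of_real A * w powr of_real \<sigma>))
            \<le> (128 * (1 + t) * exp (x / 4)) * exp (- (3/4 * x))"
          unfolding norm_mult using kE Ep(1) t by (intro mult_mono) auto
        also have "\<dots> = 128 * (1 + t) * exp (- (x / 2))" by (simp add: mult.assoc flip: exp_add)
        also have "\<dots> \<le> 128 * (1 + t) * (C * x powr (- (\<alpha> + e)))"
        proof (intro mult_left_mono)
          have "exp (- (x / 2)) \<le> exp (- (x / 16))" using x by simp
          also have "\<dots> \<le> C * x powr (- (\<alpha> + e))" using C x1 by (intro exp_le_of_powr_exp_le) auto
          finally show "exp (- (x / 2)) \<le> C * x powr (- (\<alpha> + e))" .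
        qed (use t in auto)
        finally have kk: "norm (k1 t (w powr of_real \<sigma>) * exp (- of_real A * w powr of_real \<sigma>))
            \<le> 128 * (1 + t) * (C * x powr (- (\<alpha> + e)))" .
        have "norm (F w) \<le> ((1 + t) powr (- \<alpha>) * x powr \<alpha>) * (128 * (1 + t) powr 1 * (C * x powr (- (\<alpha> + e))))"
          unfolding F_def norm_mult[of "weight a 0 w"] tau1[symmetric] using order.trans[OF W rxa] kk t C
          by (intro mult_mono) auto
        also have "\<dots> = 128 * C * ((1 + t) powr 1 * (1 + t) powr (- \<alpha>)) * (x powr \<alpha> * x powr (- (\<alpha> + e)))"
          by (simp only: mult_ac)
        also have "x powr \<alpha> * x powr (- (\<alpha> + e)) = x powr (- e)" by (simp flip: powr_add)
        also have "(1 + t) powr 1 * (1 + t) powr (- \<alpha>) = (1 + t) powr (1 + - \<alpha>)" by (rule powr_add[symmetric])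
        also have "128 * C * (1 + t) powr (1 + - \<alpha>) * x powr (- e) \<le> M * x powr (- e)"
          using KM[of "128 * C" "1 + - \<alpha>"] K by (intro mult_right_mono) auto
        finally show ?thesis by (simp add: w_def x_def \<rho>_def)
      qed
    qed (use s A e cM in auto)
    then have "L1_mult (\<lambda>\<xi>::real^'n. of_real (riesz_bessel a 0 \<xi>)
         * (k1 t (laplace_power \<sigma> \<xi>) * exp (- of_real A * laplace_power \<sigma> \<xi>)))
       ((6 / (\<sigma> * e) * 4 powr (CARD('n) / 2 + 1) + 1) * M * \<theta> powr (- CARD('n) / 2 - 1))"
    proof (rule L1_mult_cong)
      show "AE \<xi>::real^'n in lborel. F (of_real ((norm \<xi>)\<^sup>2)) = of_real (riesz_bessel a 0 \<xi>)
         * (k1 t (laplace_power \<sigma> \<xi>) * exp (- of_real A * laplace_power \<sigma> \<xi>))"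
        using AE_lborel_singleton[of "0::real^'n"]
      proof eventually_elim
        case (elim \<xi>)
        show ?case unfolding F_def weight_of_real[OF elim] real_symbol_powr[OF elim] ..
      qed
    qed
    then show ?thesis unfolding A_def[symmetric]
    proof (rule L1_mult_mono)
      define q where "q = real CARD('n) / 2 + 1"
      have "real CARD('n) \<ge> 1" by (simp add: Suc_le_eq)
      moreover have "N \<ge> real CARD('n) / 2 - 1/2" using N by (simp add: diff_divide_distrib)
      ultimately have le: "21/20 - \<alpha> + 3/10 * q \<le> 1 + (1 + N) / 2 - \<alpha>"
        unfolding q_def by argo
      have "(6 / (\<sigma> * e) * 4 powr q + 1) * M * \<theta> powr (- CARD('n) / 2 - 1)
        = D * ((1 + t) powr (21/20 - \<alpha>) * (1 + t) powr (3/10 * q))"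
        unfolding \<theta>_def M_def D_def q_def using theta_powr[OF s t, of "3/10" "CARD('n)"] by (simp add: mult_ac)
      also have "(1 + t) powr (21/20 - \<alpha>) * (1 + t) powr (3/10 * q) = (1 + t) powr (21/20 - \<alpha> + 3/10 * q)"
        by (simp flip: powr_add)
      also have "D * (1 + t) powr (21/20 - \<alpha> + 3/10 * q) \<le> D * (1 + t) powr (1 + (1 + N) / 2 - \<alpha>)"
        using D t le by (intro mult_left_mono powr_mono) auto
      finally show "(6 / (\<sigma> * e) * 4 powr (CARD('n) / 2 + 1) + 1) * M * \<theta> powr (- CARD('n) / 2 - 1) \<le> D * (1 + t) powr (1 + (1 + N) / 2 - \<alpha>)"
        unfolding q_def .
    qed
  qed
  then show ?thesis using D by blast
qed

text \<open>
  If \<open>a > \<sigma>/2\<close>, then \<open>\<rho>\<^sup>\<alpha>\<close> with \<open>\<alpha> > 1/4\<close> makes \<open>\<rho>\<^sup>\<alpha> k\<^sub>1\<close> vanish at the origin with the admissible loss: the geometric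
  mean of the bounds \<open>3 \<tau>\<close> and \<open>5 \<rho>\<^bsup>-1/2\<^esup>\<close> for \<open>k\<^sub>1\<close> is \<open>\<tau>\<^bsup>1/2\<^esup> \<rho>\<^bsup>-1/4\<^esup>\<close> up to a constant. Otherwise \<open>k\<^sub>1\<close> is split into
  \<open>k\<^sub>1 exp (- A p)\<close> and \<open>k\<^sub>1 (1 - exp (- A p))\<close>; the second factor of the latter vanishes at the origin and replaces the missing power
  of \<open>\<rho>\<close>.
\<close>

lemma K1_multiplier:
  fixes \<sigma> a N :: real
  assumes s: "\<sigma> > 1" and a: "a \<ge> 0" and N: "N \<ge> (real CARD('n::finite) - 1) / 2"
  defines "\<alpha> \<equiv> a / (2 * \<sigma>)" and "b \<equiv> max (a - \<sigma>) 0"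
  shows "\<exists>C>0. \<forall>t\<ge>0.
      L1_mult (\<lambda>\<xi>::real^'n. of_real (riesz_bessel a b \<xi>) * k1 t (laplace_power \<sigma> \<xi>))
      (C * (1 + t) powr (1 + (1 + N) / 2 - \<alpha>))"
proof (cases "a \<le> \<sigma> / 2")
  case False
  then have al: "\<alpha> > 1/4" using s by (simp add: \<alpha>_def field_simps)
  define e where "e = min (\<alpha> - 1/4) (min (1 / \<sigma>) (1/2))"
  have e: "0 < e" "e \<le> 1 / \<sigma>" "e \<le> 1/2" "e \<le> \<alpha> - 1/4"
    unfolding e_def using al s by (simp_all only: min_less_iff_conj min_le_iff_disj) auto
  obtain C where C: "C > 0" and high: "\<forall>t\<ge>0. \<forall>H. H holomorphic_on UNIV \<longrightarrow>
      (\<forall>\<rho> \<psi>. 0 < \<rho> \<longrightarrow> \<bar>\<psi>\<bar> \<le> 1/4 \<longrightarrow> norm (H (rcis \<rho> \<psi>)) \<le> 2) \<longrightarrow>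
      (\<forall>\<rho> \<psi>. 0 < \<rho> \<longrightarrow> \<bar>\<psi>\<bar> \<le> 1/4 \<longrightarrow> t * \<psi>\<^sup>2 \<le> 1 \<longrightarrow> (1 + t) * \<rho> \<le> 1 \<longrightarrow>
         \<rho> powr \<alpha> * norm (k1 t (rcis \<rho> \<psi>) * H (rcis \<rho> \<psi>)) \<le> 10 * (1 + t) powr (3/4 - \<alpha>) * ((1 + t) * \<rho>) powr e) \<longrightarrow>
      L1_mult (\<lambda>\<xi>::real^'n. of_real (riesz_bessel a b \<xi>)
         * (k1 t (laplace_power \<sigma> \<xi>) * H (laplace_power \<sigma> \<xi>)))
      (C * (1 + t) powr (1 + (1 + N) / 2 - \<alpha>))"
    using K1_multiplier_high[OF s a N e(1-3), folded \<alpha>_def b_def] by - (elim exE conjE, rule that)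
  note mult = high[rule_format]
  have "L1_mult (\<lambda>\<xi>::real^'n. of_real (riesz_bessel a b \<xi>) * k1 t (laplace_power \<sigma> \<xi>))
      (C * (1 + t) powr (1 + (1 + N) / 2 - \<alpha>))" if t: "t \<ge> 0" for t
  proof -
    have "\<rho> powr \<alpha> * norm (k1 t (rcis \<rho> \<psi>)) \<le> 10 * (1 + t) powr (3/4 - \<alpha>) * ((1 + t) * \<rho>) powr e"
      if r: "0 < \<rho>" and psi: "\<bar>\<psi>\<bar> \<le> 1/4" and tp: "t * \<psi>\<^sup>2 \<le> 1" and x1: "(1 + t) * \<rho> \<le> 1" for \<rho> \<psi>
    proof -
      define p where "p = rcis \<rho> \<psi>"
      define x where "x = (1 + t) * \<rho>"
      have x: "x > 0" "x \<le> 1" using r t x1 by (simp_all add: x_def)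
      have "\<rho> + t * \<rho> \<le> 1" using x1 by (simp add: distrib_right)
      then have r1: "\<rho> \<le> 1" using t r mult_nonneg_nonneg[of t \<rho>] by linarith
      have ex: "exp (- (t * \<rho> / 8)) \<le> 1" using t r by simp
      have k3: "norm (k1 t p) \<le> 3 * (1 + t)"
      proof -
        have "3 * t * exp (- (t * \<rho> / 8)) \<le> (3 * (1 + t)) * 1" using ex t by (intro mult_mono) auto
        then show ?thesis using norm_k1_low[OF p_def r r1 psi t tp] by linarith
      qed
      have k5: "norm (k1 t p) \<le> 5 * \<rho> powr (- 1/2)"
      proof -
        have "5 * \<rho> powr (- 1/2) * exp (- (t * \<rho> / 8)) \<le> 5 * \<rho> powr (- 1/2) * 1" using ex by (intro mult_left_mono) auto
        then show ?thesis using norm_k1_low'[OF p_def r r1 psi t tp] by linarith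
      qed
      have "norm (k1 t p) \<le> 5 * ((1 + t) powr (1/2) * \<rho> powr (- 1/4))"
      proof (rule power2_le_imp_le)
        have "(norm (k1 t p))\<^sup>2 \<le> (3 * (1 + t)) * (5 * \<rho> powr (- 1/2))"
          unfolding power2_eq_square using k3 k5 t by (intro mult_mono) auto
        also have "\<dots> = 15 * ((1 + t) * \<rho> powr (- 1/2))" by simp
        also have "\<dots> \<le> 25 * ((1 + t) * \<rho> powr (- 1/2))" using t by (intro mult_right_mono) auto
        also have "(1 + t) * \<rho> powr (- 1/2) = ((1 + t) powr (1/2) * \<rho> powr (- 1/4))\<^sup>2"
        proof -
          have "((1 + t) powr (1/2))\<^sup>2 = 1 + t" using t by (simp add: powr_half_sqrt)
          moreover have "(\<rho> powr (- 1/4))\<^sup>2 = \<rho> powr (- 1/2)" unfolding power2_eq_square by (simp flip: powr_add)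
          ultimately show ?thesis by (simp only: power_mult_distrib)
        qed
        finally show "(norm (k1 t p))\<^sup>2 \<le> (5 * ((1 + t) powr (1/2) * \<rho> powr (- 1/4)))\<^sup>2"
          by (simp only: power_mult_distrib[of 5]) simp
      qed simp
      then have "\<rho> powr \<alpha> * norm (k1 t p) \<le> \<rho> powr \<alpha> * (5 * ((1 + t) powr (1/2) * \<rho> powr (- 1/4)))"
        by (rule mult_left_mono) simp
      also have "\<dots> = 5 * (1 + t) powr (1/2) * (\<rho> powr \<alpha> * \<rho> powr (- 1/4))" by (simp only: mult_ac)
      also have "\<rho> powr \<alpha> * \<rho> powr (- 1/4) = \<rho> powr (\<alpha> + - 1/4)" by (rule powr_add[symmetric])
      also have "\<rho> powr (\<alpha> + - 1/4) = (1 + t) powr (1/4 - \<alpha>) * x powr (\<alpha> - 1/4)"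
      proof -
        have "\<rho> = x / (1 + t)" using t by (simp add: x_def)
        then show ?thesis using x t by (simp add: powr_ratio)
      qed
      also have "5 * (1 + t) powr (1/2) * ((1 + t) powr (1/4 - \<alpha>) * x powr (\<alpha> - 1/4))
        = 5 * ((1 + t) powr (1/2) * (1 + t) powr (1/4 - \<alpha>)) * x powr (\<alpha> - 1/4)" by (simp only: mult.assoc)
      also have "(1 + t) powr (1/2) * (1 + t) powr (1/4 - \<alpha>) = (1 + t) powr (1/2 + (1/4 - \<alpha>))" by (rule powr_add[symmetric])
      also have "1/2 + (1/4 - \<alpha>) = 3/4 - \<alpha>" by simp
      also have "5 * (1 + t) powr (3/4 - \<alpha>) * x powr (\<alpha> - 1/4) \<le> 10 * (1 + t) powr (3/4 - \<alpha>) * x powr e"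
        using x by (intro mult_mono powr_mono'[OF e(4)]) auto
      finally show ?thesis unfolding x_def p_def .
    qed
    then show ?thesis using mult[of t "\<lambda>_. 1"] t by (simp only: mult_1_right norm_one holomorphic_on_const)
  qed
  then show ?thesis using C by blast
next
  case True
  then have b: "b = 0" using s a by (simp add: b_def)
  have al: "\<alpha> \<ge> 0" using s a by (simp add: \<alpha>_def)
  define e where "e = min (1/8) (1 / \<sigma>)"
  have e: "0 < e" "e \<le> 1 / \<sigma>" "e \<le> 1/2" "e \<le> 1/8"
    unfolding e_def using s by (simp_all only: min_less_iff_conj min_le_iff_disj) auto
  obtain C where C: "C > 0" and high: "\<forall>t\<ge>0. \<forall>H. H holomorphic_on UNIV \<longrightarrow>
      (\<forall>\<rho> \<psi>. 0 < \<rho> \<longrightarrow> \<bar>\<psi>\<bar> \<le> 1/4 \<longrightarrow> norm (H (rcis \<rho> \<psi>)) \<le> 2) \<longrightarrow>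
      (\<forall>\<rho> \<psi>. 0 < \<rho> \<longrightarrow> \<bar>\<psi>\<bar> \<le> 1/4 \<longrightarrow> t * \<psi>\<^sup>2 \<le> 1 \<longrightarrow> (1 + t) * \<rho> \<le> 1 \<longrightarrow>
         \<rho> powr \<alpha> * norm (k1 t (rcis \<rho> \<psi>) * H (rcis \<rho> \<psi>)) \<le> 10 * (1 + t) powr (3/4 - \<alpha>) * ((1 + t) * \<rho>) powr e) \<longrightarrow>
      L1_mult (\<lambda>\<xi>::real^'n. of_real (riesz_bessel a b \<xi>)
         * (k1 t (laplace_power \<sigma> \<xi>) * H (laplace_power \<sigma> \<xi>)))
      (C * (1 + t) powr (1 + (1 + N) / 2 - \<alpha>))"
    using K1_multiplier_high[OF s a N e(1-3), folded \<alpha>_def b_def] by - (elim exE conjE, rule that)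
  note mult = high[rule_format]
  obtain C' where C': "C' > 0" and low: "\<forall>t\<ge>0.
      L1_mult (\<lambda>\<xi>::real^'n. of_real (riesz_bessel a 0 \<xi>)
         * (k1 t (laplace_power \<sigma> \<xi>) * exp (- of_real ((1 + t) powr (7/5)) * laplace_power \<sigma> \<xi>)))
      (C' * (1 + t) powr (1 + (1 + N) / 2 - \<alpha>))"
    using K1_multiplier_low[OF s a True N, folded \<alpha>_def] by - (elim exE conjE, rule that)
  have "L1_mult (\<lambda>\<xi>::real^'n. of_real (riesz_bessel a b \<xi>) * k1 t (laplace_power \<sigma> \<xi>))
      ((C + C') * (1 + t) powr (1 + (1 + N) / 2 - \<alpha>))" if t: "t \<ge> 0" for t
  proof -
    define A where "A = (1 + t) powr (7/5)"
    have A: "A \<ge> 0" by (simp add: A_def)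
    have "\<rho> powr \<alpha> * norm (k1 t (rcis \<rho> \<psi>) * (1 - exp (- of_real A * rcis \<rho> \<psi>))) \<le> 10 * (1 + t) powr (3/4 - \<alpha>) * ((1 + t) * \<rho>) powr e"
      if r: "0 < \<rho>" and psi: "\<bar>\<psi>\<bar> \<le> 1/4" and tp: "t * \<psi>\<^sup>2 \<le> 1" and x1: "(1 + t) * \<rho> \<le> 1" for \<rho> \<psi>
    proof -
      define p where "p = rcis \<rho> \<psi>"
      define x where "x = (1 + t) * \<rho>"
      have x: "x > 0" "x \<le> 1" using r t x1 by (simp_all add: x_def)
      have "\<rho> + t * \<rho> \<le> 1" using x1 by (simp add: distrib_right)
      then have r1: "\<rho> \<le> 1" using t r mult_nonneg_nonneg[of t \<rho>] by linarith
      have ex: "exp (- (t * \<rho> / 8)) \<le> 1" using t r by simp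
      have k5: "norm (k1 t p) \<le> 5 * \<rho> powr (- 1/2)"
      proof -
        have "5 * \<rho> powr (- 1/2) * exp (- (t * \<rho> / 8)) \<le> 5 * \<rho> powr (- 1/2) * 1" using ex by (intro mult_left_mono) auto
        then show ?thesis using norm_k1_low'[OF p_def r r1 psi t tp] by linarith
      qed
      note Ep = norm_exp_minus_le[OF A p_def r psi]
      have Ar: "A * \<rho> > 0" using r t by (simp add: A_def)
      \<comment> \<open>interpolation exponent \<open>5/8 = 1/2 + 1/8\<close>: it cancels \<open>\<rho>\<^bsup>-1/2\<^esup>\<close>, leaves \<open>\<rho>\<^bsup>1/8\<^esup>\<close>, and \<open>(7/5)(5/8) = 7/8\<close>\<close>
      have H: "norm (1 - exp (- of_real A * p)) \<le> 2 * (A * \<rho>) powr (5/8)"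
      proof (rule min_le_powr)
        show "norm (1 - exp (- of_real A * p)) \<le> 2 * (A * \<rho>)"
          using Ep(3) Ar by (simp add: norm_minus_commute)
        show "norm (1 - exp (- of_real A * p)) \<le> 2"
          using Ep(2) norm_triangle_ineq4[of 1 "exp (- of_real A * p)"] unfolding norm_one by linarith
      qed (use Ar in auto)
      have "(A * \<rho>) powr (5/8) = A powr (5/8) * \<rho> powr (5/8)" by (rule powr_mult)
      also have "A powr (5/8) = (1 + t) powr (7/8)" unfolding A_def powr_powr by simp
      finally have Arp: "(A * \<rho>) powr (5/8) = (1 + t) powr (7/8) * \<rho> powr (5/8)" .
      have "\<rho> powr \<alpha> * norm (k1 t p * (1 - exp (- of_real A * p))) \<le> \<rho> powr \<alpha> * ((5 * \<rho> powr (- 1/2)) * (2 * (A * \<rho>) powr (5/8)))"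
        unfolding norm_mult by (intro mult_left_mono mult_mono k5 H) auto
      also have "\<dots> = 10 * (1 + t) powr (7/8) * (\<rho> powr \<alpha> * (\<rho> powr (- 1/2) * \<rho> powr (5/8)))"
      proof -
        have "X * ((5 * Y) * (2 * (P * Z))) = 10 * P * (X * (Y * Z))" for X Y Z P :: real by simp
        then show ?thesis unfolding Arp .
      qed
      also have "\<rho> powr (- 1/2) * \<rho> powr (5/8) = \<rho> powr (- 1/2 + 5/8)" by (rule powr_add[symmetric])
      also have "\<rho> powr \<alpha> * \<rho> powr (- 1/2 + 5/8) = \<rho> powr (\<alpha> + (- 1/2 + 5/8))" by (rule powr_add[symmetric])
      also have "\<alpha> + (- 1/2 + 5/8) = \<alpha> + 1/8" by simp
      also have "\<rho> powr (\<alpha> + 1/8) = (1 + t) powr (- (\<alpha> + 1/8)) * x powr (\<alpha> + 1/8)"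
      proof -
        have "\<rho> = x / (1 + t)" using t by (simp add: x_def)
        then show ?thesis using x t by (simp add: powr_ratio)
      qed
      also have "10 * (1 + t) powr (7/8) * ((1 + t) powr (- (\<alpha> + 1/8)) * x powr (\<alpha> + 1/8))
        = 10 * ((1 + t) powr (7/8) * (1 + t) powr (- (\<alpha> + 1/8))) * x powr (\<alpha> + 1/8)" by (simp only: mult.assoc)
      also have "(1 + t) powr (7/8) * (1 + t) powr (- (\<alpha> + 1/8)) = (1 + t) powr (7/8 + - (\<alpha> + 1/8))" by (rule powr_add[symmetric])
      also have "7/8 + - (\<alpha> + 1/8) = 3/4 - \<alpha>" by simp
      also have "10 * (1 + t) powr (3/4 - \<alpha>) * x powr (\<alpha> + 1/8) \<le> 10 * (1 + t) powr (3/4 - \<alpha>) * x powr e"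
        using x e(4) al by (intro mult_left_mono powr_mono') auto
      finally show ?thesis unfolding x_def p_def .
    qed
    moreover have "norm (1 - exp (- of_real A * rcis \<rho> \<psi>)) \<le> 2" if "0 < \<rho>" "\<bar>\<psi>\<bar> \<le> 1/4" for \<rho> \<psi>
      using norm_exp_minus_le(2)[OF A refl that] norm_triangle_ineq4[of 1 "exp (- of_real A * rcis \<rho> \<psi>)"] unfolding norm_one by linarith
    moreover have "(\<lambda>p. 1 - exp (- of_real A * p)) holomorphic_on UNIV" by (intro holomorphic_intros)
    ultimately have "L1_mult (\<lambda>\<xi>::real^'n. of_real (riesz_bessel a b \<xi>)
         * (k1 t (laplace_power \<sigma> \<xi>) * (1 - exp (- of_real A * laplace_power \<sigma> \<xi>))))
      (C * (1 + t) powr (1 + (1 + N) / 2 - \<alpha>))"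
      by (intro mult[of t "\<lambda>p. 1 - exp (- of_real A * p)"] t) blast+
    from L1_mult_add[OF this low[rule_format, OF t, folded A_def b]]
    have "L1_mult (\<lambda>\<xi>::real^'n. of_real (riesz_bessel a b \<xi>) * k1 t (laplace_power \<sigma> \<xi>))
      (C * (1 + t) powr (1 + (1 + N) / 2 - \<alpha>) + C' * (1 + t) powr (1 + (1 + N) / 2 - \<alpha>))"
    proof (rule L1_mult_cong)
      have "X * (Y * (1 - Z)) + X * (Y * Z) = X * Y" for X Y Z :: complex by (simp add: algebra_simps)
      then show "AE \<xi>::real^'n in lborel. of_real (riesz_bessel a b \<xi>)
         * (k1 t (laplace_power \<sigma> \<xi>) * (1 - exp (- of_real A * laplace_power \<sigma> \<xi>)))
         + of_real (riesz_bessel a b \<xi>)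
         * (k1 t (laplace_power \<sigma> \<xi>) * exp (- of_real A * laplace_power \<sigma> \<xi>))
         = of_real (riesz_bessel a b \<xi>) * k1 t (laplace_power \<sigma> \<xi>)"
        by (intro AE_I2)
    qed
    then show ?thesis by (simp only: distrib_right)
  qed
  moreover have "C + C' > 0" using C C' by simp
  ultimately show ?thesis by blast
qed

section \<open>The solution and the estimates\<close>

text \<open>
  \<open>lambda1\<close> and \<open>lambda2\<close> are the roots \<open>- p/2 \<plusminus> d\<close> for \<open>p = |\<xi>|\<^bsup>2\<sigma>\<^esup>\<close> and \<open>d\<close> half the root of the discriminant.
\<close>

lemma discr_root_square:
  "(discr_root \<sigma> \<xi> / 2)\<^sup>2 = (laplace_power \<sigma> \<xi>)\<^sup>2 / 4 - laplace_power \<sigma> \<xi>"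
proof -
  have "norm \<xi> powr (4 * \<sigma>) = (norm \<xi> powr (2 * \<sigma>))\<^sup>2"
    unfolding power2_eq_square by (simp flip: powr_add)
  then show ?thesis by (simp add: discr_root_def power_divide diff_divide_distrib)
qed

lemma
  shows K1_eq: "K1 \<sigma> t \<xi> = k1 t (laplace_power \<sigma> \<xi>)"
    and K0_eq: "K0 \<sigma> t \<xi> = k0 t (laplace_power \<sigma> \<xi>)"
proof -
  define p d where "p = laplace_power \<sigma> \<xi>" and "d = discr_root \<sigma> \<xi> / 2"
  have d: "d\<^sup>2 = p\<^sup>2 / 4 - p" unfolding p_def d_def by (rule discr_root_square)
  have l: "lambda1 \<sigma> \<xi> = - p / 2 + d" "lambda2 \<sigma> \<xi> = - p / 2 - d"
    by (simp_all add: lambda1_def lambda2_def p_def d_def diff_divide_distrib add_divide_distrib)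
  have k: "K1 \<sigma> t \<xi> = k1 t p \<and> K0 \<sigma> t \<xi> = k0 t p"
  proof (cases "d = 0")
    case True
    then show ?thesis
      unfolding K1_def K0_def Let_def l k0_eq'[OF d] k1_double_root[OF d True] by (simp add: algebra_simps)
  next
    case False
    have diff: "(- p / 2 + d) - (- p / 2 - d) = 2 * d" by simp
    then have ne: "- p / 2 + d \<noteq> - p / 2 - d"
      using False by (metis right_minus_eq mult_eq_0_iff zero_neq_numeral)
    define x y where "x = exp ((- p / 2 + d) * of_real t)" and "y = exp ((- p / 2 - d) * of_real t)"
    have k: "2 * d * k1 t p = x - y" unfolding x_def y_def by (rule k1_mult_root[OF d])
    have K1: "K1 \<sigma> t \<xi> = (x - y) / (2 * d)"
      unfolding K1_def Let_def l if_not_P[OF ne] diff x_def y_def ..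
    have K0: "K0 \<sigma> t \<xi> = ((- p / 2 + d) * y - (- p / 2 - d) * x) / (2 * d)"
      unfolding K0_def Let_def l if_not_P[OF ne] diff x_def y_def ..
    have y: "y = x - 2 * d * k1 t p" using k by simp
    have "(- p / 2 + d) * y - (- p / 2 - d) * x = (2 * d) * (x - (- p / 2 + d) * k1 t p)"
      unfolding y by (simp add: algebra_simps)
    then show ?thesis
      unfolding K0 K1 k0_eq'[OF d] x_def[symmetric] k[symmetric] using False by simp
  qed
  then show "K1 \<sigma> t \<xi> = k1 t (laplace_power \<sigma> \<xi>)" "K0 \<sigma> t \<xi> = k0 t (laplace_power \<sigma> \<xi>)"
    unfolding p_def by simp_all
qed

text \<open>
  At \<open>t = 0\<close> the derivative is one-sided; it exists because \<open>k\<^sub>0\<close> and \<open>k\<^sub>1\<close> are differentiable in \<open>t\<close> on the whole line.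
\<close>

lemma solution_t_hat_eq:
  assumes "t \<ge> 0"
  shows "solution_t_hat \<sigma> u0 u1 t \<xi> = - (laplace_power \<sigma> \<xi> * K1 \<sigma> t \<xi>) * fourier u0 \<xi>
    + (K0 \<sigma> t \<xi> + - (laplace_power \<sigma> \<xi> * K1 \<sigma> t \<xi>)) * fourier u1 \<xi>"
proof -
  note d = discr_root_square[of \<sigma> \<xi>]
  have "((\<lambda>s. solution_hat \<sigma> u0 u1 s \<xi>) has_vector_derivative
      - laplace_power \<sigma> \<xi> * K1 \<sigma> t \<xi> * fourier u0 \<xi>
      + (K0 \<sigma> t \<xi> - laplace_power \<sigma> \<xi> * K1 \<sigma> t \<xi>) * fourier u1 \<xi>) (at t within {0..})"
    unfolding solution_hat_def K0_eq K1_eq by (intro has_vector_derivative_add has_vector_derivative_mult_left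
      has_vector_derivative_at_within[OF k0_derivative[OF d]] has_vector_derivative_at_within[OF k1_derivative[OF d]])
  moreover have "at t within {0..} \<noteq> bot"
  proof -
    have "at_right t \<le> at t within {0..}" using assms by (intro at_le) auto
    then show ?thesis using trivial_limit_at_right_real[of t] bot.extremum_unique by (metis trivial_limit_def)
  qed
  ultimately have "solution_t_hat \<sigma> u0 u1 t \<xi> = - laplace_power \<sigma> \<xi> * K1 \<sigma> t \<xi> * fourier u0 \<xi>
      + (K0 \<sigma> t \<xi> - laplace_power \<sigma> \<xi> * K1 \<sigma> t \<xi>) * fourier u1 \<xi>"
    unfolding solution_t_hat_def by (rule vector_derivative_within[rotated])
  then show ?thesis by simp
qed

text \<open>
  The operators with symbols \<open>m t\<close> map \<open>\<langle>D\<rangle>\<^sup>-\<^sup>b L\<^sup>1\<close> into \<open>|D|\<^sup>-\<^sup>a L\<^sup>1\<close> with norm of order \<open>\<tau>\<^sup>q\<close>.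
\<close>

definition symbol_bound :: "real \<Rightarrow> real \<Rightarrow> (real \<Rightarrow> real^'n::finite \<Rightarrow> complex) \<Rightarrow> real \<Rightarrow> bool" where
  "symbol_bound a b m q \<longleftrightarrow> (\<exists>C>0. \<forall>t\<ge>0.
     L1_mult (\<lambda>\<xi>. of_real (riesz_bessel a b \<xi>) * m t \<xi>) (C * (1 + t) powr q))"

lemma symbol_bound_mono:
  assumes m: "symbol_bound a b m q" and b: "b \<le> b'" and q: "q \<le> q'"
  shows "symbol_bound a b' m q'"
proof -
  obtain C where C: "C > 0" "\<And>t. t \<ge> 0 \<Longrightarrow>
     L1_mult (\<lambda>\<xi>. of_real (riesz_bessel a b \<xi>) * m t \<xi>) (C * (1 + t) powr q)"
    using m unfolding symbol_bound_def by blast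
  obtain D where D: "D > 0" "L1_mult (\<lambda>\<xi>::real^'a. of_real ((1 + (norm \<xi>)\<^sup>2) powr (- (b' - b) / 2))) D"
    using L1_mult_bessel[of "b' - b"] b by auto
  have "L1_mult (\<lambda>\<xi>. of_real (riesz_bessel a b' \<xi>) * m t \<xi>) (D * C * (1 + t) powr q')"
    if t: "t \<ge> 0" for t
  proof -
    have "(1 + t) powr q \<le> (1 + t) powr q'" using t q by (intro powr_mono) auto
    then have le: "D * (C * (1 + t) powr q) \<le> D * C * (1 + t) powr q'"
      using C D by simp
    have w: "(1 + (norm \<xi>)\<^sup>2) powr (- b' / 2) = (1 + (norm \<xi>)\<^sup>2) powr (- (b' - b) / 2) * (1 + (norm \<xi>)\<^sup>2) powr (- b / 2)"
      for \<xi> :: "real^'a"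
      unfolding powr_add[symmetric] by (simp add: diff_divide_distrib)
    have "of_real ((1 + (norm \<xi>)\<^sup>2) powr (- (b' - b) / 2)) * (of_real (riesz_bessel a b \<xi>) * m t \<xi>)
        = of_real (riesz_bessel a b' \<xi>) * m t \<xi>" for \<xi> :: "real^'a"
      by (simp only: w of_real_mult mult_ac)
    then show ?thesis
      by (intro L1_mult_cong[OF L1_mult_mono[OF L1_mult_mult[OF D(2) C(2)[OF t] less_imp_le[OF D(1)]] le]] AE_I2)
  qed
  then show ?thesis unfolding symbol_bound_def using mult_pos_pos[OF D(1) C(1)] by blast
qed

lemma symbol_bound_add:
  assumes "symbol_bound a b m q" and "symbol_bound a b m' q"
  shows "symbol_bound a b (\<lambda>t \<xi>. m t \<xi> + m' t \<xi>) q"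
proof -
  obtain C C' where C: "C > 0" "C' > 0" and
     m: "\<And>t. t \<ge> 0 \<Longrightarrow> L1_mult (\<lambda>\<xi>. of_real (riesz_bessel a b \<xi>) * m t \<xi>) (C * (1 + t) powr q)"
     "\<And>t. t \<ge> 0 \<Longrightarrow> L1_mult (\<lambda>\<xi>. of_real (riesz_bessel a b \<xi>) * m' t \<xi>) (C' * (1 + t) powr q)"
    using assms unfolding symbol_bound_def by blast
  show ?thesis unfolding symbol_bound_def distrib_left
  proof (intro exI[of _ "C + C'"] conjI allI impI)
    show "L1_mult (\<lambda>\<xi>. of_real (riesz_bessel a b \<xi>) * m t \<xi>
        + of_real (riesz_bessel a b \<xi>) * m' t \<xi>) ((C + C') * (1 + t) powr q)" if "t \<ge> 0" for t
      unfolding distrib_right by (rule L1_mult_add[OF m[OF that]])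
  qed (use C in simp)
qed

context
  fixes \<sigma> N a :: real
  assumes \<sigma>: "\<sigma> > 1" and a: "a \<ge> 0" and N: "N \<ge> (real CARD('n::finite) - 1) / 2"
begin

lemma symbol_bound_K0:
  assumes "a \<le> b"
  shows "symbol_bound a b (\<lambda>t \<xi>::real^'n. K0 \<sigma> t \<xi>) ((2 + N) / 2 - a / (2 * \<sigma>))"
  by (rule symbol_bound_mono[OF _ assms order_refl], unfold symbol_bound_def K0_eq, rule K0_multiplier[OF \<sigma> a N])

lemma symbol_bound_K1:
  assumes "max (a - \<sigma>) 0 \<le> b"
  shows "symbol_bound a b (\<lambda>t \<xi>::real^'n. K1 \<sigma> t \<xi>) (1 + (1 + N) / 2 - a / (2 * \<sigma>))"
  by (rule symbol_bound_mono[OF _ assms order_refl], unfold symbol_bound_def K1_eq, rule K1_multiplier[OF \<sigma> a N])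

end

text \<open>
  The factor \<open>|\<xi>|\<^bsup>2\<sigma>\<^esup>\<close> is absorbed into \<open>|\<xi>|\<^sup>a\<close>, which improves the exponent by \<open>1\<close>.
\<close>

lemma symbol_bound_laplace_K1:
  assumes \<sigma>: "\<sigma> > 1" and a: "a \<ge> 0" and N: "N \<ge> (real CARD('n::finite) - 1) / 2" and b: "a + \<sigma> \<le> b"
  shows "symbol_bound a b (\<lambda>t \<xi>::real^'n. - (laplace_power \<sigma> \<xi> * K1 \<sigma> t \<xi>)) ((1 + N) / 2 - a / (2 * \<sigma>))"
proof -
  have "symbol_bound (a + 2 * \<sigma>) b (\<lambda>t \<xi>::real^'n. K1 \<sigma> t \<xi>) (1 + (1 + N) / 2 - (a + 2 * \<sigma>) / (2 * \<sigma>))"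
    by (rule symbol_bound_K1[OF \<sigma> _ N]) (use \<sigma> a b in auto)
  moreover have "1 + (1 + N) / 2 - (a + 2 * \<sigma>) / (2 * \<sigma>) = (1 + N) / 2 - a / (2 * \<sigma>)"
    using \<sigma> by (simp add: add_divide_distrib)
  ultimately obtain C where C: "C > 0" "\<And>t. t \<ge> 0 \<Longrightarrow> L1_mult (\<lambda>\<xi>::real^'n.
      of_real (riesz_bessel (a + 2 * \<sigma>) b \<xi>) * K1 \<sigma> t \<xi>) (C * (1 + t) powr ((1 + N) / 2 - a / (2 * \<sigma>)))"
    unfolding symbol_bound_def by auto
  have "L1_mult (\<lambda>\<xi>::real^'n. of_real (riesz_bessel a b \<xi>)
       * - (laplace_power \<sigma> \<xi> * K1 \<sigma> t \<xi>)) (C * (1 + t) powr ((1 + N) / 2 - a / (2 * \<sigma>)))" if "t \<ge> 0" for t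
    using L1_mult_mult[OF L1_mult_const[of "- 1"] C(2)[OF that]] by (simp add: powr_add mult_ac)
  then show ?thesis unfolding symbol_bound_def using C(1) by blast
qed

text \<open>
  \<open>u = \<langle>D\<rangle>\<^sup>-\<^sup>s U\<close> with \<open>U\<close> in \<open>L\<^sup>1\<close>, whose norm is that of \<open>u\<close> in \<open>H1 s\<close>.
\<close>

lemma multiplier_on_H1:
  fixes u :: "real^'n::finite \<Rightarrow> complex"
  assumes u: "u \<in> H1 s"
    and m: "L1_mult (\<lambda>\<xi>. of_real (riesz_bessel a s \<xi>) * m \<xi>) B"
  shows "\<exists>g. has_fourier g (\<lambda>\<xi>. of_real (norm \<xi> powr a) * (m \<xi> * fourier u \<xi>)) \<and> L1_norm g \<le> B * H1_norm s u"
proof -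
  define U where "U = multiplier (jap_symbol s) u"
  obtain f where "has_fourier f (\<lambda>\<xi>. of_real (jap_symbol s \<xi>) * fourier u \<xi>)"
    using u unfolding H1_def multiplier_dom_def fourier_L1_def by blast
  then have U: "has_fourier U (\<lambda>\<xi>. of_real (jap_symbol s \<xi>) * fourier u \<xi>)"
    unfolding U_def multiplier_def by (rule has_fourier_inv_fourier)
  then obtain g where g: "has_fourier g (\<lambda>\<xi>. of_real (riesz_bessel a s \<xi>) * m \<xi> * fourier U \<xi>)"
      "L1_norm g \<le> B * L1_norm U"
    using m unfolding L1_mult_def has_fourier_def by blast
  have "has_fourier g (\<lambda>\<xi>. of_real (norm \<xi> powr a) * (m \<xi> * fourier u \<xi>))"
  proof (rule has_fourier_cong[OF g(1)])
    have c: "(1 + (norm \<xi>)\<^sup>2) powr (- s / 2) * (1 + (norm \<xi>)\<^sup>2) powr (s / 2) = 1" for \<xi> :: "real^'n"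
      unfolding powr_add[symmetric] using add_pos_nonneg[OF zero_less_one zero_le_power2[of "norm \<xi>"]] by simp
    have ring: "complex_of_real (x * y) * k * (of_real z * v) = of_real (y * z) * (of_real x * (k * v))" for x y z k v
      by simp
    from U have "AE \<xi> in lborel. fourier U \<xi> = of_real (jap_symbol s \<xi>) * fourier u \<xi>" by (simp add: has_fourier_def)
    then show "AE \<xi> in lborel. of_real (riesz_bessel a s \<xi>) * m \<xi> * fourier U \<xi>
        = of_real (norm \<xi> powr a) * (m \<xi> * fourier u \<xi>)"
      by eventually_elim (simp only: jap_symbol_def ring c of_real_1 mult_1_left)
  qed
  then show ?thesis using g(2) unfolding H1_norm_def U_def by blast
qed

text \<open>
  The bounds with \<open>0\<close> in place of \<open>a\<close> show that the solution itself is in \<open>L\<^sup>1\<close>.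
\<close>

lemma estimate_of_symbol_bounds:
  fixes w :: "(real^'n::finite \<Rightarrow> complex) \<Rightarrow> (real^'n \<Rightarrow> complex) \<Rightarrow> real \<Rightarrow> real^'n \<Rightarrow> complex"
  assumes w: "\<And>u0 u1 t \<xi>. t \<ge> 0 \<Longrightarrow> w u0 u1 t \<xi> = m0 t \<xi> * fourier u0 \<xi> + m1 t \<xi> * fourier u1 \<xi>"
    and m: "symbol_bound a s0 m0 q0" "symbol_bound a s1 m1 q1"
    and m': "symbol_bound 0 s0 m0 r0" "symbol_bound 0 s1 m1 r1"
  shows "\<exists>C>0. \<forall>u0 u1. u0 \<in> H1 s0 \<longrightarrow> u1 \<in> H1 s1 \<longrightarrow> (\<forall>t\<ge>0.
     w u0 u1 t \<in> fourier_L1 \<and> inv_fourier (w u0 u1 t) \<in> multiplier_dom (abs_symbol a) \<and>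
     L1_norm (multiplier (abs_symbol a) (inv_fourier (w u0 u1 t)))
       \<le> C * ((1 + t) powr q0 * H1_norm s0 u0 + (1 + t) powr q1 * H1_norm s1 u1))"
proof -
  obtain C0 C1 where C: "C0 > 0" "C1 > 0" and
     L: "\<And>t. t \<ge> 0 \<Longrightarrow> L1_mult (\<lambda>\<xi>. of_real (riesz_bessel a s0 \<xi>) * m0 t \<xi>) (C0 * (1 + t) powr q0)"
     "\<And>t. t \<ge> 0 \<Longrightarrow> L1_mult (\<lambda>\<xi>. of_real (riesz_bessel a s1 \<xi>) * m1 t \<xi>) (C1 * (1 + t) powr q1)"
    using m unfolding symbol_bound_def by blast
  obtain D0 D1 where
     L': "\<And>t. t \<ge> 0 \<Longrightarrow> L1_mult (\<lambda>\<xi>. of_real (riesz_bessel 0 s0 \<xi>) * m0 t \<xi>) (D0 * (1 + t) powr r0)"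
     "\<And>t. t \<ge> 0 \<Longrightarrow> L1_mult (\<lambda>\<xi>. of_real (riesz_bessel 0 s1 \<xi>) * m1 t \<xi>) (D1 * (1 + t) powr r1)"
    using m' unfolding symbol_bound_def by blast
  have "w u0 u1 t \<in> fourier_L1 \<and> inv_fourier (w u0 u1 t) \<in> multiplier_dom (abs_symbol a) \<and>
     L1_norm (multiplier (abs_symbol a) (inv_fourier (w u0 u1 t)))
       \<le> (C0 + C1) * ((1 + t) powr q0 * H1_norm s0 u0 + (1 + t) powr q1 * H1_norm s1 u1)"
    if u: "u0 \<in> H1 s0" "u1 \<in> H1 s1" and t: "t \<ge> 0" for u0 u1 t
  proof -
    obtain g0 g1 where g: "has_fourier g0 (\<lambda>\<xi>. of_real (norm \<xi> powr a) * (m0 t \<xi> * fourier u0 \<xi>))"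
        "L1_norm g0 \<le> C0 * (1 + t) powr q0 * H1_norm s0 u0"
        "has_fourier g1 (\<lambda>\<xi>. of_real (norm \<xi> powr a) * (m1 t \<xi> * fourier u1 \<xi>))"
        "L1_norm g1 \<le> C1 * (1 + t) powr q1 * H1_norm s1 u1"
      using multiplier_on_H1[OF u(1) L(1)[OF t]] multiplier_on_H1[OF u(2) L(2)[OF t]] by blast
    obtain h0 h1 where h: "has_fourier h0 (\<lambda>\<xi>. of_real (norm \<xi> powr 0) * (m0 t \<xi> * fourier u0 \<xi>))"
        "has_fourier h1 (\<lambda>\<xi>. of_real (norm \<xi> powr 0) * (m1 t \<xi> * fourier u1 \<xi>))"
      using multiplier_on_H1[OF u(1) L'(1)[OF t]] multiplier_on_H1[OF u(2) L'(2)[OF t]] by blast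
    define v where "v = inv_fourier (w u0 u1 t)"
    have "has_fourier (\<lambda>x. h0 x + h1 x) (w u0 u1 t)"
    proof (rule has_fourier_cong[OF has_fourier_add[OF h]])
      show "AE \<xi>::real^'n in lborel. of_real (norm \<xi> powr 0) * (m0 t \<xi> * fourier u0 \<xi>)
          + of_real (norm \<xi> powr 0) * (m1 t \<xi> * fourier u1 \<xi>) = w u0 u1 t \<xi>"
        using AE_lborel_singleton[of "0::real^'n"] by eventually_elim (simp add: w[OF t])
    qed
    note v = has_fourier_inv_fourier[OF this, folded v_def] fourier_L1I[OF this]
    have vi: "integrable lborel v" and va: "AE \<xi> in lborel. fourier v \<xi> = w u0 u1 t \<xi>"
      using v(1) by (auto simp: has_fourier_def)
    have g01: "has_fourier (\<lambda>x. g0 x + g1 x) (\<lambda>\<xi>. of_real (abs_symbol a \<xi>) * fourier v \<xi>)"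
      by (rule has_fourier_cong[OF has_fourier_add[OF g(1,3)]])
         (use va in eventually_elim, simp add: abs_symbol_def w[OF t] distrib_left)
    have "L1_norm (multiplier (abs_symbol a) v) = L1_norm (\<lambda>x. g0 x + g1 x)"
      unfolding multiplier_def by (rule L1_norm_inv_fourier[OF g01])
    also have "\<dots> \<le> L1_norm g0 + L1_norm g1"
      using g(1,3) by (intro L1_norm_add_le) (auto simp: has_fourier_def)
    also have "\<dots> \<le> (C0 + C1) * ((1 + t) powr q0 * H1_norm s0 u0) + (C0 + C1) * ((1 + t) powr q1 * H1_norm s1 u1)"
    proof (intro add_mono)
      show "L1_norm g0 \<le> (C0 + C1) * ((1 + t) powr q0 * H1_norm s0 u0)"
        using g(2) C by (auto intro: order.trans[OF _ mult_right_mono] simp: H1_norm_def L1_norm_nonneg mult.assoc)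
      show "L1_norm g1 \<le> (C0 + C1) * ((1 + t) powr q1 * H1_norm s1 u1)"
        using g(4) C by (auto intro: order.trans[OF _ mult_right_mono] simp: H1_norm_def L1_norm_nonneg mult.assoc)
    qed
    finally show ?thesis
      using v(2) vi fourier_L1I[OF g01] unfolding v_def[symmetric] multiplier_dom_def by (simp add: distrib_left)
  qed
  then show ?thesis using add_pos_pos[OF C] by blast
qed

theorem theorem1p1:
  fixes \<sigma> a N :: real
  assumes "\<sigma> > 1" and "a \<ge> 0"
    and "N = of_int \<lfloor>real CARD('n::finite) / 2\<rfloor>"
  shows
    "(\<exists>C>0. \<forall>u0 u1 :: real ^ 'n \<Rightarrow> complex.
        u0 \<in> H1 a \<longrightarrow> u1 \<in> H1 (max (a - \<sigma>) 0) \<longrightarrow>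
        (\<forall>t\<ge>0.
           solution_hat \<sigma> u0 u1 t \<in> fourier_L1 \<and>
           solution \<sigma> u0 u1 t \<in> multiplier_dom (abs_symbol a) \<and>
           L1_norm (multiplier (abs_symbol a) (solution \<sigma> u0 u1 t))
             \<le> C * ((1 + t) powr ((2 + N) / 2 - a / (2 * \<sigma>)) * H1_norm a u0
                  + (1 + t) powr (1 + (1 + N) / 2 - a / (2 * \<sigma>)) * H1_norm (max (a - \<sigma>) 0) u1)))
   \<and> (\<exists>C>0. \<forall>u0 u1 :: real ^ 'n \<Rightarrow> complex.
        u0 \<in> H1 (2 * \<sigma> + max (a - \<sigma>) 0) \<longrightarrow> u1 \<in> H1 (2 * \<sigma> + max (a - \<sigma>) 0) \<longrightarrow>
        (\<forall>t\<ge>0.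
           solution_t_hat \<sigma> u0 u1 t \<in> fourier_L1 \<and>
           solution_t \<sigma> u0 u1 t \<in> multiplier_dom (abs_symbol a) \<and>
           L1_norm (multiplier (abs_symbol a) (solution_t \<sigma> u0 u1 t))
             \<le> C * ((1 + t) powr ((1 + N) / 2 - a / (2 * \<sigma>)) * H1_norm (2 * \<sigma> + max (a - \<sigma>) 0) u0
                  + (1 + t) powr ((2 + N) / 2 - a / (2 * \<sigma>)) * H1_norm (2 * \<sigma> + max (a - \<sigma>) 0) u1)))"
proof -
  have \<sigma>: "\<sigma> > 1" and a: "a \<ge> 0" by fact+
  have "\<lfloor>real CARD('n) / 2\<rfloor> = int (CARD('n) div 2)" using floor_divide_of_nat_eq[of "CARD('n)" 2, where 'a=real] by simp
  then have "N = real (CARD('n) div 2)" using assms(3) by simp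
  moreover have "CARD('n) \<le> 2 * (CARD('n) div 2) + 1" by arith
  then have "real CARD('n) \<le> real (2 * (CARD('n) div 2) + 1)" by (rule of_nat_mono)
  ultimately have N: "N \<ge> (real CARD('n) - 1) / 2" by simp
  have K0: "symbol_bound c b (\<lambda>t \<xi>::real^'n. K0 \<sigma> t \<xi>) ((2 + N) / 2 - c / (2 * \<sigma>))" if "c \<ge> 0" "c \<le> b" for b c
    by (rule symbol_bound_K0[OF \<sigma> that(1) N that(2)])
  have K1: "symbol_bound c b (\<lambda>t \<xi>::real^'n. K1 \<sigma> t \<xi>) (1 + (1 + N) / 2 - c / (2 * \<sigma>))" if "c \<ge> 0" "max (c - \<sigma>) 0 \<le> b" for b c
    by (rule symbol_bound_K1[OF \<sigma> that(1) N that(2)])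
  have p: "symbol_bound c b (\<lambda>t \<xi>::real^'n. - (laplace_power \<sigma> \<xi> * K1 \<sigma> t \<xi>)) ((1 + N) / 2 - c / (2 * \<sigma>))"
    if "c \<ge> 0" "c + \<sigma> \<le> b" for b c
    by (rule symbol_bound_laplace_K1[OF \<sigma> that(1) N that(2)])
  have q: "symbol_bound c b (\<lambda>t \<xi>::real^'n. K0 \<sigma> t \<xi> + - (laplace_power \<sigma> \<xi> * K1 \<sigma> t \<xi>)) ((2 + N) / 2 - c / (2 * \<sigma>))"
    if "c \<ge> 0" "c + \<sigma> \<le> b" for b c
    using that \<sigma> by (intro symbol_bound_add K0 symbol_bound_mono[OF p[OF that]]) auto
  show ?thesis
    unfolding solution_def solution_t_def
  proof (intro conjI estimate_of_symbol_bounds)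
    show "symbol_bound a a (\<lambda>t \<xi>::real^'n. K0 \<sigma> t \<xi>) ((2 + N) / 2 - a / (2 * \<sigma>))" by (rule K0[OF a order_refl])
    show "symbol_bound 0 a (\<lambda>t \<xi>::real^'n. K0 \<sigma> t \<xi>) ((2 + N) / 2 - 0 / (2 * \<sigma>))" by (rule K0[OF order_refl a])
    show "symbol_bound a (max (a - \<sigma>) 0) (\<lambda>t \<xi>::real^'n. K1 \<sigma> t \<xi>) (1 + (1 + N) / 2 - a / (2 * \<sigma>))"
      by (rule K1[OF a order_refl])
    show "symbol_bound 0 (max (a - \<sigma>) 0) (\<lambda>t \<xi>::real^'n. K1 \<sigma> t \<xi>) (1 + (1 + N) / 2 - 0 / (2 * \<sigma>))"
      by (rule K1) (use \<sigma> in auto)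
    let ?b = "2 * \<sigma> + max (a - \<sigma>) 0"
    show "symbol_bound a ?b (\<lambda>t \<xi>::real^'n. - (laplace_power \<sigma> \<xi> * K1 \<sigma> t \<xi>)) ((1 + N) / 2 - a / (2 * \<sigma>))"
      by (rule p) (use a \<sigma> in auto)
    show "symbol_bound 0 ?b (\<lambda>t \<xi>::real^'n. - (laplace_power \<sigma> \<xi> * K1 \<sigma> t \<xi>)) ((1 + N) / 2 - 0 / (2 * \<sigma>))"
      by (rule p) (use a \<sigma> in auto)
    show "symbol_bound a ?b (\<lambda>t \<xi>::real^'n. K0 \<sigma> t \<xi> + - (laplace_power \<sigma> \<xi> * K1 \<sigma> t \<xi>)) ((2 + N) / 2 - a / (2 * \<sigma>))"
      by (rule q) (use a \<sigma> in auto)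
    show "symbol_bound 0 ?b (\<lambda>t \<xi>::real^'n. K0 \<sigma> t \<xi> + - (laplace_power \<sigma> \<xi> * K1 \<sigma> t \<xi>)) ((2 + N) / 2 - 0 / (2 * \<sigma>))"
      by (rule q) (use a \<sigma> in auto)
  qed (simp_all add: solution_hat_def solution_t_hat_eq)
qed

end
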